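(* One has $\mathcal I_\infty=\{\Gamma_\mu:\mu\in\mathcal P(\mathcal S)\}$. Moreover, every $\Gamma\in\mathcal I_\infty$ may be represented as $\Gamma_\mu$ where $\mu$ may further be required to satisfy any one of the three normalizations $\mu\in\mathcal P_L(\mathcal S)$, $\mu\in\mathcal P_R(\mathcal S)$, $\mu\in\mathcal P_m(\mathcal S)$; in other words, $$\mathcal I_\infty=\{\Gamma_\mu:\mu\in\mathcal P_L(\mathcal S)\}=\{\Gamma_\mu:\mu\in\mathcal P_R(\mathcal S)\}=\{\Gamma_\mu:\mu\in\mathcal P_m(\mathcal S)\}.$$ Furthermore, the mapping $\mu\mapsto\Gamma_\mu$ is a continuous map of each of $\mathcal P_L(\mathcal S)$, $\mathcal P_R(\mathcal S)$ and $\mathcal P_m(\mathcal S)$ onto $\mathcal I_\infty$.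
   Context: Graphs are finite, simple and undirected; $|G|$ is the number of vertices. For graphs $F,G$, $t(F,G)$ is the probability that a uniformly random map $V(F)\to V(G)$ (among all $|G|^{|F|}$ maps) is a graph homomorphism. A sequence $G_n$ with $|G_n|\to\infty$ converges if $t(F,G_n)$ converges for every graph $F$; its limit is a graph limit $\Gamma$, which is determined by the numbers $t(F,\Gamma)=\lim_n t(F,G_n)$. The set of all graph limits is denoted $\mathcal U_\infty$ and carries the topology of convergence of $t(F,\cdot)$ for every graph $F$ (it is a compact metrizable space). We write $G_n\to\Gamma$ if $|G_n|\to\infty$ and $t(F,G_n)\to t(F,\Gamma)$ for every $F$. A graph $G$ is an interval graph if there are intervals $\{I_i\}_{i\in V(G)}$ such that for all $i\ne j$, $ij\in E(G)$ if and only if $I_i\cap I_j\neq\emptyset$. $\mathcal I_\infty\subset\mathcal U_\infty$ is the set of interval graph limits, i.e. of all $\Gamma\in\mathcal U_\infty$ such that $G_n\to\Gamma$ for some sequence $G_n$ of interval graphs. $\mathcal S=\{[a,b]:0\le a\le b\le1\}$ is the set of non-empty closed subintervals of $[0,1]$ (length $0$ allowed), identified with the compact triangle $\{(a,b):0\le a\le b\le 1\}\subset\mathbb R^2$. $W:\mathcal S\times\mathcal S\to\{0,1\}$ is $W(I,J)=1$ if $I\cap J\ne\emptyset$ and $0$ otherwise. $\mathcal P(\mathcal S)$ is the set of Borel probability measures on $\mathcal S$ with the topology of weak convergence. For $\mu\in\mathcal P(\mathcal S)$, $\Gamma_\mu\in\mathcal U_\infty$ is the unique graph limit with $$t(F,\Gamma_\mu)=\int_{\mathcal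 S^{|F|}}\prod_{ij\in E(F)}W(x_i,x_j)\,d\mu(x_1)\cdots d\mu(x_{|F|})\quad\text{for every graph }F.$$ $\mu_L$ and $\mu_R$ are the marginals of $\mu$, i.e. the images of $\mu$ under $[a,b]\mapsto a$ and $[a,b]\mapsto b$. With $\lambda$ Lebesgue measure on $[0,1]$, $\mathcal P_L(\mathcal S)=\{\mu\in\mathcal P(\mathcal S):\mu_L=\lambda\}$, $\mathcal P_R(\mathcal S)=\{\mu\in\mathcal P(\mathcal S):\mu_R=\lambda\}$, $\mathcal P_m(\mathcal S)=\{\mu\in\mathcal P(\mathcal S):\tfrac12(\mu_L+\mu_R)=\lambda\}$. *)

theory Defs
  imports "HOL-Probability.Probability"
begin

text \<open>Every finite simple graph is isomorphic to one whose vertices are natural numbers, and all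
  notions below are invariant under isomorphism.\<close>

typedef fgraph =
  "{(V, E) :: nat set \<times> nat set set | V E. finite V \<and> E \<subseteq> {e. e \<subseteq> V \<and> card e = 2}}"
  by (rule exI[of _ "({}, {})"]) auto

definition verts :: "fgraph \<Rightarrow> nat set" where
  "verts G = fst (Rep_fgraph G)"

definition edges :: "fgraph \<Rightarrow> nat set set" where
  "edges G = snd (Rep_fgraph G)"

definition graph_homs :: "fgraph \<Rightarrow> fgraph \<Rightarrow> (nat \<Rightarrow> nat) set" where
  "graph_homs F G =
     {\<phi> \<in> verts F \<rightarrow>\<^sub>E verts G. \<forall>i j. {i, j} \<in> edges F \<longrightarrow> {\<phi> i, \<phi> j} \<in> edges G}"

definition hom_density :: "fgraph \<Rightarrow> fgraph \<Rightarrow> real" where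
  "hom_density F G = real (card (graph_homs F G)) / real (card (verts F \<rightarrow>\<^sub>E verts G))"

text \<open>A graph limit \<open>\<Gamma>\<close> is determined by the numbers \<open>t(F, \<Gamma>)\<close>, and we identify it with the
  function \<open>F \<mapsto> t(F, \<Gamma>)\<close>.\<close>

definition graph_tendsto :: "(nat \<Rightarrow> fgraph) \<Rightarrow> (fgraph \<Rightarrow> real) \<Rightarrow> bool" where
  "graph_tendsto G \<Gamma> \<longleftrightarrow>
     filterlim (\<lambda>n. card (verts (G n))) at_top sequentially \<and>
     (\<forall>F. (\<lambda>n. hom_density F (G n)) \<longlonglongrightarrow> \<Gamma> F)"

definition graph_limits :: "(fgraph \<Rightarrow> real) set" where
  "graph_limits = {\<Gamma>. \<exists>G. graph_tendsto G \<Gamma>}"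

definition graph_limit_topology :: "(fgraph \<Rightarrow> real) topology" where
  "graph_limit_topology = subtopology (product_topology (\<lambda>_. euclideanreal) UNIV) graph_limits"

definition interval_graph :: "fgraph \<Rightarrow> bool" where
  "interval_graph G \<longleftrightarrow>
     (\<exists>I :: nat \<Rightarrow> real set.
        (\<forall>i \<in> verts G. is_interval (I i)) \<and>
        (\<forall>i \<in> verts G. \<forall>j \<in> verts G. i \<noteq> j \<longrightarrow> ({i, j} \<in> edges G \<longleftrightarrow> I i \<inter> I j \<noteq> {})))"

definition interval_graph_limits :: "(fgraph \<Rightarrow> real) set" where
  "interval_graph_limits =
     {\<Gamma> \<in> graph_limits. \<exists>G. (\<forall>n. interval_graph (G n)) \<and> graph_tendsto G \<Gamma>}"

text \<open>The pair \<open>(a, b)\<close> stands for the interval \<open>[a, b]\<close>.\<close>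

definition intervals :: "(real \<times> real) set" where
  "intervals = {(a, b). 0 \<le> a \<and> a \<le> b \<and> b \<le> 1}"

definition interval_kernel :: "real \<times> real \<Rightarrow> real \<times> real \<Rightarrow> real" where
  "interval_kernel I J = (if {fst I..snd I} \<inter> {fst J..snd J} \<noteq> {} then 1 else 0)"

definition interval_measures :: "(real \<times> real) measure set" where
  "interval_measures = {\<mu>. prob_space \<mu> \<and> sets \<mu> = sets (restrict_space borel intervals)}"

text \<open>The topology of weak convergence is the coarsest one that makes \<open>\<mu> \<mapsto> \<integral>x. f x \<partial>\<mu>\<close> continuous
  for every continuous \<open>f\<close> on \<^term>\<open>intervals\<close>; as \<^term>\<open>intervals\<close> is compact, all such \<open>f\<close> are
  bounded.\<close>

definition weak_topology :: "(real \<times> real) measure topology" where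
  "weak_topology =
     (let C = {f :: real \<times> real \<Rightarrow> real. continuous_on intervals f}
      in pullback_topology interval_measures (\<lambda>\<mu>. \<lambda>f\<in>C. \<integral>x. f x \<partial>\<mu>)
           (product_topology (\<lambda>_. euclideanreal) C))"

text \<open>In the product, each edge \<open>ij\<close> is counted once, as the pair with \<open>i < j\<close>.\<close>

definition interval_limit :: "(real \<times> real) measure \<Rightarrow> fgraph \<Rightarrow> real" where
  "interval_limit \<mu> F =
     (\<integral>x. (\<Prod>(i, j) \<in> {(i, j). i < j \<and> {i, j} \<in> edges F}. interval_kernel (x i) (x j))
        \<partial>(\<Pi>\<^sub>M i\<in>verts F. \<mu>))"

definition lebesgue01 :: "real measure" where
  "lebesgue01 = restrict_space lborel {0..1}"

definition left_marginal :: "(real \<times> real) measure \<Rightarrow> real measure" where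
  "left_marginal \<mu> = distr \<mu> (restrict_space borel {0..1}) fst"

definition right_marginal :: "(real \<times> real) measure \<Rightarrow> real measure" where
  "right_marginal \<mu> = distr \<mu> (restrict_space borel {0..1}) snd"

definition interval_measures_L :: "(real \<times> real) measure set" where
  "interval_measures_L = {\<mu> \<in> interval_measures. left_marginal \<mu> = lebesgue01}"

definition interval_measures_R :: "(real \<times> real) measure set" where
  "interval_measures_R = {\<mu> \<in> interval_measures. right_marginal \<mu> = lebesgue01}"

definition interval_measures_m :: "(real \<times> real) measure set" where
  "interval_measures_m =
     {\<mu> \<in> interval_measures. \<forall>A \<in> sets lebesgue01.
        (measure (left_marginal \<mu>) A + measure (right_marginal \<mu>) A) / 2 = measure lebesgue01 A}"

end

theory Submission
  imports Defs
begin

text \<open>Two intervals meet if and only if each of them begins no later than the other one ends. Hence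
  the density of \<open>F\<close> in \<open>\<Gamma>\<^sub>\<mu>\<close> is the probability that, for independent random intervals with law
  \<open>\<mu>\<close>, one at each vertex of \<open>F\<close>, every comparison \<open>left endpoint \<le> right endpoint\<close> along the edges
  (in both orientations) holds. Everything rests on how these comparisons behave.

  Every \<open>\<Gamma>\<^sub>\<mu>\<close> is a limit of interval graphs because a large sample from \<open>\<mu>\<close> spans an interval graph
  whose densities are V-statistics, up to the few maps that are not injective; their second moment
  about \<open>\<Gamma>\<^sub>\<mu>\<close> vanishes as the sample grows (\<open>V_statistic_second_moment\<close>,
  \<open>interval_limit_is_interval_graph_limit\<close>).

  The normalizations come from the randomized rank transform, the distribution function with its
  jumps filled in by an independent uniform variable (\<open>distr_rank_at\<close>). It is nondecreasing, so it
  never reverses a comparison, and the two endpoints are placed inside a jump in such a way that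
  almost surely ties are neither created nor wrongly resolved (\<open>interval_limit_rank_interval\<close>).
  With the distribution function of the left or of the right marginal it produces the first two
  normalizations without changing any density; with that of the averaged marginal of a
  left-normalized measure it produces the third.

  In each normalization at least one endpoint has a law with density at most 2, so that a
  left and a right endpoint of independent intervals are within \<open>\<delta>\<close> of each other with probability at most \<open>4 \<delta>\<close>,
  uniformly in \<open>\<mu>\<close> (\<open>near_tie_probability\<close>). The discontinuous comparison can therefore be replaced,
  with a uniformly small error, by a continuous function that is a finite sum of products of
  functions of a single endpoint; after this replacement a density is a polynomial in integrals of
  continuous functions. Being a uniform limit of weakly continuous functions, the density is weakly
  continuous (\<open>continuous_map_interval_limit_at\<close>).

  Conversely, let interval graphs \<open>G\<^sub>n\<close> converge to \<open>\<Gamma>\<close>. The empirical measure of the intervals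
  that represent \<open>G\<^sub>n\<close> has nearly the densities of \<open>G\<^sub>n\<close>, and its rank transform is left-normalized
  and has the same densities. A subsequence converges weakly (\<open>weak_sequential_compactness\<close>), its
  limit is left-normalized (\<open>left_normalized_closed\<close>), and by continuity it represents \<open>\<Gamma>\<close>.\<close>

section \<open>Independent coordinates\<close>

lemma pair_marginal_PiM:
  assumes "prob_space M" "i \<in> I" "j \<in> I" "i \<noteq> j"
  shows "distr (PiM I (\<lambda>_. M)) (M \<Otimes>\<^sub>M M) (\<lambda>x. (x i, x j)) = M \<Otimes>\<^sub>M M"
proof (rule pair_measure_eqI[symmetric])
  interpret M: prob_space M by fact
  interpret P: product_prob_space "\<lambda>_. M" I by standard
  show "sigma_finite_measure M" "sigma_finite_measure M" by standard+
  fix A B assume AB [measurable]: "A \<in> sets M" "B \<in> sets M"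
  note [measurable] = assms(2,3)
  have "emeasure (distr (PiM I (\<lambda>_. M)) (M \<Otimes>\<^sub>M M) (\<lambda>x. (x i, x j))) (A \<times> B)
      = emeasure (PiM I (\<lambda>_. M)) {x \<in> space (PiM I (\<lambda>_. M)). \<forall>k\<in>{i, j}. x k \<in> (if k = i then A else B)}"
    using assms by (subst emeasure_distr) (auto intro!: arg_cong2[where f = emeasure])
  also have "\<dots> = (\<Prod>k\<in>{i, j}. emeasure M (if k = i then A else B))"
    using assms by (intro P.emeasure_PiM_Collect) auto
  also have "\<dots> = emeasure M A * emeasure M B"
    using assms by simp
  finally show "emeasure M A * emeasure M B
    = emeasure (distr (PiM I (\<lambda>_. M)) (M \<Otimes>\<^sub>M M) (\<lambda>x. (x i, x j))) (A \<times> B)" ..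
qed simp

lemma AE_PiM_pair:
  assumes "prob_space M" "i \<in> I" "j \<in> I" "i \<noteq> j" and "AE z in M \<Otimes>\<^sub>M M. P (fst z) (snd z)"
  shows "AE x in PiM I (\<lambda>_. M). P (x i) (x j)"
proof -
  have "AE z in distr (PiM I (\<lambda>_. M)) (M \<Otimes>\<^sub>M M) (\<lambda>x. (x i, x j)). P (fst z) (snd z)"
    unfolding pair_marginal_PiM[OF assms(1-4)] by (rule assms(5))
  moreover have "(\<lambda>x. (x i, x j)) \<in> PiM I (\<lambda>_. M) \<rightarrow>\<^sub>M M \<Otimes>\<^sub>M M"
    using assms(2,3) by (intro measurable_Pair measurable_component_singleton)
  ultimately have "AE x in PiM I (\<lambda>_. M). P (fst (x i, x j)) (snd (x i, x j))"
    by (rule AE_distrD[rotated])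
  then show ?thesis by simp
qed

lemma indep_vars_PiM_coordinates:
  assumes "prob_space M" "I \<noteq> {}"
  shows "prob_space.indep_vars (PiM I (\<lambda>_. M)) (\<lambda>_. M) (\<lambda>i x. x i) I"
proof -
  interpret P: prob_space "PiM I (\<lambda>_. M)"
    using assms by (intro prob_space_PiM)
  have "distr (PiM I (\<lambda>_. M)) (PiM I (\<lambda>_. M)) (\<lambda>x. \<lambda>i\<in>I. x i)
      = distr (PiM I (\<lambda>_. M)) (PiM I (\<lambda>_. M)) (\<lambda>x. x)"
    by (intro distr_cong) (auto simp: space_PiM)
  also have "\<dots> = PiM I (\<lambda>i. distr (PiM I (\<lambda>_. M)) M (\<lambda>x. x i))"
    using assms by (auto simp: distr_id intro!: PiM_cong distr_PiM_component[symmetric])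
  finally show ?thesis
    using assms(2) by (subst P.indep_vars_iff_distr_eq_PiM') auto
qed

lemma integral_PiM_reindex:
  fixes f :: "('i \<Rightarrow> 'a) \<Rightarrow> real"
  assumes "prob_space M" "inj_on \<phi> V" "\<phi> \<in> V \<rightarrow> I"
    and [measurable]: "f \<in> borel_measurable (PiM V (\<lambda>_. M))"
  shows "(\<integral>x. f (\<lambda>i\<in>V. x (\<phi> i)) \<partial>PiM I (\<lambda>_. M)) = (\<integral>x. f x \<partial>PiM V (\<lambda>_. M))"
proof -
  have [measurable]: "(\<lambda>x. \<lambda>i\<in>V. x (\<phi> i)) \<in> PiM I (\<lambda>_. M) \<rightarrow>\<^sub>M PiM V (\<lambda>_. M)"
    using assms(3) by (intro measurable_restrict measurable_component_singleton) auto
  have "(\<integral>x. f x \<partial>PiM V (\<lambda>_. M))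
     = (\<integral>x. f x \<partial>distr (PiM I (\<lambda>_. M)) (PiM V (\<lambda>_. M)) (\<lambda>x. \<lambda>i\<in>V. x (\<phi> i)))"
    using assms by (subst distr_PiM_reindex) auto
  also have "\<dots> = (\<integral>x. f (\<lambda>i\<in>V. x (\<phi> i)) \<partial>PiM I (\<lambda>_. M))"
    by (subst integral_distr) auto
  finally show ?thesis ..
qed

lemma integral_PiM_mult_disjoint:
  fixes f :: "('i \<Rightarrow> 'a) \<Rightarrow> real" and g :: "('j \<Rightarrow> 'a) \<Rightarrow> real"
  assumes M: "prob_space M" and "I \<noteq> {}"
    and "\<phi> \<in> V \<rightarrow> I" "\<psi> \<in> W \<rightarrow> I" "\<phi> ` V \<inter> \<psi> ` W = {}"
    and [measurable]: "f \<in> borel_measurable (PiM V (\<lambda>_. M))" "g \<in> borel_measurable (PiM W (\<lambda>_. M))"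
    and f: "\<And>x. \<bar>f x\<bar> \<le> 1" and g: "\<And>x. \<bar>g x\<bar> \<le> 1"
  shows "(\<integral>x. f (\<lambda>i\<in>V. x (\<phi> i)) * g (\<lambda>i\<in>W. x (\<psi> i)) \<partial>PiM I (\<lambda>_. M))
    = (\<integral>x. f (\<lambda>i\<in>V. x (\<phi> i)) \<partial>PiM I (\<lambda>_. M)) * (\<integral>x. g (\<lambda>i\<in>W. x (\<psi> i)) \<partial>PiM I (\<lambda>_. M))"
proof -
  interpret P: prob_space "PiM I (\<lambda>_. M)" using M by (intro prob_space_PiM)
  let ?f = "\<lambda>y. f (\<lambda>i\<in>V. y (\<phi> i))" and ?g = "\<lambda>y. g (\<lambda>i\<in>W. y (\<psi> i))"
  have [measurable]: "(\<lambda>x. \<lambda>i\<in>V. x (\<phi> i)) \<in> PiM (\<phi> ` V) (\<lambda>_. M) \<rightarrow>\<^sub>M PiM V (\<lambda>_. M)"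
    "(\<lambda>x. \<lambda>i\<in>W. x (\<psi> i)) \<in> PiM (\<psi> ` W) (\<lambda>_. M) \<rightarrow>\<^sub>M PiM W (\<lambda>_. M)"
    "(\<lambda>x. \<lambda>i\<in>V. x (\<phi> i)) \<in> PiM I (\<lambda>_. M) \<rightarrow>\<^sub>M PiM V (\<lambda>_. M)"
    "(\<lambda>x. \<lambda>i\<in>W. x (\<psi> i)) \<in> PiM I (\<lambda>_. M) \<rightarrow>\<^sub>M PiM W (\<lambda>_. M)"
    using assms(3,4) by (auto intro!: measurable_restrict measurable_component_singleton)
  have "P.indep_var (PiM (\<phi> ` V) (\<lambda>_. M)) (\<lambda>x. restrict (\<lambda>i. x i) (\<phi> ` V))
      (PiM (\<psi> ` W) (\<lambda>_. M)) (\<lambda>x. restrict (\<lambda>i. x i) (\<psi> ` W))"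
    using assms by (intro P.indep_var_restrict[OF indep_vars_PiM_coordinates]) auto
  then have "P.indep_var borel (?f \<circ> (\<lambda>x. restrict (\<lambda>i. x i) (\<phi> ` V)))
      borel (?g \<circ> (\<lambda>x. restrict (\<lambda>i. x i) (\<psi> ` W)))"
    by (rule P.indep_var_compose) measurable
  moreover have "?f \<circ> (\<lambda>x. restrict (\<lambda>i. x i) (\<phi> ` V)) = ?f" "?g \<circ> (\<lambda>x. restrict (\<lambda>i. x i) (\<psi> ` W)) = ?g"
    by (auto simp: fun_eq_iff intro!: arg_cong[where f = f] arg_cong[where f = g])
  ultimately have "P.indep_var borel ?f borel ?g" by simp
  then show ?thesis
    by (intro P.indep_var_lebesgue_integral P.integrable_const_bound[where B = 1])
      (auto intro!: f g simp: real_norm_def)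
qed

section \<open>V-statistics\<close>

text \<open>Two given positions receive the same value in a fraction \<open>1 / card N\<close> of all maps.\<close>

lemma card_noninjective:
  assumes "finite V" "finite N"
  shows "card {\<phi> \<in> V \<rightarrow>\<^sub>E N. \<not> inj_on \<phi> V} * card N \<le> (card V)\<^sup>2 * card N ^ card V"
proof -
  let ?C = "\<lambda>(i, j). {\<phi> \<in> V \<rightarrow>\<^sub>E N. \<phi> i = \<phi> j}"
  let ?D = "{(i, j) \<in> V \<times> V. i \<noteq> j}"
  have fin: "finite (V \<rightarrow>\<^sub>E N)" using assms by (intro finite_PiE) auto
  have finD: "finite ?D" using assms by (auto intro: finite_subset[of _ "V \<times> V"])
  have C: "card (?C p) * card N \<le> card N ^ card V" if p: "p \<in> ?D" for p
  proof -
    obtain i j where ij: "p = (i, j)" "i \<in> V" "j \<in> V" "i \<noteq> j" using p by auto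
    have "inj_on (\<lambda>\<phi>. restrict \<phi> (V - {j})) (?C p)"
    proof (rule inj_onI)
      fix \<phi> \<psi> assume *: "\<phi> \<in> ?C p" "\<psi> \<in> ?C p" "restrict \<phi> (V - {j}) = restrict \<psi> (V - {j})"
      have "\<phi> k = \<psi> k" if "k \<in> V - {j}" for k using fun_cong[OF *(3), of k] that by simp
      then have "\<phi> k = \<psi> k" if "k \<in> V" for k using that * ij by (cases "k = j") auto
      then show "\<phi> = \<psi>" using * ij by (intro PiE_ext[of _ V "\<lambda>_. N" \<psi>]) auto
    qed
    moreover have "(\<lambda>\<phi>. restrict \<phi> (V - {j})) ` ?C p \<subseteq> (V - {j}) \<rightarrow>\<^sub>E N"
      using ij by (intro image_subsetI) (simp add: restrict_PiE_iff PiE_iff)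
    ultimately have "card (?C p) \<le> card ((V - {j}) \<rightarrow>\<^sub>E N)"
      using assms by (intro card_inj_on_le[OF _ _ finite_PiE]) auto
    also have "\<dots> = card N ^ (card V - 1)"
      using assms ij by (simp add: card_funcsetE)
    finally have "card (?C p) * card N \<le> card N ^ (card V - 1) * card N" by simp
    also have "\<dots> = card N ^ card V"
      using assms ij card_gt_0_iff[of V] by (metis Suc_diff_1 empty_iff power_Suc2)
    finally show ?thesis .
  qed
  have "{\<phi> \<in> V \<rightarrow>\<^sub>E N. \<not> inj_on \<phi> V} \<subseteq> (\<Union>p\<in>?D. ?C p)"
    by (force simp: inj_on_def)
  then have "card {\<phi> \<in> V \<rightarrow>\<^sub>E N. \<not> inj_on \<phi> V} \<le> card (\<Union>p\<in>?D. ?C p)"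
    using fin finD by (intro card_mono finite_UN_I) (auto intro: finite_subset)
  also have "\<dots> \<le> (\<Sum>p\<in>?D. card (?C p))" by (rule card_UN_le[OF finD])
  finally have "card {\<phi> \<in> V \<rightarrow>\<^sub>E N. \<not> inj_on \<phi> V} * card N \<le> (\<Sum>p\<in>?D. card (?C p) * card N)"
    by (simp flip: sum_distrib_right)
  also have "\<dots> \<le> (\<Sum>p\<in>?D. card N ^ card V)" using C by (intro sum_mono) auto
  also have "\<dots> \<le> (card V)\<^sup>2 * card N ^ card V"
  proof -
    have "card ?D \<le> card (V \<times> V)" using assms by (intro card_mono) auto
    then show ?thesis using assms by (simp add: power2_eq_square)
  qed
  finally show ?thesis .
qed

text \<open>A pair of maps is a single map on two disjoint copies of the domain, and it is injective there if
  and only if both maps are injective with disjoint images.\<close>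

lemma card_noninjective_pairs:
  assumes "finite V" "finite N"
  shows "card {(\<phi>, \<psi>) \<in> (V \<rightarrow>\<^sub>E N) \<times> (V \<rightarrow>\<^sub>E N). \<not> (inj_on \<phi> V \<and> inj_on \<psi> V \<and> \<phi> ` V \<inter> \<psi> ` V = {})} * card N
     \<le> (2 * card V)\<^sup>2 * (card N ^ card V)\<^sup>2" (is "card ?B * _ \<le> _")
proof -
  let ?V = "V \<times> (UNIV :: bool set)"
  let ?h = "\<lambda>(\<phi>, \<psi>). \<lambda>(i, b) \<in> ?V. if b then \<phi> i else \<psi> i"
  have "inj_on ?h ?B"
  proof (rule inj_onI, clarify)
    fix \<phi> \<psi> \<phi>' \<psi>'
    assume P: "\<phi> \<in> V \<rightarrow>\<^sub>E N" "\<psi> \<in> V \<rightarrow>\<^sub>E N" "\<phi>' \<in> V \<rightarrow>\<^sub>E N" "\<psi>' \<in> V \<rightarrow>\<^sub>E N"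
      and eq: "(\<lambda>(i, b) \<in> ?V. if b then \<phi> i else \<psi> i) = (\<lambda>(i, b) \<in> ?V. if b then \<phi>' i else \<psi>' i)"
    have "\<phi> i = \<phi>' i" "\<psi> i = \<psi>' i" if "i \<in> V" for i
      using fun_cong[OF eq, of "(i, True)"] fun_cong[OF eq, of "(i, False)"] that by auto
    then show "\<phi> = \<phi>' \<and> \<psi> = \<psi>'" using PiE_ext[OF P(1,3)] PiE_ext[OF P(2,4)] by simp
  qed
  moreover have "?h ` ?B \<subseteq> {\<rho> \<in> ?V \<rightarrow>\<^sub>E N. \<not> inj_on \<rho> ?V}"
  proof clarify
    fix \<phi> \<psi> assume P: "\<phi> \<in> V \<rightarrow>\<^sub>E N" "\<psi> \<in> V \<rightarrow>\<^sub>E N"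
      and *: "\<not> (inj_on \<phi> V \<and> inj_on \<psi> V \<and> \<phi> ` V \<inter> \<psi> ` V = {})"
    have "\<not> inj_on (\<lambda>(i, b) \<in> ?V. if b then \<phi> i else \<psi> i) ?V"
    proof
      assume inj: "inj_on (\<lambda>(i, b) \<in> ?V. if b then \<phi> i else \<psi> i) ?V"
      have "i = j" if "i \<in> V" "j \<in> V" "\<phi> i = \<phi> j" for i j
        using inj_onD[OF inj, of "(i, True)" "(j, True)"] that by simp
      then have "inj_on \<phi> V" by (rule inj_onI)
      moreover have "i = j" if "i \<in> V" "j \<in> V" "\<psi> i = \<psi> j" for i j
        using inj_onD[OF inj, of "(i, False)" "(j, False)"] that by simp
      then have "inj_on \<psi> V" by (rule inj_onI)
      moreover have "\<phi> i \<noteq> \<psi> j" if "i \<in> V" "j \<in> V" for i j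
      proof
        assume "\<phi> i = \<psi> j"
        then show False using inj_onD[OF inj, of "(i, True)" "(j, False)"] that by simp
      qed
      ultimately show False using * by blast
    qed
    moreover have "(\<lambda>(i, b) \<in> ?V. if b then \<phi> i else \<psi> i) \<in> ?V \<rightarrow>\<^sub>E N"
      using P by (auto simp: restrict_PiE_iff)
    ultimately show "(\<lambda>(i, b) \<in> ?V. if b then \<phi> i else \<psi> i) \<in> ?V \<rightarrow>\<^sub>E N
      \<and> \<not> inj_on (\<lambda>(i, b) \<in> ?V. if b then \<phi> i else \<psi> i) ?V" by (rule conjI[rotated])
  qed
  moreover have "finite {\<rho> \<in> ?V \<rightarrow>\<^sub>E N. \<not> inj_on \<rho> ?V}"
    using assms by (intro finite_subset[OF _ finite_PiE[of ?V "\<lambda>_. N"]]) auto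
  ultimately have "card ?B \<le> card {\<rho> \<in> ?V \<rightarrow>\<^sub>E N. \<not> inj_on \<rho> ?V}"
    by (rule card_inj_on_le)
  then have "card ?B * card N \<le> card {\<rho> \<in> ?V \<rightarrow>\<^sub>E N. \<not> inj_on \<rho> ?V} * card N" by simp
  also have "\<dots> \<le> (card ?V)\<^sup>2 * card N ^ card ?V"
    using assms by (intro card_noninjective) auto
  also have "\<dots> = (2 * card V)\<^sup>2 * (card N ^ card V)\<^sup>2"
    by (simp add: card_cartesian_product mult.commute flip: power_mult)
  finally show ?thesis .
qed

text \<open>Expanding the square gives a sum over pairs of maps. If both maps are injective with disjoint
  images, the two centred factors are independent and contribute nothing; the remaining pairs form a
  fraction of order \<open>1 / n\<close>.\<close>

lemma V_statistic_second_moment: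
  fixes f :: "('i \<Rightarrow> 'a) \<Rightarrow> real"
  assumes M: "prob_space M" and V: "finite V" and n: "n > 0"
    and [measurable]: "f \<in> borel_measurable (PiM V (\<lambda>_. M))"
    and f: "\<And>x. 0 \<le> f x" "\<And>x. f x \<le> 1"
  shows "(\<integral>x. ((\<Sum>\<phi>\<in>V \<rightarrow>\<^sub>E {..<n}. f (\<lambda>i\<in>V. x (\<phi> i))) / real n ^ card V
      - (\<integral>x. f x \<partial>PiM V (\<lambda>_. M)))\<^sup>2 \<partial>PiM {..<n} (\<lambda>_. M)) \<le> (2 * real (card V))\<^sup>2 / real n"
proof -
  let ?P = "PiM {..<n} (\<lambda>_. M)" and ?N = "V \<rightarrow>\<^sub>E {..<n}"
  interpret P: prob_space ?P using M by (intro prob_space_PiM)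
  interpret Q: prob_space "PiM V (\<lambda>_. M)" using M by (intro prob_space_PiM)
  define t where "t = (\<integral>x. f x \<partial>PiM V (\<lambda>_. M))"
  have fint: "integrable (PiM V (\<lambda>_. M)) f"
    using f by (intro Q.integrable_const_bound[where B = 1]) auto
  have t: "0 \<le> t" "t \<le> 1"
  proof -
    show "0 \<le> t" unfolding t_def using f by (intro Bochner_Integration.integral_nonneg) auto
    show "t \<le> 1" unfolding t_def using f by (intro Q.integral_le_const fint) auto
  qed
  define g where "g x = f x - t" for x
  have g_meas [measurable]: "g \<in> borel_measurable (PiM V (\<lambda>_. M))" unfolding g_def by measurable
  have g1: "\<bar>g x\<bar> \<le> 1" for x using f[of x] t by (auto simp: g_def)
  have g0: "(\<integral>x. g x \<partial>PiM V (\<lambda>_. M)) = 0"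
    unfolding g_def using fint by (simp add: t_def Q.prob_space)
  let ?G = "\<lambda>\<phi> x. g (\<lambda>i\<in>V. x (\<phi> i))"
  have Gm: "?G \<phi> \<in> borel_measurable ?P" if "\<phi> \<in> ?N" for \<phi>
  proof -
    have "(\<lambda>x. \<lambda>i\<in>V. x (\<phi> i)) \<in> ?P \<rightarrow>\<^sub>M PiM V (\<lambda>_. M)"
      using that by (intro measurable_restrict measurable_component_singleton) auto
    then show ?thesis by measurable
  qed
  have Gi: "integrable ?P (\<lambda>x. ?G \<phi> x * ?G \<psi> x)" if "\<phi> \<in> ?N" "\<psi> \<in> ?N" for \<phi> \<psi>
    using Gm[OF that(1)] Gm[OF that(2)] g1
    by (intro P.integrable_const_bound[where B = 1])
       (auto simp: abs_mult intro!: mult_le_one)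
  let ?B = "{(\<phi>, \<psi>) \<in> ?N \<times> ?N. \<not> (inj_on \<phi> V \<and> inj_on \<psi> V \<and> \<phi> ` V \<inter> \<psi> ` V = {})}"
  have finN: "finite ?N" using V by (intro finite_PiE) auto
  have cardN: "card ?N = n ^ card V" using V by (simp add: card_funcsetE)
  have good: "(\<integral>x. ?G \<phi> x * ?G \<psi> x \<partial>?P) = 0" if "(\<phi>, \<psi>) \<in> ?N \<times> ?N - ?B" for \<phi> \<psi>
  proof -
    have "\<phi> \<in> V \<rightarrow> {..<n}" "\<psi> \<in> V \<rightarrow> {..<n}" "inj_on \<phi> V" "\<phi> ` V \<inter> \<psi> ` V = {}" using that by auto
    then have "(\<integral>x. ?G \<phi> x * ?G \<psi> x \<partial>?P) = (\<integral>x. ?G \<phi> x \<partial>?P) * (\<integral>x. ?G \<psi> x \<partial>?P)"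
      using n g1 by (intro integral_PiM_mult_disjoint[OF M]) auto
    also have "(\<integral>x. ?G \<phi> x \<partial>?P) = 0"
      using \<open>\<phi> \<in> V \<rightarrow> {..<n}\<close> \<open>inj_on \<phi> V\<close> g0 by (subst integral_PiM_reindex[OF M]) auto
    finally show ?thesis by (simp only: mult_zero_left)
  qed
  have bad: "(\<integral>x. ?G \<phi> x * ?G \<psi> x \<partial>?P) \<le> 1" if "(\<phi>, \<psi>) \<in> ?B" for \<phi> \<psi>
  proof -
    have "?G \<phi> x * ?G \<psi> x \<le> 1" for x
      using abs_le_D1[of "?G \<phi> x * ?G \<psi> x" 1] g1 by (simp add: abs_mult mult_le_one)
    then show ?thesis using Gi[of \<phi> \<psi>] that by (intro P.integral_le_const) auto
  qed
  have "(\<Sum>\<phi>\<in>?N. f (\<lambda>i\<in>V. x (\<phi> i))) / real n ^ card V - t = (\<Sum>\<phi>\<in>?N. ?G \<phi> x) / real n ^ card V" for x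
    using n by (simp add: g_def sum_subtractf cardN field_simps)
  then have "((\<Sum>\<phi>\<in>?N. f (\<lambda>i\<in>V. x (\<phi> i))) / real n ^ card V - t)\<^sup>2
      = (\<Sum>(\<phi>, \<psi>)\<in>?N \<times> ?N. ?G \<phi> x * ?G \<psi> x) / (real n ^ card V)\<^sup>2" for x
    by (simp add: power2_eq_square power_divide sum_product sum.cartesian_product)
  moreover have "(\<integral>x. (\<Sum>(\<phi>, \<psi>)\<in>?N \<times> ?N. ?G \<phi> x * ?G \<psi> x) \<partial>?P)
      = (\<Sum>(\<phi>, \<psi>)\<in>?N \<times> ?N. \<integral>x. ?G \<phi> x * ?G \<psi> x \<partial>?P)"
    unfolding case_prod_unfold by (rule Bochner_Integration.integral_sum) (intro Gi; auto)
  ultimately have eq: "(\<integral>x. ((\<Sum>\<phi>\<in>?N. f (\<lambda>i\<in>V. x (\<phi> i))) / real n ^ card V - t)\<^sup>2 \<partial>?P)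
      = (\<Sum>(\<phi>, \<psi>)\<in>?N \<times> ?N. \<integral>x. ?G \<phi> x * ?G \<psi> x \<partial>?P) / (real n ^ card V)\<^sup>2"
    by simp
  have "(\<Sum>(\<phi>, \<psi>)\<in>?N \<times> ?N. \<integral>x. ?G \<phi> x * ?G \<psi> x \<partial>?P) = (\<Sum>(\<phi>, \<psi>)\<in>?B. \<integral>x. ?G \<phi> x * ?G \<psi> x \<partial>?P)"
    using finN good by (intro sum.mono_neutral_right) auto
  also have "\<dots> \<le> (\<Sum>p\<in>?B. 1)"
    using bad by (intro sum_mono) auto
  also have "\<dots> = real (card ?B)" by simp
  also have "real (card ?B) \<le> (2 * real (card V))\<^sup>2 * (real n ^ card V)\<^sup>2 / real n"
  proof -
    have "real (card ?B * card {..<n}) \<le> real ((2 * card V)\<^sup>2 * (card {..<n} ^ card V)\<^sup>2)"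
      by (intro of_nat_mono card_noninjective_pairs V) simp
    then have "real (card ?B) * real n \<le> (2 * real (card V))\<^sup>2 * (real n ^ card V)\<^sup>2" by simp
    then show ?thesis using n by (simp add: pos_le_divide_eq)
  qed
  finally have "(\<Sum>(\<phi>, \<psi>)\<in>?N \<times> ?N. \<integral>x. ?G \<phi> x * ?G \<psi> x \<partial>?P) / (real n ^ card V)\<^sup>2
      \<le> (2 * real (card V))\<^sup>2 * (real n ^ card V)\<^sup>2 / real n / (real n ^ card V)\<^sup>2"
    by (rule divide_right_mono) simp
  also have "\<dots> = (2 * real (card V))\<^sup>2 / real n" using n by simp
  finally show ?thesis unfolding eq[symmetric] t_def .
qed


section \<open>Graphs and homomorphism densities\<close>

definition arcs :: "fgraph \<Rightarrow> (nat \<times> nat) set" where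
  "arcs F = {(i, j). {i, j} \<in> edges F}"

lemma finite_verts [simp]: "finite (verts F)"
  using Rep_fgraph[of F] by (auto simp: verts_def)

lemma edges_subset: "edges F \<subseteq> {e. e \<subseteq> verts F \<and> card e = 2}"
  using Rep_fgraph[of F] by (fastforce simp: verts_def edges_def)

lemma arcsD:
  assumes "(i, j) \<in> arcs F"
  shows "i \<in> verts F" "j \<in> verts F" "i \<noteq> j" "(j, i) \<in> arcs F"
proof -
  have e: "{i, j} \<subseteq> verts F" "card {i, j} = 2"
    using assms edges_subset[of F] by (auto simp: arcs_def)
  then show "i \<in> verts F" "j \<in> verts F" by auto
  show "i \<noteq> j" using e(2) by auto
  show "(j, i) \<in> arcs F" using assms by (simp add: arcs_def insert_commute)
qed

lemma arcs_subset: "arcs F \<subseteq> verts F \<times> verts F"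
  using arcsD by auto

lemma finite_arcs [simp]: "finite (arcs F)"
  by (rule finite_subset[OF arcs_subset]) simp

text \<open>Countability allows a diagonal choice of one sequence of graphs that serves all densities.\<close>

lemma countable_fgraphs: "countable (UNIV :: fgraph set)"
proof -
  have "range Rep_fgraph \<subseteq> Collect finite \<times> {E. finite E \<and> E \<subseteq> Collect finite}"
  proof (rule image_subsetI)
    fix F
    have "edges F \<subseteq> Pow (verts F)" using edges_subset[of F] by auto
    then have "finite (edges F)" by (rule finite_subset) simp
    moreover have "edges F \<subseteq> Collect finite"
      using \<open>edges F \<subseteq> Pow (verts F)\<close> finite_subset[OF _ finite_verts[of F]] by blast
    ultimately show "Rep_fgraph F \<in> Collect finite \<times> {E. finite E \<and> E \<subseteq> Collect finite}"
      using finite_verts[of F] by (auto simp: mem_Times_iff simp flip: verts_def edges_def)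
  qed
  moreover have "countable ((Collect finite :: nat set set) \<times> {E. finite E \<and> E \<subseteq> (Collect finite :: nat set set)})"
    by (intro countable_SIGMA countable_Collect_finite_subset) (rule countable_Collect_finite)+
  ultimately have "countable (range Rep_fgraph)" by (rule countable_subset)
  then show ?thesis
    by (rule countable_image_inj_on) (simp add: inj_on_def Rep_fgraph_inject)
qed

text \<open>Every edge enters with both orientations, since two intervals meet if and only if each of them
  begins no later than the other one ends. Every factor compares one left with one right endpoint,
  which is the form on which the rank transform and the smoothing of the kernel act.\<close>

definition overlap :: "fgraph \<Rightarrow> (nat \<Rightarrow> real \<times> real) \<Rightarrow> real" where
  "overlap F x = (\<Prod>(i, j)\<in>arcs F. of_bool (fst (x i) \<le> snd (x j)))"

lemma prod_of_bool: "finite A \<Longrightarrow> (\<Prod>p\<in>A. of_bool (P p)) = (of_bool (\<forall>p\<in>A. P p) :: real)"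
  by (induction A rule: finite_induct) auto

lemma borel_measurable_of_bool_le:
  fixes a b :: "'a \<Rightarrow> real"
  assumes [measurable]: "a \<in> borel_measurable M" "b \<in> borel_measurable M"
  shows "(\<lambda>x. of_bool (a x \<le> b x) :: real) \<in> borel_measurable M"
  by measurable

lemma overlap_eq_of_bool: "overlap F x = of_bool (\<forall>(i, j)\<in>arcs F. fst (x i) \<le> snd (x j))"
  unfolding overlap_def case_prod_unfold by (rule prod_of_bool) simp

lemma overlap_bounds: "0 \<le> overlap F x" "overlap F x \<le> 1"
  by (simp_all add: overlap_eq_of_bool)

lemma overlap_restrict: "overlap F (restrict x (verts F)) = overlap F x"
  unfolding overlap_def by (rule prod.cong) (use arcsD in auto)

lemma measurable_endpoints [measurable (raw)]:
  assumes "sets M = sets (restrict_space borel intervals)"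
  shows "fst \<in> borel_measurable M" "snd \<in> borel_measurable M"
  by (auto simp: measurable_cong_sets[OF assms refl] intro!: measurable_restrict_space1 borel_measurable_continuous_onI continuous_intros)

lemma interval_measuresD:
  assumes "\<mu> \<in> interval_measures"
  shows "prob_space \<mu>" "sets \<mu> = sets (restrict_space borel intervals)" "space \<mu> = intervals"
  using assms sets_eq_imp_space_eq[of \<mu> "restrict_space borel intervals"]
  by (auto simp: interval_measures_def space_restrict_space)

lemma overlap_measurable:
  assumes "\<And>i. i \<in> verts F \<Longrightarrow> fst \<in> borel_measurable (M i)"
    and "\<And>i. i \<in> verts F \<Longrightarrow> snd \<in> borel_measurable (M i)"
  shows "overlap F \<in> borel_measurable (PiM (verts F) M)"
proof -
  have fst: "(\<lambda>x. fst (x i)) \<in> borel_measurable (PiM (verts F) M)"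
    and snd: "(\<lambda>x. snd (x i)) \<in> borel_measurable (PiM (verts F) M)" if "i \<in> verts F" for i
    using that assms[OF that]
    by (auto intro: measurable_compose[OF measurable_component_singleton])
  have "(\<lambda>x. \<Prod>p\<in>arcs F. of_bool (fst (x (fst p)) \<le> snd (x (snd p))) :: real)
      \<in> borel_measurable (PiM (verts F) M)"
  proof (rule borel_measurable_prod)
    fix p assume "p \<in> arcs F"
    then have "(\<lambda>x. fst (x (fst p))) \<in> borel_measurable (PiM (verts F) M)"
      "(\<lambda>x. snd (x (snd p))) \<in> borel_measurable (PiM (verts F) M)"
      using arcsD[of "fst p" "snd p" F] by (auto intro!: fst snd)
    then show "(\<lambda>x. of_bool (fst (x (fst p)) \<le> snd (x (snd p))) :: real)
        \<in> borel_measurable (PiM (verts F) M)"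
      by (rule borel_measurable_of_bool_le)
  qed
  then show ?thesis unfolding overlap_def[abs_def] case_prod_unfold .
qed

lemma interval_kernel_eq:
  assumes "I \<in> intervals" "J \<in> intervals"
  shows "interval_kernel I J = of_bool (fst I \<le> snd J \<and> fst J \<le> snd I)"
proof -
  have "{fst I..snd I} \<inter> {fst J..snd J} \<noteq> {} \<longleftrightarrow> max (fst I) (fst J) \<le> min (snd I) (snd J)"
    by (auto simp: Int_atLeastAtMost)
  then show ?thesis using assms by (auto simp: interval_kernel_def intervals_def)
qed

lemma prod_interval_kernel_eq_overlap:
  assumes "\<And>i. i \<in> verts F \<Longrightarrow> x i \<in> intervals"
  shows "(\<Prod>(i, j)\<in>{(i, j). i < j \<and> {i, j} \<in> edges F}. interval_kernel (x i) (x j)) = overlap F x"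
proof -
  let ?D = "{(i, j). i < j \<and> {i, j} \<in> edges F}"
  have D: "?D = {(i, j) \<in> arcs F. i < j}" by (auto simp: arcs_def)
  have fin: "finite ?D" unfolding D by (rule finite_subset[OF _ finite_arcs]) auto
  have "(\<Prod>(i, j)\<in>?D. interval_kernel (x i) (x j))
      = (\<Prod>p\<in>?D. of_bool (fst (x (fst p)) \<le> snd (x (snd p)) \<and> fst (x (snd p)) \<le> snd (x (fst p))))"
  proof (rule prod.cong[OF refl])
    fix p assume "p \<in> ?D"
    then have "x (fst p) \<in> intervals" "x (snd p) \<in> intervals"
      unfolding D by (auto intro!: assms dest: arcsD)
    then show "(case p of (i, j) \<Rightarrow> interval_kernel (x i) (x j))
        = of_bool (fst (x (fst p)) \<le> snd (x (snd p)) \<and> fst (x (snd p)) \<le> snd (x (fst p)))"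
      by (simp add: case_prod_unfold interval_kernel_eq)
  qed
  also have "\<dots> = of_bool (\<forall>p\<in>?D. fst (x (fst p)) \<le> snd (x (snd p)) \<and> fst (x (snd p)) \<le> snd (x (fst p)))"
    by (rule prod_of_bool[OF fin])
  also have "\<dots> = overlap F x"
  proof -
    have "(i, j) \<in> ?D \<or> (j, i) \<in> ?D" if "(i, j) \<in> arcs F" for i j
      using arcsD[OF that] that by (auto simp: D)
    then have "(\<forall>p\<in>?D. fst (x (fst p)) \<le> snd (x (snd p)) \<and> fst (x (snd p)) \<le> snd (x (fst p)))
        \<longleftrightarrow> (\<forall>(i, j)\<in>arcs F. fst (x i) \<le> snd (x j))"
      using arcsD(4)[of _ _ F] unfolding D by fastforce
    then show ?thesis unfolding overlap_eq_of_bool by simp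
  qed
  finally show ?thesis .
qed

lemma interval_limit_eq:
  assumes "\<mu> \<in> interval_measures"
  shows "interval_limit \<mu> F = (\<integral>x. overlap F x \<partial>PiM (verts F) (\<lambda>_. \<mu>))"
  unfolding interval_limit_def
  using interval_measuresD(3)[OF assms]
  by (intro Bochner_Integration.integral_cong refl prod_interval_kernel_eq_overlap)
     (auto simp: space_PiM)

section \<open>Interval graphs\<close>

definition interval_model :: "fgraph \<Rightarrow> (nat \<Rightarrow> real \<times> real) \<Rightarrow> bool" where
  "interval_model G J \<longleftrightarrow> (\<forall>v\<in>verts G. J v \<in> intervals) \<and>
     (\<forall>v\<in>verts G. \<forall>w\<in>verts G. v \<noteq> w \<longrightarrow>
        ({v, w} \<in> edges G \<longleftrightarrow> fst (J v) \<le> snd (J w) \<and> fst (J w) \<le> snd (J v)))"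

text \<open>Each interval is shrunk to the hull of one chosen common point for every interval that it meets.
  By convexity the hull stays inside, so no intersections are created, and the chosen points keep the
  existing ones.\<close>

lemma intersecting_intervals_compact_model:
  fixes I :: "nat \<Rightarrow> real set"
  assumes "finite V" and "\<forall>v\<in>V. is_interval (I v)"
  shows "\<exists>a b :: nat \<Rightarrow> real. (\<forall>v\<in>V. a v \<le> b v) \<and> (\<forall>v\<in>V. \<forall>w\<in>V. v \<noteq> w \<longrightarrow>
      (I v \<inter> I w \<noteq> {} \<longleftrightarrow> a v \<le> b w \<and> a w \<le> b v))"
proof -
  note I = assms(2)[rule_format]
  define p where "p v w = (SOME x. x \<in> I v \<inter> I w)" for v w
  have p: "p v w \<in> I v" "p v w \<in> I w" if "I v \<inter> I w \<noteq> {}" for v w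
    using that some_in_eq[of "I v \<inter> I w"] by (auto simp: p_def)
  have p_sym: "p v w = p w v" for v w by (simp add: p_def Int_commute)
  define P where "P v = p v ` {w \<in> V. I v \<inter> I w \<noteq> {}}" for v
  have finP: "finite (P v)" for v using assms(1) by (simp add: P_def)
  define U where "U = (\<Union>v\<in>V. P v)"
  have finU: "finite U" using assms(1) finP by (simp add: U_def)
  obtain B where B: "\<And>x. x \<in> U \<Longrightarrow> x < B"
    using finU by (metis Max_ge finite_insert insert_iff le_less_trans less_add_one)
  \<comment> \<open>an empty interval is replaced by a point of its own, to the right of all others\<close>
  define a where "a v = (if I v = {} then B + real v else Min (P v))" for v
  define b where "b v = (if I v = {} then B + real v else Max (P v))" for v
  have PI: "P v \<noteq> {}" "P v \<subseteq> I v" "a v \<in> P v" "b v \<in> P v" "a v \<le> b v" "b v < B"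
    if "v \<in> V" "I v \<noteq> {}" for v
  proof -
    show ne: "P v \<noteq> {}" using that by (auto simp: P_def)
    show "P v \<subseteq> I v" using p by (auto simp: P_def)
    show "a v \<in> P v" "b v \<in> P v" using ne finP that by (auto simp: a_def b_def)
    show "a v \<le> b v" using ne finP[of v] that by (simp add: a_def b_def)
    show "b v < B" using \<open>b v \<in> P v\<close> that by (intro B) (auto simp: U_def)
  qed
  have ab: "a v \<le> b v" if "v \<in> V" for v
    using PI(5)[OF that] by (cases "I v = {}") (auto simp: a_def b_def)
  have "I v \<inter> I w \<noteq> {} \<longleftrightarrow> a v \<le> b w \<and> a w \<le> b v" if vw: "v \<in> V" "w \<in> V" "v \<noteq> w" for v w
  proof (cases "I v = {} \<or> I w = {}")
    case True
    have "\<not> (a v \<le> b w \<and> a w \<le> b v)"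
    proof (cases "I v = {} \<and> I w = {}")
      case True
      then show ?thesis using vw by (simp add: a_def b_def)
    next
      case False
      with True consider "I v = {}" "I w \<noteq> {}" | "I v \<noteq> {}" "I w = {}" by blast
      then show ?thesis
        by cases (use PI(6)[OF vw(1)] PI(6)[OF vw(2)] in \<open>simp_all add: a_def\<close>)
    qed
    with True show ?thesis by auto
  next
    case False
    show ?thesis
    proof
      assume *: "I v \<inter> I w \<noteq> {}"
      then have "p v w \<in> P v" "p v w \<in> P w"
        using vw by (simp add: P_def) (use vw * in \<open>simp add: P_def p_sym[of v w] Int_commute\<close>)
      then show "a v \<le> b w \<and> a w \<le> b v"
        using False finP by (auto simp: a_def b_def intro: order.trans[OF Min_le Max_ge])
    next
      assume *: "a v \<le> b w \<and> a w \<le> b v"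
      let ?m = "max (a v) (a w)"
      have m: "a v \<le> ?m" "?m \<le> b v" "a w \<le> ?m" "?m \<le> b w" using * ab vw by auto
      have "a v \<in> I v" "b v \<in> I v" "a w \<in> I w" "b w \<in> I w"
        using PI(2-4)[OF vw(1)] PI(2-4)[OF vw(2)] False by blast+
      then have "?m \<in> I v" "?m \<in> I w"
        using mem_is_interval_1_I[OF I[OF vw(1)] _ _ m(1,2)]
          mem_is_interval_1_I[OF I[OF vw(2)] _ _ m(3,4)] by blast+
      then show "I v \<inter> I w \<noteq> {}" by auto
    qed
  qed
  with ab have "(\<forall>v\<in>V. a v \<le> b v) \<and> (\<forall>v\<in>V. \<forall>w\<in>V. v \<noteq> w \<longrightarrow>
      (I v \<inter> I w \<noteq> {} \<longleftrightarrow> a v \<le> b w \<and> a w \<le> b v))"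
    by simp
  then show ?thesis by (intro exI)
qed

lemma interval_graph_iff_interval_model: "interval_graph G \<longleftrightarrow> (\<exists>J. interval_model G J)"
proof
  assume "interval_graph G"
  then obtain I :: "nat \<Rightarrow> real set" where I': "(\<forall>v\<in>verts G. is_interval (I v)) \<and>
      (\<forall>v\<in>verts G. \<forall>w\<in>verts G. v \<noteq> w \<longrightarrow> ({v, w} \<in> edges G \<longleftrightarrow> I v \<inter> I w \<noteq> {}))"
    unfolding interval_graph_def ..
  note I = conjunct1[OF I', rule_format] conjunct2[OF I', rule_format]
  from intersecting_intervals_compact_model[of "verts G" I, OF finite_verts conjunct1[OF I']]
  obtain a b :: "nat \<Rightarrow> real" where "(\<forall>v\<in>verts G. a v \<le> b v) \<and> (\<forall>v\<in>verts G. \<forall>w\<in>verts G. v \<noteq> w \<longrightarrow>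
      (I v \<inter> I w \<noteq> {} \<longleftrightarrow> a v \<le> b w \<and> a w \<le> b v))"
    by (elim exE)
  note ab = conjunct1[OF this, rule_format] conjunct2[OF this, rule_format]
  \<comment> \<open>an increasing bijection of the line onto the open unit interval\<close>
  define h :: "real \<Rightarrow> real" where "h x = (1 + tanh x) / 2" for x
  have h: "h x \<le> h y \<longleftrightarrow> x \<le> y" "0 \<le> h x" "h x \<le> 1" for x y
    using tanh_real_bounds[of x] by (auto simp: h_def divide_right_mono field_simps)
  have "interval_model G (\<lambda>v. (h (a v), h (b v)))"
    unfolding interval_model_def
    by (simp add: intervals_def h ab(1)) (simp add: I(2) ab(2))
  then show "\<exists>J. interval_model G J" by (rule exI[of "interval_model G"])
next
  assume "\<exists>J. interval_model G J"
  then obtain J where J: "interval_model G J" ..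
  have "{v, w} \<in> edges G \<longleftrightarrow> {fst (J v)..snd (J v)} \<inter> {fst (J w)..snd (J w)} \<noteq> {}"
    if "v \<in> verts G" "w \<in> verts G" "v \<noteq> w" for v w
    using J that interval_kernel_eq[of "J v" "J w"]
    by (auto simp: interval_model_def interval_kernel_def split: if_splits)
  then show "interval_graph G"
    unfolding interval_graph_def
    by (intro exI[of _ "\<lambda>v. {fst (J v)..snd (J v)}"]) (auto simp: is_interval_cc)
qed

lemma sampled_interval_graph:
  assumes "\<And>i. i < n \<Longrightarrow> x i \<in> intervals"
  obtains G where "verts G = {..<n}" "interval_model G x"
proof -
  let ?E = "{{i, j} | i j. i < n \<and> j < n \<and> i \<noteq> j \<and> fst (x i) \<le> snd (x j) \<and> fst (x j) \<le> snd (x i)}"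
  have "({..<n}, ?E) \<in> {(V, E) | V E. finite V \<and> E \<subseteq> {e. e \<subseteq> V \<and> card e = 2}}"
    by (auto simp: card_2_iff)
  from Abs_fgraph_inverse[OF this] have "verts (Abs_fgraph ({..<n}, ?E)) = {..<n}"
    "edges (Abs_fgraph ({..<n}, ?E)) = ?E"
    by (simp_all add: verts_def edges_def)
  moreover from this have "interval_model (Abs_fgraph ({..<n}, ?E)) x"
    using assms by (auto simp: interval_model_def doubleton_eq_iff)
  ultimately show ?thesis by (intro that)
qed

text \<open>Every interval meets itself although no vertex is adjacent to itself, so homomorphisms and
  overlaps can differ only for maps that identify two vertices.\<close>

lemma hom_density_near_average_overlap:
  assumes J: "interval_model G J" and ne: "verts G \<noteq> {}"
  shows "\<bar>hom_density F G - (\<Sum>\<phi>\<in>verts F \<rightarrow>\<^sub>E verts G. overlap F (\<lambda>i\<in>verts F. J (\<phi> i)))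
      / real (card (verts G)) ^ card (verts F)\<bar> \<le> (real (card (verts F)))\<^sup>2 / real (card (verts G))"
proof -
  let ?N = "verts F \<rightarrow>\<^sub>E verts G" and ?n = "card (verts G)" and ?k = "card (verts F)"
  let ?O = "\<lambda>\<phi>. overlap F (\<lambda>i\<in>verts F. J (\<phi> i))"
  let ?H = "\<lambda>\<phi>. of_bool (\<phi> \<in> graph_homs F G) :: real"
  have fin: "finite ?N" by (intro finite_PiE) auto
  have n: "?n > 0" using ne by (simp add: card_gt_0_iff)
  have cardN: "card ?N = ?n ^ ?k" by (simp add: card_funcsetE)
  have "real (card (graph_homs F G)) = (\<Sum>\<phi>\<in>?N. ?H \<phi>)"
  proof -
    have "?N \<inter> {\<phi>. \<phi> \<in> graph_homs F G} = graph_homs F G" by (auto simp: graph_homs_def)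
    then show ?thesis using fin by simp
  qed
  then have eq: "hom_density F G - (\<Sum>\<phi>\<in>?N. ?O \<phi>) / real ?n ^ ?k = (\<Sum>\<phi>\<in>?N. ?H \<phi> - ?O \<phi>) / real ?n ^ ?k"
    by (simp add: hom_density_def cardN sum_subtractf diff_divide_distrib)
  have "\<bar>\<Sum>\<phi>\<in>?N. ?H \<phi> - ?O \<phi>\<bar> \<le> (\<Sum>\<phi>\<in>?N. \<bar>?H \<phi> - ?O \<phi>\<bar>)"
    by (rule sum_abs)
  also have "(\<Sum>\<phi>\<in>?N. \<bar>?H \<phi> - ?O \<phi>\<bar>) \<le> (\<Sum>\<phi>\<in>?N. of_bool (\<not> inj_on \<phi> (verts F)))"
  proof (rule sum_mono)
    fix \<phi> assume \<phi>: "\<phi> \<in> ?N"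
    have "?H \<phi> = ?O \<phi>" if inj: "inj_on \<phi> (verts F)"
    proof -
      have "\<phi> \<in> graph_homs F G \<longleftrightarrow> (\<forall>(i, j)\<in>arcs F. {\<phi> i, \<phi> j} \<in> edges G)"
        using \<phi> by (auto simp: graph_homs_def arcs_def)
      also have "\<dots> \<longleftrightarrow> (\<forall>(i, j)\<in>arcs F. fst (J (\<phi> i)) \<le> snd (J (\<phi> j)) \<and> fst (J (\<phi> j)) \<le> snd (J (\<phi> i)))"
      proof (intro ball_cong refl, clarify)
        fix i j assume "(i, j) \<in> arcs F"
        note ij = arcsD[OF this]
        then have "\<phi> i \<in> verts G" "\<phi> j \<in> verts G" "\<phi> i \<noteq> \<phi> j"
          using \<phi> inj by (auto dest: inj_onD)
        then show "{\<phi> i, \<phi> j} \<in> edges G \<longleftrightarrow> fst (J (\<phi> i)) \<le> snd (J (\<phi> j)) \<and> fst (J (\<phi> j)) \<le> snd (J (\<phi> i))"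
          using J by (simp add: interval_model_def)
      qed
      also have "\<dots> \<longleftrightarrow> (\<forall>(i, j)\<in>arcs F. fst (J (\<phi> i)) \<le> snd (J (\<phi> j)))"
        using arcsD(4) by fast
      finally show ?thesis
        by (subst overlap_restrict) (simp add: overlap_eq_of_bool)
    qed
    moreover have "\<bar>?H \<phi> - ?O \<phi>\<bar> \<le> 1" using overlap_bounds[of F "restrict (\<lambda>i. J (\<phi> i)) (verts F)"] by (auto simp: abs_le_iff)
    ultimately show "\<bar>?H \<phi> - ?O \<phi>\<bar> \<le> of_bool (\<not> inj_on \<phi> (verts F))" by auto
  qed
  also have "\<dots> = real (card {\<phi> \<in> ?N. \<not> inj_on \<phi> (verts F)})"
    using fin by (simp add: Int_def)
  also have "\<dots> \<le> (real ?k)\<^sup>2 * real ?n ^ ?k / real ?n"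
  proof -
    have "real (card {\<phi> \<in> ?N. \<not> inj_on \<phi> (verts F)} * ?n) \<le> real (?k\<^sup>2 * ?n ^ ?k)"
      by (intro of_nat_mono card_noninjective) auto
    then show ?thesis using n by (simp add: pos_le_divide_eq)
  qed
  finally have "\<bar>\<Sum>\<phi>\<in>?N. ?H \<phi> - ?O \<phi>\<bar> / real ?n ^ ?k
      \<le> (real ?k)\<^sup>2 * real ?n ^ ?k / real ?n / real ?n ^ ?k"
    by (rule divide_right_mono) simp
  also have "\<dots> = (real ?k)\<^sup>2 / real ?n" using n by simp
  finally show ?thesis unfolding eq by (simp only: abs_divide power_abs abs_of_nat)
qed


section \<open>Random intervals and interval graph limits\<close>

abbreviation interval_space :: "(real \<times> real) measure" where
  "interval_space \<equiv> restrict_space borel intervals"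

lemma measurable_at_coordinate:
  assumes "h \<in> N \<rightarrow>\<^sub>M L" "i \<in> I"
  shows "(\<lambda>x. h (x i)) \<in> PiM I (\<lambda>_. N) \<rightarrow>\<^sub>M L"
  using assms(2) by (intro measurable_compose[OF _ assms(1)] measurable_component_singleton)

lemma distr_in_interval_measures:
  assumes "prob_space N" "f \<in> N \<rightarrow>\<^sub>M interval_space"
  shows "distr N interval_space f \<in> interval_measures"
  using assms by (auto simp: interval_measures_def intro!: prob_space.prob_space_distr)

lemma interval_limit_distr:
  assumes N: "prob_space N" and f: "f \<in> N \<rightarrow>\<^sub>M interval_space"
  shows "interval_limit (distr N interval_space f) F
    = (\<integral>x. overlap F (\<lambda>i. f (x i)) \<partial>PiM (verts F) (\<lambda>_. N))"
proof -
  let ?V = "verts F"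
  define D where "D = distr N interval_space f"
  have D: "D \<in> interval_measures" unfolding D_def by (rule distr_in_interval_measures[OF N f])
  have f': "f \<in> N \<rightarrow>\<^sub>M D" using f unfolding D_def by (simp add: measurable_distr_eq2)
  have DD: "distr N D f = D" unfolding D_def by (rule distr_cong) auto
  have "distr (PiM ?V (\<lambda>_. N)) (PiM ?V (\<lambda>_. D)) (compose ?V f) = PiM ?V (\<lambda>_. distr N D f)"
    using N f' interval_measuresD(1)[OF D] by (intro distr_PiM_finite_prob_space') auto
  then have eq: "distr (PiM ?V (\<lambda>_. N)) (PiM ?V (\<lambda>_. D)) (compose ?V f) = PiM ?V (\<lambda>_. D)"
    unfolding DD .
  have m: "overlap F \<in> borel_measurable (PiM ?V (\<lambda>_. D))"
    by (intro overlap_measurable measurable_endpoints interval_measuresD(2)[OF D])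
  have c: "compose ?V f \<in> PiM ?V (\<lambda>_. N) \<rightarrow>\<^sub>M PiM ?V (\<lambda>_. D)"
    unfolding compose_def
    by (intro measurable_restrict measurable_at_coordinate[OF f'])
  have "interval_limit D F = (\<integral>x. overlap F x \<partial>distr (PiM ?V (\<lambda>_. N)) (PiM ?V (\<lambda>_. D)) (compose ?V f))"
    unfolding eq by (rule interval_limit_eq[OF D])
  also have "\<dots> = (\<integral>x. overlap F (compose ?V f x) \<partial>PiM ?V (\<lambda>_. N))"
    by (rule integral_distr[OF c m])
  finally show ?thesis unfolding D_def compose_def overlap_restrict .
qed

text \<open>A density involves only comparisons between independent intervals at distinct vertices, and
  finitely many of them.\<close>

lemma interval_limit_distr_cong:
  assumes N: "prob_space N" and f: "f \<in> N \<rightarrow>\<^sub>M interval_space" and g: "g \<in> N \<rightarrow>\<^sub>M interval_space"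
    and eq: "AE z in N \<Otimes>\<^sub>M N. fst (f (fst z)) \<le> snd (f (snd z)) \<longleftrightarrow> fst (g (fst z)) \<le> snd (g (snd z))"
  shows "interval_limit (distr N interval_space f) = interval_limit (distr N interval_space g)"
proof
  fix F
  let ?P = "PiM (verts F) (\<lambda>_. N)"
  have "AE x in ?P. \<forall>p\<in>arcs F. fst (f (x (fst p))) \<le> snd (f (x (snd p)))
      \<longleftrightarrow> fst (g (x (fst p))) \<le> snd (g (x (snd p)))"
  proof (rule AE_finite_allI[OF finite_arcs])
    fix p assume "p \<in> arcs F"
    then have p: "fst p \<in> verts F" "snd p \<in> verts F" "fst p \<noteq> snd p"
      using arcsD[of "fst p" "snd p" F] by auto
    from AE_PiM_pair[OF N p eq]
    show "AE x in ?P. fst (f (x (fst p))) \<le> snd (f (x (snd p)))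
      \<longleftrightarrow> fst (g (x (fst p))) \<le> snd (g (x (snd p)))" .
  qed
  then have "AE x in ?P. overlap F (\<lambda>i. f (x i)) = overlap F (\<lambda>i. g (x i))"
    by eventually_elim (simp add: overlap_def case_prod_unfold cong: prod.cong)
  moreover have "(\<lambda>x. overlap F (\<lambda>i. h (x i))) \<in> borel_measurable ?P"
    if h: "h \<in> N \<rightarrow>\<^sub>M interval_space" for h
  proof -
    have "(\<lambda>x. \<lambda>i\<in>verts F. h (x i)) \<in> ?P \<rightarrow>\<^sub>M PiM (verts F) (\<lambda>_. interval_space)"
      by (intro measurable_restrict measurable_at_coordinate[OF h])
    from measurable_compose[OF this overlap_measurable[OF measurable_endpoints]]
    show ?thesis unfolding overlap_restrict by simp
  qed
  ultimately show "interval_limit (distr N interval_space f) F = interval_limit (distr N interval_space g) F"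
    unfolding interval_limit_distr[OF N f] interval_limit_distr[OF N g]
    using f g by (intro integral_cong_AE) auto
qed

lemma PiM_uniform_count_measure:
  assumes "finite V" "finite N" "N \<noteq> {}"
  shows "PiM V (\<lambda>_. uniform_count_measure N) = uniform_count_measure (V \<rightarrow>\<^sub>E N)"
proof -
  interpret M: prob_space "uniform_count_measure N"
    using assms by (intro prob_space_uniform_count_measure) auto
  interpret P: product_prob_space "\<lambda>_. uniform_count_measure N" V by standard
  have fin: "finite (V \<rightarrow>\<^sub>E N)" using assms by (intro finite_PiE) auto
  show ?thesis
  proof (rule P.PiM_eqI[symmetric])
    show "sets (uniform_count_measure (V \<rightarrow>\<^sub>E N)) = sets (PiM V (\<lambda>_. uniform_count_measure N))"
    proof -
      have "sets (PiM V (\<lambda>_. uniform_count_measure N)) = sets (PiM V (\<lambda>_. count_space N))"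
        by (intro sets_PiM_cong) (auto simp: sets_uniform_count_measure)
      also have "\<dots> = sets (count_space (V \<rightarrow>\<^sub>E N))"
        using assms by (subst count_space_PiM_finite) (auto intro: countable_finite)
      finally show ?thesis by (simp add: sets_uniform_count_measure)
    qed
    fix A assume "\<And>i. i \<in> V \<Longrightarrow> A i \<in> sets (uniform_count_measure N)"
    then have A: "\<And>i. i \<in> V \<Longrightarrow> A i \<subseteq> N" by (auto simp: sets_uniform_count_measure)
    have "emeasure (uniform_count_measure (V \<rightarrow>\<^sub>E N)) (PiE V A) = card (PiE V A) / card (V \<rightarrow>\<^sub>E N)"
      using A fin by (intro emeasure_uniform_count_measure) (auto intro: PiE_mono)
    also have "\<dots> = ennreal (\<Prod>i\<in>V. card (A i) / card N)"
      using assms by (simp add: card_PiE prod_dividef)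
    also have "\<dots> = (\<Prod>i\<in>V. emeasure (uniform_count_measure N) (A i))"
      using A assms by (subst prod_ennreal[symmetric]) (auto simp: emeasure_uniform_count_measure intro!: prod.cong)
    finally show "emeasure (uniform_count_measure (V \<rightarrow>\<^sub>E N)) (PiE V A)
      = (\<Prod>i\<in>V. emeasure (uniform_count_measure N) (A i))" .
  qed (use assms in auto)
qed

text \<open>The densities of the empirical measure of a model of \<open>G\<close> are averages of overlaps over all maps
  into the vertices of \<open>G\<close>.\<close>

lemma interval_graph_near_empirical_limit:
  assumes "interval_graph G" "verts G \<noteq> {}"
  obtains \<nu> where "\<nu> \<in> interval_measures"
    "\<And>F. \<bar>hom_density F G - interval_limit \<nu> F\<bar> \<le> (real (card (verts F)))\<^sup>2 / real (card (verts G))"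
proof -
  obtain J where J: "interval_model G J"
    using assms(1) interval_graph_iff_interval_model by blast
  let ?U = "uniform_count_measure (verts G)"
  have U: "prob_space ?U" using assms by (intro prob_space_uniform_count_measure) auto
  have Jm: "J \<in> ?U \<rightarrow>\<^sub>M interval_space"
    using J by (auto simp: measurable_def sets_uniform_count_measure space_uniform_count_measure
        space_restrict_space interval_model_def)
  have "interval_limit (distr ?U interval_space J) F
      = (\<Sum>\<phi>\<in>verts F \<rightarrow>\<^sub>E verts G. overlap F (\<lambda>i\<in>verts F. J (\<phi> i))) / real (card (verts G)) ^ card (verts F)" for F
  proof -
    have "interval_limit (distr ?U interval_space J) F
        = (\<Sum>\<phi>\<in>verts F \<rightarrow>\<^sub>E verts G. overlap F (\<lambda>i. J (\<phi> i))) / real (card (verts F \<rightarrow>\<^sub>E verts G))"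
      using assms
      by (simp add: interval_limit_distr[OF U Jm] PiM_uniform_count_measure
          integral_uniform_count_measure finite_PiE)
    also have "real (card (verts F \<rightarrow>\<^sub>E verts G)) = real (card (verts G)) ^ card (verts F)"
      by (simp add: card_funcsetE)
    finally show ?thesis unfolding overlap_restrict .
  qed
  then have "\<bar>hom_density F G - interval_limit (distr ?U interval_space J) F\<bar>
      \<le> (real (card (verts F)))\<^sup>2 / real (card (verts G))" for F
    using hom_density_near_average_overlap[OF J assms(2), of F] by presburger
  then show ?thesis by (rule that[OF distr_in_interval_measures[OF U Jm]])
qed

text \<open>The squared errors of finitely many densities have a small total mean over random samples, so
  some sample attains a small value.\<close>

lemma sample_near_interval_limit:
  fixes \<F> :: "fgraph set" and \<epsilon> :: real
  assumes \<mu>: "\<mu> \<in> interval_measures" and fin: "finite \<F>" and \<epsilon>: "\<epsilon> > 0"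
  obtains G where "interval_graph G" "card (verts G) \<ge> m"
    "\<And>F. F \<in> \<F> \<Longrightarrow> \<bar>hom_density F G - interval_limit \<mu> F\<bar> \<le> \<epsilon>"
proof -
  note M = interval_measuresD[OF \<mu>]
  define K where "K = (\<Sum>F\<in>\<F>. (2 * real (card (verts F)))\<^sup>2)"
  have K: "(real (card (verts F)))\<^sup>2 \<le> K" if "F \<in> \<F>" for F
  proof -
    have "(real (card (verts F)))\<^sup>2 \<le> (2 * real (card (verts F)))\<^sup>2" by (intro power_mono) auto
    also have "\<dots> \<le> K" unfolding K_def using that fin by (intro member_le_sum) auto
    finally show ?thesis .
  qed
  have K0: "0 \<le> K" unfolding K_def by (intro sum_nonneg) auto
  \<comment> \<open>the mean square sampling error and the error from maps that are not injective are both
    bounded through \<open>K / n\<close>, and each of them may use up \<open>\<epsilon> / 2\<close>\<close>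
  obtain n :: nat where n: "real n > 4 * K / \<epsilon>\<^sup>2 + 2 * K / \<epsilon> + real m"
    using reals_Archimedean2 by blast
  have K1: "0 \<le> 4 * K / \<epsilon>\<^sup>2" "0 \<le> 2 * K / \<epsilon>" using K0 \<epsilon> by auto
  have n0: "n > 0" "n \<ge> m" using n K1 by linarith+
  have nK: "K / real n \<le> (\<epsilon> / 2)\<^sup>2" "K / real n \<le> \<epsilon> / 2"
  proof -
    have "4 * K / \<epsilon>\<^sup>2 \<le> real n" "2 * K / \<epsilon> \<le> real n" using n K1 by linarith+
    then show "K / real n \<le> (\<epsilon> / 2)\<^sup>2" "K / real n \<le> \<epsilon> / 2"
      using \<epsilon> n0 by (simp_all add: field_simps power2_eq_square)
  qed
  let ?P = "PiM {..<n} (\<lambda>_. \<mu>)"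
  interpret P: prob_space ?P using M(1) by (intro prob_space_PiM)
  define U where "U F x = (\<Sum>\<phi>\<in>verts F \<rightarrow>\<^sub>E {..<n}. overlap F (\<lambda>i\<in>verts F. x (\<phi> i)))
      / real n ^ card (verts F)" for F and x :: "nat \<Rightarrow> real \<times> real"
  let ?Y = "\<lambda>x. \<Sum>F\<in>\<F>. (U F x - interval_limit \<mu> F)\<^sup>2"
  have om: "overlap F \<in> borel_measurable (PiM (verts F) (\<lambda>_. \<mu>))" for F
    by (intro overlap_measurable measurable_endpoints M(2))
  have U01: "0 \<le> U F x" "U F x \<le> 1" for F x
  proof -
    show "0 \<le> U F x" unfolding U_def using overlap_bounds by (intro divide_nonneg_nonneg sum_nonneg) auto
    have "(\<Sum>\<phi>\<in>verts F \<rightarrow>\<^sub>E {..<n}. overlap F (\<lambda>i\<in>verts F. x (\<phi> i))) \<le> (\<Sum>\<phi>\<in>verts F \<rightarrow>\<^sub>E {..<n}. 1)"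
      by (intro sum_mono overlap_bounds)
    also have "\<dots> = real n ^ card (verts F)" by (simp add: card_funcsetE)
    finally show "U F x \<le> 1" unfolding U_def using n0 by (simp add: divide_le_eq)
  qed
  have t01: "0 \<le> interval_limit \<mu> F" "interval_limit \<mu> F \<le> 1" for F
  proof -
    interpret Q: prob_space "PiM (verts F) (\<lambda>_. \<mu>)" using M(1) by (intro prob_space_PiM)
    have "integrable (PiM (verts F) (\<lambda>_. \<mu>)) (overlap F)"
      using overlap_bounds[of F] om by (intro Q.integrable_const_bound[where B = 1]) auto
    then show "0 \<le> interval_limit \<mu> F" "interval_limit \<mu> F \<le> 1"
      unfolding interval_limit_eq[OF \<mu>]
      using overlap_bounds[of F] Q.integral_ge_const Q.integral_le_const by auto
  qed
  have Um: "U F \<in> borel_measurable ?P" for F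
  proof -
    have "(\<lambda>x. overlap F (\<lambda>i\<in>verts F. x (\<phi> i))) \<in> borel_measurable ?P" if "\<phi> \<in> verts F \<rightarrow>\<^sub>E {..<n}" for \<phi>
      using that
      by (intro measurable_compose[OF _ om] measurable_restrict measurable_component_singleton) auto
    then show ?thesis unfolding U_def by (intro borel_measurable_divide borel_measurable_sum) auto
  qed
  have int: "integrable ?P (\<lambda>x. (U F x - interval_limit \<mu> F)\<^sup>2)" for F
  proof (rule P.integrable_const_bound[where B = 1])
    show "AE x in ?P. norm ((U F x - interval_limit \<mu> F)\<^sup>2) \<le> 1"
    proof (rule AE_I2)
      fix x
      have "\<bar>U F x - interval_limit \<mu> F\<bar> \<le> 1" using U01[of F x] t01[of F] by linarith
      then show "norm ((U F x - interval_limit \<mu> F)\<^sup>2) \<le> 1" by (simp add: abs_square_le_1)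
    qed
    show "(\<lambda>x. (U F x - interval_limit \<mu> F)\<^sup>2) \<in> borel_measurable ?P" using Um by measurable
  qed
  have "(\<integral>x. ?Y x \<partial>?P) = (\<Sum>F\<in>\<F>. \<integral>x. (U F x - interval_limit \<mu> F)\<^sup>2 \<partial>?P)"
    using int by (rule Bochner_Integration.integral_sum)
  also have "\<dots> \<le> (\<Sum>F\<in>\<F>. (2 * real (card (verts F)))\<^sup>2 / real n)"
    unfolding U_def interval_limit_eq[OF \<mu>]
    by (intro sum_mono V_statistic_second_moment M(1) finite_verts n0 om overlap_bounds)
  also have "\<dots> = K / real n" by (simp add: K_def sum_divide_distrib)
  finally have EY: "(\<integral>x. ?Y x \<partial>?P) \<le> K / real n" .
  obtain x where x: "x \<in> space ?P" "?Y x \<le> K / real n"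
  proof (rule ccontr)
    assume "\<not> thesis"
    then have "\<forall>x\<in>space ?P. K / real n < ?Y x" using that by force
    then have "K / real n < (\<integral>x. ?Y x \<partial>?P)"
      using int by (intro P.expectation_greater) auto
    then show False using EY by simp
  qed
  obtain G where G: "verts G = {..<n}" "interval_model G x"
    by (rule sampled_interval_graph[of n x]) (use x(1) M(3) in \<open>auto simp: space_PiM\<close>)
  have ne: "verts G \<noteq> {}" using G(1) n0 by auto
  have "\<bar>hom_density F G - interval_limit \<mu> F\<bar> \<le> \<epsilon>" if F: "F \<in> \<F>" for F
  proof -
    have "(U F x - interval_limit \<mu> F)\<^sup>2 \<le> ?Y x"
      using F fin by (intro member_le_sum) auto
    also have "\<dots> \<le> (\<epsilon> / 2)\<^sup>2" using x(2) nK(1) by linarith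
    finally have "\<bar>U F x - interval_limit \<mu> F\<bar> \<le> \<epsilon> / 2" using \<epsilon> by (simp add: abs_le_square_iff[symmetric])
    moreover have "\<bar>hom_density F G - U F x\<bar> \<le> \<epsilon> / 2"
    proof -
      have "\<bar>hom_density F G - U F x\<bar> \<le> (real (card (verts F)))\<^sup>2 / real n"
        using hom_density_near_average_overlap[OF G(2) ne, of F]
        unfolding U_def G(1) card_lessThan .
      also have "\<dots> \<le> K / real n" using K[OF F] by (simp add: divide_right_mono)
      finally show ?thesis using nK(2) by linarith
    qed
    ultimately show ?thesis by linarith
  qed
  moreover have "interval_graph G" using G(2) interval_graph_iff_interval_model by blast
  ultimately show ?thesis using G(1) n0 by (intro that) auto
qed

lemma interval_limit_is_interval_graph_limit:
  assumes "\<mu> \<in> interval_measures"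
  shows "interval_limit \<mu> \<in> interval_graph_limits"
proof -
  define e where "e = from_nat_into (UNIV :: fgraph set)"
  have e: "\<exists>l. F = e l" for F
    using range_from_nat_into[OF _ countable_fgraphs] unfolding e_def by (metis UNIV_I UNIV_not_empty rangeE)
  have "\<exists>G. interval_graph G \<and> card (verts G) \<ge> m
      \<and> (\<forall>F\<in>e ` {..m}. \<bar>hom_density F G - interval_limit \<mu> F\<bar> \<le> 1 / real (Suc m))" for m
    by (rule sample_near_interval_limit[OF assms, of "e ` {..m}" "1 / real (Suc m)" m]) auto
  then obtain G where G: "\<And>m. interval_graph (G m)" "\<And>m. card (verts (G m)) \<ge> m"
    "\<And>m l. l \<le> m \<Longrightarrow> \<bar>hom_density (e l) (G m) - interval_limit \<mu> (e l)\<bar> \<le> 1 / real (Suc m)"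
    by (metis atMost_iff image_eqI)
  have "(\<lambda>m. hom_density F (G m)) \<longlonglongrightarrow> interval_limit \<mu> F" for F
  proof -
    obtain l where l: "F = e l" using e by blast
    have "(\<lambda>m. hom_density F (G m) - interval_limit \<mu> F) \<longlonglongrightarrow> 0"
    proof (rule Lim_null_comparison)
      show "eventually (\<lambda>m. norm (hom_density F (G m) - interval_limit \<mu> F) \<le> 1 / real (Suc m)) sequentially"
        using eventually_ge_at_top[of l] by eventually_elim (use G(3) l in auto)
      show "(\<lambda>m. 1 / real (Suc m)) \<longlonglongrightarrow> 0" by (rule LIMSEQ_Suc[OF lim_1_over_n])
    qed
    then show ?thesis by (simp add: LIM_zero_iff)
  qed
  moreover have "filterlim (\<lambda>m. card (verts (G m))) at_top sequentially"
    using G(2) by (intro filterlim_at_top_mono[OF filterlim_ident]) auto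
  ultimately have "graph_tendsto G (interval_limit \<mu>)" by (simp add: graph_tendsto_def)
  then show ?thesis using G(1) by (auto simp: interval_graph_limits_def graph_limits_def)
qed


section \<open>The uniform distribution\<close>

lemma sets_lebesgue01: "sets lebesgue01 = sets (restrict_space borel {0..1})"
  unfolding lebesgue01_def by (rule sets_restrict_space_cong) simp

lemma space_lebesgue01 [simp]: "space lebesgue01 = {0..1}"
  by (simp add: lebesgue01_def space_restrict_space)

lemma prob_space_lebesgue01: "prob_space lebesgue01"
  unfolding lebesgue01_def by (rule prob_space_restrict_space) auto

lemma measure_lebesgue01:
  assumes "A \<subseteq> {0..1}"
  shows "measure lebesgue01 A = measure lborel A"
  unfolding lebesgue01_def using assms by (intro measure_restrict_space) auto

lemma borel_subset_in_sets_lebesgue01: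
  assumes "A \<in> sets borel" "A \<subseteq> {0..1}"
  shows "A \<in> sets lebesgue01"
  unfolding sets_lebesgue01 using assms by (auto simp: sets_restrict_space_iff)

text \<open>If the distribution function \<open>F\<close> satisfies \<open>F(t-) \<le> t \<le> F(t)\<close>, then
  \<open>F(t) \<le> F(s-) \<le> s\<close> for every \<open>s > t\<close>, so \<open>F\<close> is the identity.\<close>

lemma lebesgue01_eqI:
  assumes M: "prob_space M" and sets: "sets M = sets (restrict_space borel {0..1})"
    and le: "\<And>t. 0 < t \<Longrightarrow> t < 1 \<Longrightarrow> measure M {x \<in> space M. x < t} \<le> t"
    and ge: "\<And>t. 0 < t \<Longrightarrow> t < 1 \<Longrightarrow> t \<le> measure M {x \<in> space M. x \<le> t}"
  shows "M = lebesgue01"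
proof -
  interpret M: prob_space M by fact
  have space: "space M = {0..1}"
    using sets_eq_imp_space_eq[OF sets] by (simp add: space_restrict_space)
  have in_sets: "A \<in> sets M" if "A \<in> sets borel" "A \<subseteq> {0..1}" for A
    unfolding sets using that by (auto simp: sets_restrict_space_iff)
  have id: "(\<lambda>x. x) \<in> M \<rightarrow>\<^sub>M borel" "(\<lambda>x. x) \<in> lebesgue01 \<rightarrow>\<^sub>M borel"
    by (simp_all add: measurable_cong_sets[OF sets refl] measurable_cong_sets[OF sets_lebesgue01 refl]
        measurable_restrict_space1)
  have M_eq: "measure M {0..t} = t" if t: "0 \<le> t" "t < 1" for t
  proof (rule antisym)
    have "measure M {0..t} \<le> t + e" if e: "e > 0" for e
    proof -
      define s where "s = min (t + e) ((t + 1) / 2)"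
      have s: "t < s" "s \<le> t + e" "0 < s" "s < 1" using t e by (auto simp: s_def min_def field_simps)
      have "measure M {0..t} \<le> measure M {x \<in> space M. x < s}"
        using s by (intro M.finite_measure_mono in_sets) (auto simp: space)
      also have "\<dots> \<le> s" using s by (intro le)
      finally show ?thesis using s by simp
    qed
    then show "measure M {0..t} \<le> t" by (rule field_le_epsilon)
    show "t \<le> measure M {0..t}"
    proof (cases "t = 0")
      case False
      then have "t \<le> measure M {x \<in> space M. x \<le> t}" using t by (intro ge) auto
      also have "{x \<in> space M. x \<le> t} = {0..t}" using t by (auto simp: space)
      finally show ?thesis .
    qed simp
  qed
  have cdf_eq: "cdf (distr N borel (\<lambda>x. x)) t = (if t < 0 then 0 else if t < 1 then measure N {0..t} else 1)"
    if "prob_space N" "space N = {0..1}" "(\<lambda>x. x) \<in> N \<rightarrow>\<^sub>M borel" for N :: "real measure" and t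
  proof -
    have "cdf (distr N borel (\<lambda>x. x)) t = measure N ({..t} \<inter> {0..1})"
      using that by (simp add: cdf_def measure_distr Int_def)
    also have "{..t} \<inter> {0..1} = (if t < 0 then {} else if t < 1 then {0..t} else {0..1})" by auto
    finally show ?thesis using prob_space.prob_space[OF that(1)] that(2) by simp
  qed
  have "distr M borel (\<lambda>x. x) = distr lebesgue01 borel (\<lambda>x. x)"
  proof (rule cdf_unique)
    show "real_distribution (distr M borel (\<lambda>x. x))" "real_distribution (distr lebesgue01 borel (\<lambda>x. x))"
      using M prob_space_lebesgue01 id
      by (auto simp: real_distribution_def real_distribution_axioms_def intro!: prob_space.prob_space_distr)
    show "cdf (distr M borel (\<lambda>x. x)) = cdf (distr lebesgue01 borel (\<lambda>x. x))"
      by (rule ext) (simp add: cdf_eq M prob_space_lebesgue01 space id M_eq measure_lebesgue01)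
  qed
  then have eq: "emeasure (distr M borel (\<lambda>x. x)) A = emeasure (distr lebesgue01 borel (\<lambda>x. x)) A" for A by simp
  show ?thesis
  proof (rule measure_eqI)
    show "sets M = sets lebesgue01" by (simp add: sets sets_lebesgue01)
    fix A assume "A \<in> sets M"
    then have A: "A \<in> sets borel" "A \<subseteq> {0..1}" unfolding sets by (auto simp: sets_restrict_space_iff)
    then have "A \<inter> space M = A" "A \<inter> {0..1} = A" by (auto simp: space)
    then show "emeasure M A = emeasure lebesgue01 A"
      using eq[of A] A id by (simp add: emeasure_distr)
  qed
qed

lemma measure_pair_Times:
  assumes "prob_space M" "prob_space N" "A \<in> sets M" "B \<in> sets N"
  shows "measure (M \<Otimes>\<^sub>M N) (A \<times> B) = measure M A * measure N B"
proof -
  interpret N: prob_space N by fact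
  show ?thesis
    using assms(3,4) by (simp add: measure_def N.emeasure_pair_measure_Times enn2real_mult)
qed

lemma distr_pair_measure_fst:
  assumes "prob_space N"
  shows "distr (M \<Otimes>\<^sub>M N) M fst = M"
proof (rule measure_eqI)
  interpret N: prob_space N by fact
  fix A assume "A \<in> sets (distr (M \<Otimes>\<^sub>M N) M fst)"
  then have A: "A \<in> sets M" by simp
  then have "fst -` A \<inter> space (M \<Otimes>\<^sub>M N) = A \<times> space N"
    using sets.sets_into_space[OF A] by (auto simp: space_pair_measure)
  then show "emeasure (distr (M \<Otimes>\<^sub>M N) M fst) A = emeasure M A"
    using A by (simp add: emeasure_distr N.emeasure_pair_measure_Times N.emeasure_space_1)
qed simp

section \<open>The randomized rank transform\<close>

text \<open>The distribution function of \<open>m\<close> at \<open>x\<close>, where the second argument runs through the jump at an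
  atom: 0 gives the left limit and 1 the value.\<close>

definition rank_at :: "real measure \<Rightarrow> real \<Rightarrow> real \<Rightarrow> real" where
  "rank_at m x v = measure m {..<x} + v * measure m {x}"

context
  fixes m :: "real measure"
  assumes m: "prob_space m" and m_sets: "sets m = sets borel"
begin

interpretation m: prob_space m by (rule m)

lemma rank_at_one: "rank_at m x 1 = measure m {..x}"
proof -
  have "measure m ({..<x} \<union> {x}) = measure m {..<x} + measure m {x}"
    by (intro m.finite_measure_Union) (auto simp: m_sets)
  moreover have "{..<x} \<union> {x} = {..x}" by auto
  ultimately show ?thesis by (simp add: rank_at_def)
qed

lemma rank_at_mono_second: "v \<le> w \<Longrightarrow> rank_at m x v \<le> rank_at m x w"
  by (simp add: rank_at_def mult_right_mono)

lemma rank_at_mono_strict: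
  assumes "x < y" "v \<le> 1" "0 \<le> w"
  shows "rank_at m x v \<le> rank_at m y w"
proof -
  have "rank_at m x v \<le> rank_at m x 1"
    using assms by (intro rank_at_mono_second)
  also have "\<dots> \<le> measure m {..<y}"
    unfolding rank_at_one using assms by (intro m.finite_measure_mono) (auto simp: m_sets)
  also have "\<dots> \<le> rank_at m y w" using assms by (simp add: rank_at_def)
  finally show ?thesis .
qed

lemma rank_at_bounds:
  assumes "0 \<le> v" "v \<le> 1"
  shows "0 \<le> rank_at m x v" "rank_at m x v \<le> 1"
proof -
  show "0 \<le> rank_at m x v" using assms by (simp add: rank_at_def)
  have "rank_at m x v \<le> rank_at m x 1" by (rule rank_at_mono_second) fact
  also have "\<dots> \<le> 1" by (simp add: rank_at_one)
  finally show "rank_at m x v \<le> 1" .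
qed

lemma rank_at_measurable:
  assumes "f \<in> borel_measurable N" "g \<in> borel_measurable N"
  shows "(\<lambda>z. rank_at m (f z) (g z)) \<in> borel_measurable N"
proof -
  define F G where "F x = measure m {..<x}" and "G x = measure m {..x}" for x
  note [measurable] = assms
  have "mono F" "mono G"
    unfolding F_def G_def by (intro monoI m.finite_measure_mono; auto simp: m_sets)+
  then have [measurable]: "F \<in> borel_measurable borel" "G \<in> borel_measurable borel"
    by (simp_all add: borel_measurable_mono)
  have "rank_at m x v = F x + v * (G x - F x)" for x v
    using rank_at_one[of x] by (simp add: rank_at_def F_def G_def)
  then have "(\<lambda>z. rank_at m (f z) (g z)) = (\<lambda>z. F (f z) + g z * (G (f z) - F (f z)))" by simp
  also have "\<dots> \<in> borel_measurable N" by measurable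
  finally show ?thesis .
qed

lemma ex_quantile:
  assumes t: "0 < t" "t < 1"
  shows "\<exists>x. measure m {..<x} \<le> t \<and> t \<le> measure m {..x}"
proof -
  interpret rd: real_distribution m
    by standard (rule m_sets)
  interpret R: right_continuous_mono "cdf m" 0 1
    by (rule right_continuous_mono.intro)
      (simp_all add: rd.cdf_is_right_cont monoI rd.cdf_nondecreasing rd.cdf_lim_at_bot rd.cdf_lim_at_top_prob)
  let ?x = "Inf {x. t \<le> cdf m x}"
  have q: "t \<le> cdf m y \<longleftrightarrow> ?x \<le> y" for y using t by (rule R.pseudoinverse)
  have "measure m {..<?x} \<le> t"
  proof (rule tendsto_upperbound[OF rd.cdf_at_left])
    show "\<forall>\<^sub>F y in at_left ?x. cdf m y \<le> t"
      unfolding eventually_at_filter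
    proof (intro always_eventually allI impI)
      fix y assume "y \<in> {..<?x}"
      then have "\<not> ?x \<le> y" by simp
      then have "\<not> t \<le> cdf m y" by (simp only: q[of y] not_False_eq_True)
      then show "cdf m y \<le> t" by simp
    qed
  qed simp
  moreover have "t \<le> measure m {..?x}" using q[THEN iffD2, OF order.refl] by (simp only: cdf_def)
  ultimately show ?thesis by blast
qed

text \<open>If \<open>Z\<close> has law \<open>m\<close> and \<open>V\<close> is uniform and independent of \<open>Z\<close>, then \<open>rank_at m Z V\<close> is
  uniform: its value is at most \<open>t\<close> when \<open>Z\<close> is below the \<open>t\<close>-quantile and at least \<open>t\<close> when
  \<open>Z\<close> is above it, and \<open>V\<close> splits the atom at the quantile in the right proportion.\<close>

lemma distr_rank_at: "distr (m \<Otimes>\<^sub>M lebesgue01) lebesgue01 (\<lambda>z. rank_at m (fst z) (snd z)) = lebesgue01"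
proof -
  let ?N = "m \<Otimes>\<^sub>M lebesgue01" and ?T = "\<lambda>z. rank_at m (fst z) (snd z)"
  interpret U: prob_space lebesgue01 by (rule prob_space_lebesgue01)
  interpret N: pair_prob_space m lebesgue01 ..
  have space: "space ?N = UNIV \<times> {0..1}"
    using sets_eq_imp_space_eq[OF m_sets] by (simp add: space_pair_measure)
  have fst_snd: "fst \<in> borel_measurable ?N" "snd \<in> borel_measurable ?N"
  proof -
    have "(\<lambda>x. x) \<in> m \<rightarrow>\<^sub>M borel" "(\<lambda>x. x) \<in> lebesgue01 \<rightarrow>\<^sub>M borel"
      by (simp_all add: measurable_cong_sets[OF m_sets refl]
          measurable_cong_sets[OF sets_lebesgue01 refl] measurable_restrict_space1)
    from measurable_compose[OF measurable_fst[of m lebesgue01] this(1)]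
      measurable_compose[OF measurable_snd[of m lebesgue01] this(2)]
    show "fst \<in> borel_measurable ?N" "snd \<in> borel_measurable ?N" by simp_all
  qed
  have T: "?T \<in> borel_measurable ?N" by (intro rank_at_measurable fst_snd)
  have T': "?T \<in> ?N \<rightarrow>\<^sub>M lebesgue01"
    unfolding measurable_cong_sets[OF refl sets_lebesgue01]
    using T rank_at_bounds by (auto intro!: measurable_restrict_space2 simp: space)
  have Tsets: "{z \<in> space ?N. ?T z < t} \<in> sets ?N" "{z \<in> space ?N. ?T z \<le> t} \<in> sets ?N" for t
    using T by measurable
  have main: "measure ?N {z \<in> space ?N. ?T z < t} \<le> t \<and> t \<le> measure ?N {z \<in> space ?N. ?T z \<le> t}"
    if t: "0 < t" "t < 1" for t
  proof -
    obtain x where x: "measure m {..<x} \<le> t" "t \<le> measure m {..x}" using ex_quantile[OF t] by blast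
    define p w where "p = measure m {..<x}" and "w = measure m {x}"
    have w0: "0 \<le> w" by (simp add: w_def)
    have pw: "p \<le> t" "t \<le> p + w"
      using x rank_at_one[of x] by (simp_all add: p_def w_def rank_at_def)
    \<comment> \<open>the share of the atom at the quantile that is needed to fill up the mass to \<open>t\<close>\<close>
    define c where "c = (if w = 0 then 0 else (t - p) / w)"
    have c: "0 \<le> c" "c \<le> 1" "p + c * w = t"
      using pw w0 by (auto simp: c_def field_simps)
    have "{..<x} \<in> sets m" "{x} \<in> sets m" "{0..c} \<in> sets lebesgue01" "{0..1} \<in> sets lebesgue01"
      using c by (auto simp: m_sets intro!: borel_subset_in_sets_lebesgue01)
    note s = this
    have sx: "{..<x} \<times> space lebesgue01 \<in> sets ?N" "{x} \<times> {0..c} \<in> sets ?N"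
      using s by (auto intro!: pair_measureI)
    have "measure ?N ({..<x} \<times> space lebesgue01 \<union> {x} \<times> {0..c})
        = measure ?N ({..<x} \<times> space lebesgue01) + measure ?N ({x} \<times> {0..c})"
      using sx by (intro N.finite_measure_Union) auto
    also have "\<dots> = p + w * c"
      using s c by (simp add: measure_pair_Times[OF m prob_space_lebesgue01] p_def w_def
          U.prob_space[simplified] measure_lebesgue01)
    also have "\<dots> = t" using c by (simp add: mult.commute)
    finally have R: "measure ?N ({..<x} \<times> space lebesgue01 \<union> {x} \<times> {0..c}) = t" .
    have below_quantile: "fst z \<le> x" if z: "z \<in> {z \<in> space ?N. ?T z < t}" for z
    proof (rule ccontr)
      assume "\<not> fst z \<le> x"
      then have "rank_at m x 1 \<le> ?T z" using z by (intro rank_at_mono_strict) (auto simp: space)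
      then show False using z x(2) by (simp add: rank_at_one)
    qed
    have "measure ?N {z \<in> space ?N. ?T z < t} \<le> t"
    proof (cases "w = 0")
      case True
      then have "{z \<in> space ?N. ?T z < t} \<subseteq> {..<x} \<times> space lebesgue01 \<union> {x} \<times> {0..1}"
      proof (intro subsetI)
        fix z assume z: "z \<in> {z \<in> space ?N. ?T z < t}"
        have "fst z \<le> x" using z by (rule below_quantile)
        then show "z \<in> {..<x} \<times> space lebesgue01 \<union> {x} \<times> {0..1}"
          using z by (cases z) (auto simp: space)
      qed
      then have "measure ?N {z \<in> space ?N. ?T z < t} \<le> measure ?N ({..<x} \<times> space lebesgue01 \<union> {x} \<times> {0..1})"
        using s by (intro N.finite_measure_mono sets.Un pair_measureI) auto
      also have "\<dots> \<le> measure ?N ({..<x} \<times> space lebesgue01) + measure ?N ({x} \<times> {0..1})"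
        using s by (intro measure_Un_le pair_measureI) auto
      also have "\<dots> = p + w * 1"
        using s by (simp add: measure_pair_Times[OF m prob_space_lebesgue01] p_def w_def
            U.prob_space[simplified])
      finally show ?thesis using True pw by simp
    next
      case False
      have "{z \<in> space ?N. ?T z < t} \<subseteq> {..<x} \<times> space lebesgue01 \<union> {x} \<times> {0..c}"
      proof (intro subsetI)
        fix z assume z: "z \<in> {z \<in> space ?N. ?T z < t}"
        have "fst z \<le> x" using z by (rule below_quantile)
        moreover have "snd z \<le> c" if "fst z = x"
        proof -
          have "p + snd z * w < p + c * w" using z that c(3) by (simp add: rank_at_def p_def w_def)
          then show ?thesis using False w0 by (simp add: mult_less_cancel_right)
        qed
        ultimately show "z \<in> {..<x} \<times> space lebesgue01 \<union> {x} \<times> {0..c}"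
          using z by (cases z) (auto simp: space)
      qed
      then have "measure ?N {z \<in> space ?N. ?T z < t} \<le> measure ?N ({..<x} \<times> space lebesgue01 \<union> {x} \<times> {0..c})"
        using sx by (intro N.finite_measure_mono) auto
      then show ?thesis using R by simp
    qed
    moreover have "t \<le> measure ?N {z \<in> space ?N. ?T z \<le> t}"
    proof -
      have "?T z \<le> t" if "z \<in> {..<x} \<times> space lebesgue01 \<union> {x} \<times> {0..c}" for z
      proof (cases "fst z = x")
        case True
        then have "snd z * w \<le> c * w" using that w0 by (intro mult_right_mono) auto
        then show ?thesis using True c(3) by (simp add: rank_at_def p_def w_def)
      next
        case False
        then have "?T z \<le> rank_at m x 0" using that by (intro rank_at_mono_strict) auto
        then show ?thesis using x(1) by (simp add: rank_at_def)
      qed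
      then have "{..<x} \<times> space lebesgue01 \<union> {x} \<times> {0..c} \<subseteq> {z \<in> space ?N. ?T z \<le> t}"
        using c by (auto simp: space)
      then have "measure ?N ({..<x} \<times> space lebesgue01 \<union> {x} \<times> {0..c}) \<le> measure ?N {z \<in> space ?N. ?T z \<le> t}"
        using Tsets by (intro N.finite_measure_mono) auto
      then show ?thesis using R by simp
    qed
    ultimately show ?thesis ..
  qed
  have pre: "measure (distr ?N lebesgue01 ?T) {x \<in> space (distr ?N lebesgue01 ?T). Q x}
      = measure ?N {z \<in> space ?N. Q (?T z)}" if "{x \<in> {0..1}. Q x} \<in> sets lebesgue01" for Q
    using that measurable_space[OF T'] by (subst measure_distr[OF T']) (auto intro!: arg_cong[where f = "measure ?N"])
  show ?thesis
  proof (rule lebesgue01_eqI)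
    show "prob_space (distr ?N lebesgue01 ?T)" by (rule N.prob_space_distr[OF T'])
    show "sets (distr ?N lebesgue01 ?T) = sets (restrict_space borel {0..1})" by (simp add: sets_lebesgue01)
    fix t :: real assume t: "0 < t" "t < 1"
    show "measure (distr ?N lebesgue01 ?T) {x \<in> space (distr ?N lebesgue01 ?T). x < t} \<le> t"
      using main[OF t] by (subst pre) (auto intro!: borel_subset_in_sets_lebesgue01)
    show "t \<le> measure (distr ?N lebesgue01 ?T) {x \<in> space (distr ?N lebesgue01 ?T). x \<le> t}"
      using main[OF t] by (subst pre) (auto intro!: borel_subset_in_sets_lebesgue01)
  qed
qed

end


section \<open>Normalizing the marginals\<close>

abbreviation unit_space :: "real measure" where
  "unit_space \<equiv> restrict_space borel {0..1}"

lemma measurable_lebesgue01_iff: "f \<in> N \<rightarrow>\<^sub>M lebesgue01 \<longleftrightarrow> f \<in> N \<rightarrow>\<^sub>M unit_space"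
  by (simp add: measurable_cong_sets[OF refl sets_lebesgue01])

lemma measurable_lebesgue01_id: "(\<lambda>x. x) \<in> borel_measurable lebesgue01"
  by (simp add: measurable_cong_sets[OF sets_lebesgue01 refl] measurable_restrict_space1)

lemma distr_lebesgue01: "distr N lebesgue01 f = distr N unit_space f"
  by (rule distr_cong) (simp_all add: sets_lebesgue01)

lemma endpoints_in_unit_space:
  assumes "sets M = sets interval_space"
  shows "fst \<in> M \<rightarrow>\<^sub>M unit_space" "snd \<in> M \<rightarrow>\<^sub>M unit_space"
proof -
  have "space M = intervals"
    using sets_eq_imp_space_eq[OF assms] by (simp add: space_restrict_space)
  then show "fst \<in> M \<rightarrow>\<^sub>M unit_space" "snd \<in> M \<rightarrow>\<^sub>M unit_space"
    using measurable_endpoints[OF assms]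
    by (auto intro!: measurable_restrict_space2 simp: intervals_def)
qed

lemma marginals_distr:
  assumes "f \<in> N \<rightarrow>\<^sub>M interval_space"
  shows "left_marginal (distr N interval_space f) = distr N lebesgue01 (\<lambda>z. fst (f z))"
    and "right_marginal (distr N interval_space f) = distr N lebesgue01 (\<lambda>z. snd (f z))"
  unfolding left_marginal_def right_marginal_def distr_lebesgue01
  by (subst distr_distr[OF endpoints_in_unit_space(1)[OF refl] assms]; simp add: comp_def)
     (subst distr_distr[OF endpoints_in_unit_space(2)[OF refl] assms]; simp add: comp_def)

lemma AE_lebesgue01_neq: "AE x in lebesgue01. x \<noteq> y"
  unfolding lebesgue01_def
  by (subst AE_restrict_space_iff) (auto intro: eventually_mono[OF AE_lborel_singleton[of y]])

lemma AE_neq_if_uniform: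
  assumes X: "X \<in> N \<rightarrow>\<^sub>M lebesgue01" and "distr N lebesgue01 X = lebesgue01"
  shows "AE z in N. X z \<noteq> y"
  by (rule AE_distrD[OF X]) (simp only: assms(2) AE_lebesgue01_neq)

lemma AE_pair_neq:
  fixes X Y :: "'a \<Rightarrow> real"
  assumes N: "prob_space N" and [measurable]: "X \<in> borel_measurable N" "Y \<in> borel_measurable N"
    and "(\<forall>y. AE z in N. X z \<noteq> y) \<or> (\<forall>y. AE z in N. Y z \<noteq> y)"
  shows "AE p in N \<Otimes>\<^sub>M N. X (fst p) \<noteq> Y (snd p)"
proof -
  interpret N: prob_space N by fact
  interpret NN: pair_sigma_finite N N ..
  have s: "{p \<in> space (N \<Otimes>\<^sub>M N). X (fst p) \<noteq> Y (snd p)} \<in> sets (N \<Otimes>\<^sub>M N)" by measurable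
  have "AE x in N. AE y in N. X x \<noteq> Y y"
    using assms(4)
  proof
    assume "\<forall>y. AE z in N. X z \<noteq> y"
    then have "AE y in N. AE x in N. X x \<noteq> Y y" by simp
    then show ?thesis using NN.AE_commute[of "\<lambda>x y. X x \<noteq> Y y"] s by simp
  next
    assume *: "\<forall>y. AE z in N. Y z \<noteq> y"
    have "AE y in N. X x \<noteq> Y y" for x
      using *[rule_format, of "X x"] by eventually_elim auto
    then show ?thesis by simp
  qed
  then show ?thesis by (intro NN.AE_pair_measure s) simp
qed

lemma distr_rank_at_self:
  assumes \<mu>: "prob_space \<mu>" and Z: "Z \<in> borel_measurable \<mu>"
  shows "distr (\<mu> \<Otimes>\<^sub>M lebesgue01) lebesgue01 (\<lambda>z. rank_at (distr \<mu> borel Z) (Z (fst z)) (snd z)) = lebesgue01"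
    and "(\<lambda>z. rank_at (distr \<mu> borel Z) (Z (fst z)) (snd z)) \<in> \<mu> \<Otimes>\<^sub>M lebesgue01 \<rightarrow>\<^sub>M lebesgue01"
proof -
  let ?m = "distr \<mu> borel Z"
  have m: "prob_space ?m" "sets ?m = sets borel" using \<mu> Z by (auto intro: prob_space.prob_space_distr)
  have id: "distr lebesgue01 lebesgue01 (\<lambda>x. x) = lebesgue01" by (rule distr_id)
  interpret U: prob_space lebesgue01 by (rule prob_space_lebesgue01)
  have "?m \<Otimes>\<^sub>M distr lebesgue01 lebesgue01 (\<lambda>x. x)
      = distr (\<mu> \<Otimes>\<^sub>M lebesgue01) (borel \<Otimes>\<^sub>M lebesgue01) (\<lambda>(x, y). (Z x, y))"
    using Z by (intro pair_measure_distr) (auto simp: id U.sigma_finite_measure_axioms)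
  then have eq: "?m \<Otimes>\<^sub>M lebesgue01 = distr (\<mu> \<Otimes>\<^sub>M lebesgue01) (borel \<Otimes>\<^sub>M lebesgue01) (\<lambda>(x, y). (Z x, y))"
    unfolding id .
  have T: "(\<lambda>z. rank_at ?m (fst z) (snd z)) \<in> borel \<Otimes>\<^sub>M lebesgue01 \<rightarrow>\<^sub>M lebesgue01"
  proof -
    have "(\<lambda>z. rank_at ?m (fst z) (snd z)) \<in> borel_measurable (borel \<Otimes>\<^sub>M lebesgue01)"
      by (intro rank_at_measurable m measurable_fst measurable_compose[OF measurable_snd measurable_lebesgue01_id])
    then show ?thesis
      unfolding measurable_lebesgue01_iff
      using rank_at_bounds[OF m] by (auto intro!: measurable_restrict_space2 simp: space_pair_measure)
  qed
  have Zp: "(\<lambda>(x, y). (Z x, y)) \<in> \<mu> \<Otimes>\<^sub>M lebesgue01 \<rightarrow>\<^sub>M borel \<Otimes>\<^sub>M lebesgue01"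
    using Z by measurable
  show "distr (\<mu> \<Otimes>\<^sub>M lebesgue01) lebesgue01 (\<lambda>z. rank_at ?m (Z (fst z)) (snd z)) = lebesgue01"
    using distr_rank_at[OF m] unfolding eq distr_distr[OF T Zp] by (simp add: comp_def case_prod_unfold)
  show "(\<lambda>z. rank_at ?m (Z (fst z)) (snd z)) \<in> \<mu> \<Otimes>\<^sub>M lebesgue01 \<rightarrow>\<^sub>M lebesgue01"
    using measurable_compose[OF Zp T] by (simp add: case_prod_unfold)
qed

text \<open>Both endpoints are randomized by functions of one and the same uniform variable, the last
  component of the argument; \<open>\<alpha> \<le> \<beta>\<close> keeps the left endpoint of a degenerate interval below the
  right one.\<close>

definition rank_interval :: "real measure \<Rightarrow> (real \<Rightarrow> real) \<Rightarrow> (real \<Rightarrow> real) \<Rightarrow> (real \<times> real) \<times> real \<Rightarrow> real \<times> real"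
  where "rank_interval m \<alpha> \<beta> z =
    (rank_at m (fst (fst z)) (\<alpha> (snd z)), rank_at m (snd (fst z)) (\<beta> (snd z)))"

lemma rank_interval_measurable:
  assumes \<mu>: "\<mu> \<in> interval_measures" and m: "prob_space m" "sets m = sets borel"
    and \<alpha>\<beta>: "\<alpha> \<in> borel_measurable borel" "\<beta> \<in> borel_measurable borel"
    and bounds: "\<And>v. v \<in> {0..1} \<Longrightarrow> 0 \<le> \<alpha> v \<and> \<alpha> v \<le> \<beta> v \<and> \<beta> v \<le> 1"
  shows "rank_interval m \<alpha> \<beta> \<in> \<mu> \<Otimes>\<^sub>M lebesgue01 \<rightarrow>\<^sub>M interval_space"
proof (rule measurable_restrict_space2)
  note M = interval_measuresD[OF \<mu>]
  have v: "(\<lambda>z. \<gamma> (snd z)) \<in> borel_measurable (\<mu> \<Otimes>\<^sub>M lebesgue01)" if "\<gamma> \<in> borel_measurable borel" for \<gamma> :: "real \<Rightarrow> real"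
    by (rule measurable_compose[OF measurable_snd measurable_compose[OF measurable_lebesgue01_id that]])
  have x: "(\<lambda>z. fst (fst z)) \<in> borel_measurable (\<mu> \<Otimes>\<^sub>M lebesgue01)"
    "(\<lambda>z. snd (fst z)) \<in> borel_measurable (\<mu> \<Otimes>\<^sub>M lebesgue01)"
    by (rule measurable_compose[OF measurable_fst measurable_endpoints(1)[OF M(2)]],
        rule measurable_compose[OF measurable_fst measurable_endpoints(2)[OF M(2)]])
  show "rank_interval m \<alpha> \<beta> \<in> borel_measurable (\<mu> \<Otimes>\<^sub>M lebesgue01)"
    unfolding rank_interval_def[abs_def]
    by (intro borel_measurable_Pair rank_at_measurable m x v \<alpha>\<beta>)
  show "rank_interval m \<alpha> \<beta> \<in> space (\<mu> \<Otimes>\<^sub>M lebesgue01) \<rightarrow> intervals"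
  proof
    fix z assume "z \<in> space (\<mu> \<Otimes>\<^sub>M lebesgue01)"
    then have z: "fst (fst z) \<le> snd (fst z)" "snd z \<in> {0..1}"
      by (auto simp: space_pair_measure M(3) intervals_def)
    note b = bounds[OF z(2)]
    have "rank_at m (fst (fst z)) (\<alpha> (snd z)) \<le> rank_at m (snd (fst z)) (\<beta> (snd z))"
    proof (cases "fst (fst z) = snd (fst z)")
      case True
      then show ?thesis using b rank_at_mono_second[OF m] by simp
    next
      case False
      then show ?thesis using b z by (intro rank_at_mono_strict m) auto
    qed
    then show "rank_interval m \<alpha> \<beta> z \<in> intervals"
      using rank_at_bounds[OF m] b by (auto simp: rank_interval_def intervals_def)
  qed
qed

text \<open>The rank transform is monotone, so it can only change the comparison between a left and a
  right endpoint by creating or resolving a tie.\<close>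

lemma interval_limit_rank_interval:
  assumes \<mu>: "\<mu> \<in> interval_measures" and m: "prob_space m" "sets m = sets borel"
    and \<alpha>\<beta>: "\<alpha> \<in> borel_measurable borel" "\<beta> \<in> borel_measurable borel"
    and bounds: "\<And>v. v \<in> {0..1} \<Longrightarrow> 0 \<le> \<alpha> v \<and> \<alpha> v \<le> \<beta> v \<and> \<beta> v \<le> 1"
    and no_tie: "(\<forall>y. AE z in \<mu> \<Otimes>\<^sub>M lebesgue01. fst (rank_interval m \<alpha> \<beta> z) \<noteq> y) \<or>
      (\<forall>y. AE z in \<mu> \<Otimes>\<^sub>M lebesgue01. snd (rank_interval m \<alpha> \<beta> z) \<noteq> y)"
    and tie: "(\<forall>v\<in>{0..1}. \<forall>w\<in>{0..1}. \<alpha> v \<le> \<beta> w) \<or> (\<forall>y. AE x in \<mu>. fst x \<noteq> y)"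
  shows "interval_limit (distr (\<mu> \<Otimes>\<^sub>M lebesgue01) interval_space (rank_interval m \<alpha> \<beta>)) = interval_limit \<mu>"
proof -
  note M = interval_measuresD[OF \<mu>]
  let ?N = "\<mu> \<Otimes>\<^sub>M lebesgue01" and ?f = "rank_interval m \<alpha> \<beta>"
  interpret \<mu>: prob_space \<mu> by (rule M(1))
  interpret U: prob_space lebesgue01 by (rule prob_space_lebesgue01)
  interpret N: pair_prob_space \<mu> lebesgue01 ..
  have N: "prob_space ?N" by (rule N.prob_space_axioms)
  have f: "?f \<in> ?N \<rightarrow>\<^sub>M interval_space" by (rule rank_interval_measurable[OF \<mu> m \<alpha>\<beta> bounds])
  have g: "fst \<in> ?N \<rightarrow>\<^sub>M interval_space"
    unfolding measurable_cong_sets[OF refl M(2)[symmetric]] by (rule measurable_fst)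
  have "distr ?N interval_space fst = distr ?N \<mu> fst" by (rule distr_cong) (simp_all add: M(2))
  also have "\<dots> = \<mu>" by (rule distr_pair_measure_fst[OF prob_space_lebesgue01])
  finally have g_eq: "distr ?N interval_space fst = \<mu>" .
  have fe: "(\<lambda>z. fst (?f z)) \<in> borel_measurable ?N" "(\<lambda>z. snd (?f z)) \<in> borel_measurable ?N"
    by (rule measurable_compose[OF f measurable_endpoints(1)[OF refl]],
        rule measurable_compose[OF f measurable_endpoints(2)[OF refl]])
  have ge: "(\<lambda>z. fst (fst z)) \<in> borel_measurable ?N" "(\<lambda>z. snd (fst z)) \<in> borel_measurable ?N"
    by (rule measurable_compose[OF g measurable_endpoints(1)[OF refl]],
        rule measurable_compose[OF g measurable_endpoints(2)[OF refl]])
  have 1: "AE p in ?N \<Otimes>\<^sub>M ?N. fst (?f (fst p)) \<noteq> snd (?f (snd p))"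
    by (rule AE_pair_neq[OF N fe no_tie])
  have 2: "AE p in ?N \<Otimes>\<^sub>M ?N. fst (fst (fst p)) = snd (fst (snd p)) \<longrightarrow> fst (?f (fst p)) \<le> snd (?f (snd p))"
    using tie
  proof
    assume "\<forall>v\<in>{0..1}. \<forall>w\<in>{0..1}. \<alpha> v \<le> \<beta> w"
    then show ?thesis
      by (intro AE_I2) (auto simp: space_pair_measure rank_interval_def intro!: rank_at_mono_second[OF m])
  next
    assume a: "\<forall>y. AE x in \<mu>. fst x \<noteq> y"
    have "AE z in ?N. fst (fst z) \<noteq> y" for y
    proof (rule AE_distrD[OF measurable_fst])
      show "AE x in distr ?N \<mu> fst. fst x \<noteq> y"
        unfolding distr_pair_measure_fst[OF prob_space_lebesgue01] using a by blast
    qed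
    then have "AE p in ?N \<Otimes>\<^sub>M ?N. fst (fst (fst p)) \<noteq> snd (fst (snd p))"
      by (intro AE_pair_neq[OF N ge] disjI1 allI)
    then show ?thesis by eventually_elim simp
  qed
  have "AE p in ?N \<Otimes>\<^sub>M ?N. p \<in> space (?N \<Otimes>\<^sub>M ?N)" by (rule AE_space)
  with 1 2 have "AE p in ?N \<Otimes>\<^sub>M ?N. fst (?f (fst p)) \<le> snd (?f (snd p))
      \<longleftrightarrow> fst (fst (fst p)) \<le> snd (fst (snd p))"
  proof eventually_elim
    case (elim p)
    then have v: "snd (fst p) \<in> {0..1}" "snd (snd p) \<in> {0..1}" by (auto simp: space_pair_measure)
    consider "fst (fst (fst p)) < snd (fst (snd p))" | "fst (fst (fst p)) = snd (fst (snd p))"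
      | "snd (fst (snd p)) < fst (fst (fst p))" by linarith
    then show ?case
    proof cases
      case 1
      then have "fst (?f (fst p)) \<le> snd (?f (snd p))"
        using bounds[OF v(1)] bounds[OF v(2)] unfolding rank_interval_def fst_conv snd_conv
        by (intro rank_at_mono_strict[OF m]) auto
      then show ?thesis using 1 by simp
    next
      case 2
      then show ?thesis using elim by simp
    next
      case 3
      then have "snd (?f (snd p)) \<le> fst (?f (fst p))"
        using bounds[OF v(1)] bounds[OF v(2)] unfolding rank_interval_def fst_conv snd_conv
        by (intro rank_at_mono_strict[OF m]) auto
      then show ?thesis using 3 elim by simp
    qed
  qed
  from interval_limit_distr_cong[OF N f g this] show ?thesis unfolding g_eq .
qed

text \<open>Left endpoints are spread over the jump at an atom and right endpoints are moved to its top, so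
  an interval that ends at an atom still meets the intervals that begin there.\<close>

lemma ex_left_normalized:
  assumes \<mu>: "\<mu> \<in> interval_measures"
  shows "\<exists>\<nu>\<in>interval_measures_L. interval_limit \<nu> = interval_limit \<mu>"
proof -
  note M = interval_measuresD[OF \<mu>]
  define m where "m = distr \<mu> borel fst"
  have m: "prob_space m" "sets m = sets borel"
    using M(1) measurable_endpoints[OF M(2)] by (auto simp: m_def intro: prob_space.prob_space_distr)
  let ?N = "\<mu> \<Otimes>\<^sub>M lebesgue01" and ?f = "rank_interval m (\<lambda>v. v) (\<lambda>_. 1)"
  interpret \<mu>: prob_space \<mu> by (rule M(1))
  interpret U: prob_space lebesgue01 by (rule prob_space_lebesgue01)
  interpret N: pair_prob_space \<mu> lebesgue01 ..
  have f: "?f \<in> ?N \<rightarrow>\<^sub>M interval_space" by (rule rank_interval_measurable[OF \<mu> m]) auto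
  have law: "distr ?N lebesgue01 (\<lambda>z. fst (?f z)) = lebesgue01" "(\<lambda>z. fst (?f z)) \<in> ?N \<rightarrow>\<^sub>M lebesgue01"
    using distr_rank_at_self[OF M(1) measurable_endpoints(1)[OF M(2)]] by (simp_all add: rank_interval_def m_def)
  have "interval_limit (distr ?N interval_space ?f) = interval_limit \<mu>"
  proof (rule interval_limit_rank_interval[OF \<mu> m])
    show "(\<forall>y. AE z in ?N. fst (?f z) \<noteq> y) \<or> (\<forall>y. AE z in ?N. snd (?f z) \<noteq> y)"
      using AE_neq_if_uniform[OF law(2,1)] by blast
  qed auto
  moreover have "distr ?N interval_space ?f \<in> interval_measures_L"
    using distr_in_interval_measures[OF N.prob_space_axioms f] law marginals_distr[OF f]
    by (simp add: interval_measures_L_def)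
  ultimately show ?thesis by blast
qed

text \<open>In the mirror image, right endpoints are spread over the jump at an atom and left endpoints are
  moved to its bottom.\<close>

lemma ex_right_normalized:
  assumes \<mu>: "\<mu> \<in> interval_measures"
  shows "\<exists>\<nu>\<in>interval_measures_R. interval_limit \<nu> = interval_limit \<mu>"
proof -
  note M = interval_measuresD[OF \<mu>]
  define m where "m = distr \<mu> borel snd"
  have m: "prob_space m" "sets m = sets borel"
    using M(1) measurable_endpoints[OF M(2)] by (auto simp: m_def intro: prob_space.prob_space_distr)
  let ?N = "\<mu> \<Otimes>\<^sub>M lebesgue01" and ?f = "rank_interval m (\<lambda>_. 0) (\<lambda>v. v)"
  interpret \<mu>: prob_space \<mu> by (rule M(1))
  interpret U: prob_space lebesgue01 by (rule prob_space_lebesgue01)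
  interpret N: pair_prob_space \<mu> lebesgue01 ..
  have f: "?f \<in> ?N \<rightarrow>\<^sub>M interval_space" by (rule rank_interval_measurable[OF \<mu> m]) auto
  have law: "distr ?N lebesgue01 (\<lambda>z. snd (?f z)) = lebesgue01" "(\<lambda>z. snd (?f z)) \<in> ?N \<rightarrow>\<^sub>M lebesgue01"
    using distr_rank_at_self[OF M(1) measurable_endpoints(2)[OF M(2)]] by (simp_all add: rank_interval_def m_def)
  have "interval_limit (distr ?N interval_space ?f) = interval_limit \<mu>"
  proof (rule interval_limit_rank_interval[OF \<mu> m])
    show "(\<forall>y. AE z in ?N. fst (?f z) \<noteq> y) \<or> (\<forall>y. AE z in ?N. snd (?f z) \<noteq> y)"
      using AE_neq_if_uniform[OF law(2,1)] by blast
  qed auto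
  moreover have "distr ?N interval_space ?f \<in> interval_measures_R"
    using distr_in_interval_measures[OF N.prob_space_axioms f] law marginals_distr[OF f]
    by (simp add: interval_measures_R_def)
  ultimately show ?thesis by blast
qed

text \<open>Averaging over a fair coin that selects one of the two endpoints turns the rank transform of
  the averaged marginal into the average of the laws of the two transformed endpoints.\<close>

lemma lebesgue01_eq_average_of_rank_laws:
  assumes \<mu>: "\<mu> \<in> interval_measures"
  obtains m where "prob_space m" "sets m = sets borel"
    "\<And>A. A \<in> sets lebesgue01 \<Longrightarrow>
      (measure (distr (\<mu> \<Otimes>\<^sub>M lebesgue01) lebesgue01 (\<lambda>z. rank_at m (fst (fst z)) (snd z))) A
      + measure (distr (\<mu> \<Otimes>\<^sub>M lebesgue01) lebesgue01 (\<lambda>z. rank_at m (snd (fst z)) (snd z))) A) / 2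
      = measure lebesgue01 A"
proof -
  note M = interval_measuresD[OF \<mu>]
  let ?C = "measure_pmf (bernoulli_pmf (1/2))"
  let ?Q = "?C \<Otimes>\<^sub>M \<mu>" and ?N = "\<mu> \<Otimes>\<^sub>M lebesgue01"
  define Z where "Z q = (if fst q then fst (snd q) else snd (snd q))" for q :: "bool \<times> real \<times> real"
  define m where "m = distr ?Q borel Z"
  interpret C: prob_space ?C by (rule measure_pmf.prob_space_axioms)
  interpret \<mu>: prob_space \<mu> by (rule M(1))
  interpret U: prob_space lebesgue01 by (rule prob_space_lebesgue01)
  interpret Q: pair_prob_space ?C \<mu> ..
  interpret N: pair_prob_space \<mu> lebesgue01 ..
  have [measurable]: "fst \<in> borel_measurable \<mu>" "snd \<in> borel_measurable \<mu>"
    by (rule measurable_endpoints[OF M(2)])+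
  have Z: "Z \<in> borel_measurable ?Q" unfolding Z_def by measurable
  have m: "prob_space m" "sets m = sets borel"
    unfolding m_def using Z by (auto intro: Q.prob_space_distr)
  have T_meas: "(\<lambda>z. rank_at m (e (fst z)) (snd z)) \<in> N' \<Otimes>\<^sub>M lebesgue01 \<rightarrow>\<^sub>M lebesgue01"
    if "e \<in> borel_measurable N'" for e :: "'z \<Rightarrow> real" and N'
  proof -
    have "(\<lambda>z. rank_at m (e (fst z)) (snd z)) \<in> borel_measurable (N' \<Otimes>\<^sub>M lebesgue01)"
      by (intro rank_at_measurable m measurable_compose[OF measurable_fst that]
          measurable_compose[OF measurable_snd measurable_lebesgue01_id])
    then show ?thesis
      unfolding measurable_lebesgue01_iff
      using rank_at_bounds[OF m] by (auto intro!: measurable_restrict_space2 simp: space_pair_measure)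
  qed
  have "(measure (distr ?N lebesgue01 (\<lambda>z. rank_at m (fst (fst z)) (snd z))) A
      + measure (distr ?N lebesgue01 (\<lambda>z. rank_at m (snd (fst z)) (snd z))) A) / 2 = measure lebesgue01 A"
    if A: "A \<in> sets lebesgue01" for A
  proof -
    define h where "h x = emeasure lebesgue01 {v \<in> {0..1}. rank_at m x v \<in> A}" for x
    have law: "emeasure (distr (N' \<Otimes>\<^sub>M lebesgue01) lebesgue01 (\<lambda>z. rank_at m (e (fst z)) (snd z))) A
        = (\<integral>\<^sup>+ x. h (e x) \<partial>N') \<and> (\<lambda>x. h (e x)) \<in> borel_measurable N'"
      if e: "e \<in> borel_measurable N'" for e :: "'z \<Rightarrow> real" and N'
    proof -
      let ?S = "(\<lambda>z. rank_at m (e (fst z)) (snd z)) -` A \<inter> space (N' \<Otimes>\<^sub>M lebesgue01)"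
      have S: "?S \<in> sets (N' \<Otimes>\<^sub>M lebesgue01)" using T_meas[OF e] A by (rule measurable_sets)
      have sec: "emeasure lebesgue01 (Pair x -` ?S) = h (e x)" if "x \<in> space N'" for x
        unfolding h_def using that by (intro arg_cong[where f = "emeasure lebesgue01"]) (auto simp: space_pair_measure)
      have "emeasure (distr (N' \<Otimes>\<^sub>M lebesgue01) lebesgue01 (\<lambda>z. rank_at m (e (fst z)) (snd z))) A
          = emeasure (N' \<Otimes>\<^sub>M lebesgue01) ?S"
        using T_meas[OF e] A by (rule emeasure_distr)
      also have "\<dots> = (\<integral>\<^sup>+ x. emeasure lebesgue01 (Pair x -` ?S) \<partial>N')"
        by (rule U.emeasure_pair_measure_alt[OF S])
      also have "\<dots> = (\<integral>\<^sup>+ x. h (e x) \<partial>N')" by (rule nn_integral_cong) (rule sec)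
      finally show ?thesis
        using U.measurable_emeasure_Pair[OF S] sec by (simp cong: measurable_cong)
    qed
    have "emeasure lebesgue01 A = (\<integral>\<^sup>+ q. h (Z q) \<partial>?Q)"
      using law[OF Z] distr_rank_at_self(1)[OF Q.prob_space_axioms Z] by (simp add: m_def)
    also have "\<dots> = (\<integral>\<^sup>+ c. (\<integral>\<^sup>+ x. h (Z (c, x)) \<partial>\<mu>) \<partial>?C)"
      using law[OF Z] by (intro \<mu>.nn_integral_fst[symmetric]) auto
    also have "\<dots> = (\<integral>\<^sup>+ x. h (fst x) \<partial>\<mu>) * ennreal (1/2) + (\<integral>\<^sup>+ x. h (snd x) \<partial>\<mu>) * ennreal (1/2)"
      by (subst nn_integral_bernoulli_pmf) (auto simp: Z_def)
    also have "(\<integral>\<^sup>+ x. h (fst x) \<partial>\<mu>) = emeasure (distr ?N lebesgue01 (\<lambda>z. rank_at m (fst (fst z)) (snd z))) A"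
      using law[of fst \<mu>] by simp
    also have "(\<integral>\<^sup>+ x. h (snd x) \<partial>\<mu>) = emeasure (distr ?N lebesgue01 (\<lambda>z. rank_at m (snd (fst z)) (snd z))) A"
      using law[of snd \<mu>] by simp
    finally have eq: "emeasure lebesgue01 A
      = emeasure (distr ?N lebesgue01 (\<lambda>z. rank_at m (fst (fst z)) (snd z))) A * ennreal (1/2)
      + emeasure (distr ?N lebesgue01 (\<lambda>z. rank_at m (snd (fst z)) (snd z))) A * ennreal (1/2)" .
    interpret L: prob_space "distr ?N lebesgue01 (\<lambda>z. rank_at m (fst (fst z)) (snd z))"
      using T_meas[of fst \<mu>] by (intro N.prob_space_distr) auto
    interpret R: prob_space "distr ?N lebesgue01 (\<lambda>z. rank_at m (snd (fst z)) (snd z))"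
      using T_meas[of snd \<mu>] by (intro N.prob_space_distr) auto
    have half: "0 \<le> (1 / 2 :: real)" by simp
    let ?l = "measure (distr ?N lebesgue01 (\<lambda>z. rank_at m (fst (fst z)) (snd z))) A"
    let ?r = "measure (distr ?N lebesgue01 (\<lambda>z. rank_at m (snd (fst z)) (snd z))) A"
    have "ennreal (measure lebesgue01 A) = ennreal (?l * (1/2) + ?r * (1/2))"
      using eq unfolding U.emeasure_eq_measure L.emeasure_eq_measure R.emeasure_eq_measure
      by (simp only: ennreal_plus ennreal_mult measure_nonneg half mult_nonneg_nonneg)
    then have "measure lebesgue01 A = ?l * (1/2) + ?r * (1/2)"
      by (subst (asm) ennreal_inj) (auto intro!: add_nonneg_nonneg)
    then show ?thesis by (simp add: field_simps)
  qed
  with m show ?thesis by (rule that)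
qed

text \<open>If the left endpoint is uniform, then a left endpoint almost surely differs from an independent
  right endpoint, so both can be spread over the jumps in the same way. New ties almost surely do not arise,
  since the transformed left endpoint has a law bounded by twice the uniform distribution.\<close>

lemma ex_average_normalized:
  assumes \<mu>: "\<mu> \<in> interval_measures_L"
  shows "\<exists>\<nu>\<in>interval_measures_m. interval_limit \<nu> = interval_limit \<mu>"
proof -
  have \<mu>P: "\<mu> \<in> interval_measures" and left: "left_marginal \<mu> = lebesgue01"
    using \<mu> by (auto simp: interval_measures_L_def)
  note M = interval_measuresD[OF \<mu>P]
  let ?N = "\<mu> \<Otimes>\<^sub>M lebesgue01"
  obtain m where m: "prob_space m" "sets m = sets borel" and
    avg: "\<And>A. A \<in> sets lebesgue01 \<Longrightarrow>
      (measure (distr ?N lebesgue01 (\<lambda>z. rank_at m (fst (fst z)) (snd z))) A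
      + measure (distr ?N lebesgue01 (\<lambda>z. rank_at m (snd (fst z)) (snd z))) A) / 2
      = measure lebesgue01 A"
    using lebesgue01_eq_average_of_rank_laws[OF \<mu>P] by blast
  let ?f = "rank_interval m (\<lambda>v. v) (\<lambda>v. v)"
  interpret \<mu>: prob_space \<mu> by (rule M(1))
  interpret U: prob_space lebesgue01 by (rule prob_space_lebesgue01)
  interpret N: pair_prob_space \<mu> lebesgue01 ..
  have f: "?f \<in> ?N \<rightarrow>\<^sub>M interval_space" by (rule rank_interval_measurable[OF \<mu>P m]) auto
  have fe: "(\<lambda>z. fst (?f z)) \<in> ?N \<rightarrow>\<^sub>M lebesgue01"
    unfolding measurable_lebesgue01_iff
    by (rule measurable_compose[OF f endpoints_in_unit_space(1)[OF refl]])
  interpret L: prob_space "distr ?N lebesgue01 (\<lambda>z. fst (?f z))" by (rule N.prob_space_distr[OF fe])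
  have "interval_limit (distr ?N interval_space ?f) = interval_limit \<mu>"
  proof (rule interval_limit_rank_interval[OF \<mu>P m])
    have "AE z in ?N. fst (?f z) \<noteq> y" for y
    proof -
      have A: "{y} \<inter> {0..1} \<in> sets lebesgue01" by (intro borel_subset_in_sets_lebesgue01) auto
      have "measure lebesgue01 ({y} \<inter> {0..1}) = 0"
        by (subst measure_lebesgue01) (auto intro!: measure_eq_0_null_sets finite_imp_null_set_lborel)
      then have "measure (distr ?N lebesgue01 (\<lambda>z. fst (?f z))) ({y} \<inter> {0..1}) = 0"
        using avg[OF A] unfolding rank_interval_def fst_conv
        by (smt (verit) measure_nonneg field_sum_of_halves divide_eq_0_iff)
      then have "emeasure (distr ?N lebesgue01 (\<lambda>z. fst (?f z))) ({y} \<inter> {0..1}) = 0"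
        by (simp add: L.emeasure_eq_measure)
      then have "{y} \<inter> {0..1} \<in> null_sets (distr ?N lebesgue01 (\<lambda>z. fst (?f z)))"
        using A by (auto intro: null_setsI)
      from AE_not_in[OF this] have "AE x in distr ?N lebesgue01 (\<lambda>z. fst (?f z)). x \<notin> {y} \<inter> {0..1}" .
      from AE_distrD[OF fe this] AE_space[of ?N] show ?thesis
        by eventually_elim (use measurable_space[OF fe] in auto)
    qed
    then show "(\<forall>y. AE z in ?N. fst (?f z) \<noteq> y) \<or> (\<forall>y. AE z in ?N. snd (?f z) \<noteq> y)" by blast
    have "distr \<mu> lebesgue01 fst = lebesgue01"
      using left by (simp add: left_marginal_def distr_lebesgue01)
    moreover have "fst \<in> \<mu> \<rightarrow>\<^sub>M lebesgue01"
      unfolding measurable_lebesgue01_iff by (rule endpoints_in_unit_space[OF M(2)])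
    ultimately show "(\<forall>v\<in>{0..1::real}. \<forall>w\<in>{0..1}. v \<le> w) \<or> (\<forall>y. AE x in \<mu>. fst x \<noteq> y)"
      using AE_neq_if_uniform[of fst \<mu>] by blast
  qed auto
  moreover have "distr ?N interval_space ?f \<in> interval_measures_m"
    using distr_in_interval_measures[OF N.prob_space_axioms f] avg
    by (simp add: interval_measures_m_def marginals_distr[OF f] rank_interval_def)
  ultimately show ?thesis by blast
qed


section \<open>Continuity\<close>

lemma compact_intervals: "compact intervals"
proof -
  have "compact (({0..1::real} \<times> {0..1::real}) \<inter> {p. fst p \<le> snd p})"
    by (intro compact_Int_closed compact_Times compact_Icc closed_Collect_le continuous_intros)
  also have "({0..1::real} \<times> {0..1::real}) \<inter> {p. fst p \<le> snd p} = intervals"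
    by (auto simp: intervals_def)
  finally show ?thesis .
qed

lemma integrable_continuous_on_intervals:
  fixes f :: "real \<times> real \<Rightarrow> real"
  assumes \<mu>: "\<mu> \<in> interval_measures" and f: "continuous_on intervals f"
  shows "integrable \<mu> f"
proof -
  note M = interval_measuresD[OF \<mu>]
  interpret prob_space \<mu> by (rule M(1))
  have "f \<in> borel_measurable \<mu>"
    unfolding measurable_cong_sets[OF M(2) refl] by (rule borel_measurable_continuous_on_restrict[OF f])
  moreover obtain B where "\<And>x. x \<in> intervals \<Longrightarrow> norm (f x) \<le> B"
    using compact_imp_bounded[OF compact_continuous_image[OF f compact_intervals]]
    by (auto simp: bounded_iff)
  ultimately show ?thesis by (intro integrable_const_bound[where B = B]) (auto simp: M(3))
qed

lemma topspace_weak_topology: "topspace weak_topology = interval_measures"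
  by (auto simp: weak_topology_def Let_def topspace_pullback_topology)

lemma continuous_map_integral:
  fixes f :: "real \<times> real \<Rightarrow> real"
  assumes "continuous_on intervals f"
  shows "continuous_map weak_topology euclideanreal (\<lambda>\<mu>. \<integral>x. f x \<partial>\<mu>)"
proof -
  let ?C = "{f :: real \<times> real \<Rightarrow> real. continuous_on intervals f}"
  have "continuous_map weak_topology euclideanreal ((\<lambda>p. p f) \<circ> (\<lambda>\<mu>. \<lambda>f\<in>?C. \<integral>x. f x \<partial>\<mu>))"
    unfolding weak_topology_def Let_def
    using assms by (intro continuous_map_pullback continuous_map_product_projection) auto
  then show ?thesis using assms by (simp add: comp_def)
qed

definition ramp :: "nat \<Rightarrow> real \<Rightarrow> real \<Rightarrow> real" where
  "ramp N k x = max 0 (min 1 (real N * x - k))"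

definition tent :: "nat \<Rightarrow> real \<Rightarrow> real \<Rightarrow> real" where
  "tent N k x = ramp N (k - 1) x - ramp N k x"

text \<open>A continuous substitute for the comparison of two points of the unit interval that is exact
  unless they are closer than the mesh \<open>2 / N\<close>. The tents form a partition of unity that locates
  the first argument, and the ramp compares the second argument with the tent. Being a finite sum
  of products of functions of one argument each, it turns densities into polynomials in integrals
  of continuous functions.\<close>

definition soft_le :: "nat \<Rightarrow> real \<Rightarrow> real \<Rightarrow> real" where
  "soft_le N a b = (\<Sum>k\<le>N. tent N (real k) a * ramp N (real k) b)"

lemma ramp_bounds: "0 \<le> ramp N k x" "ramp N k x \<le> 1"
  by (auto simp: ramp_def)

lemma tent_bounds: "0 \<le> tent N k x" "tent N k x \<le> 1"
  by (auto simp: tent_def ramp_def)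

lemma sum_tent:
  assumes "a \<in> {0..1}"
  shows "(\<Sum>k\<le>N. tent N (real k) a) = 1"
proof -
  have "(\<Sum>k\<le>N. tent N (real k) a) = (\<Sum>k\<le>N. ramp N (real k - 1) a - ramp N (real (Suc k) - 1) a)"
    by (simp add: tent_def)
  also have "\<dots> = ramp N (real 0 - 1) a - ramp N (real (Suc N) - 1) a"
    by (rule sum_telescope)
  also have "\<dots> = 1"
    using assms mult_left_mono[of a 1 "real N"] by (auto simp: ramp_def)
  finally show ?thesis .
qed

lemma soft_le_bounds:
  assumes "a \<in> {0..1}"
  shows "0 \<le> soft_le N a b" "soft_le N a b \<le> 1"
proof -
  show "0 \<le> soft_le N a b"
    unfolding soft_le_def by (intro sum_nonneg mult_nonneg_nonneg tent_bounds ramp_bounds)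
  have "soft_le N a b \<le> (\<Sum>k\<le>N. tent N (real k) a * 1)"
    unfolding soft_le_def by (intro sum_mono mult_left_mono tent_bounds ramp_bounds)
  then show "soft_le N a b \<le> 1" using sum_tent[OF assms] by simp
qed

lemma soft_le_error:
  assumes a: "a \<in> {0..1}" and N: "N > 0"
  shows "\<bar>of_bool (a \<le> b) - soft_le N a b\<bar> \<le> of_bool (\<bar>a - b\<bar> \<le> 2 / real N)"
proof (cases "\<bar>a - b\<bar> \<le> 2 / real N")
  case True
  then show ?thesis using soft_le_bounds[OF a, of N b] by (cases "a \<le> b") auto
next
  case False
  then consider "a + 2 / real N < b" | "b + 2 / real N < a" by linarith
  then show ?thesis
  proof cases
    case 1
    then have *: "real N * a + 2 < real N * b"
      using N mult_strict_left_mono[of "a + 2 / real N" b "real N"] by (simp add: algebra_simps)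
    have "tent N (real k) a * ramp N (real k) b = tent N (real k) a" for k
      using * by (auto simp: tent_def ramp_def)
    then have "soft_le N a b = 1" by (simp only: soft_le_def sum_tent[OF a])
    moreover have "a \<le> b" using 1 by (smt (verit) divide_nonneg_nonneg of_nat_0_le_iff)
    ultimately show ?thesis by simp
  next
    case 2
    then have *: "real N * b + 2 < real N * a"
      using N mult_strict_left_mono[of "b + 2 / real N" a "real N"] by (simp add: algebra_simps)
    have "tent N (real k) a * ramp N (real k) b = 0" for k
      using * by (auto simp: tent_def ramp_def)
    then have "soft_le N a b = 0" by (simp only: soft_le_def sum.neutral_const)
    moreover have "\<not> a \<le> b" using 2 by (smt (verit) divide_nonneg_nonneg of_nat_0_le_iff)
    ultimately show ?thesis by simp
  qed
qed

lemma continuous_on_ramp [continuous_intros]: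
  assumes "continuous_on A f"
  shows "continuous_on A (\<lambda>x. ramp N k (f x))"
  unfolding ramp_def by (intro continuous_intros assms)

lemma continuous_on_tent [continuous_intros]:
  assumes "continuous_on A f"
  shows "continuous_on A (\<lambda>x. tent N k (f x))"
  unfolding tent_def by (intro continuous_intros assms)

lemma soft_le_measurable:
  assumes "f \<in> borel_measurable M" "g \<in> borel_measurable M"
  shows "(\<lambda>x. soft_le N (f x) (g x)) \<in> borel_measurable M"
proof -
  have "ramp N k \<in> borel_measurable borel" "tent N k \<in> borel_measurable borel" for k
    by (intro borel_measurable_continuous_onI continuous_on_ramp continuous_on_tent continuous_on_id)+
  from measurable_compose[OF assms(2) this(1)] measurable_compose[OF assms(1) this(2)]
  show ?thesis unfolding soft_le_def by (intro borel_measurable_sum borel_measurable_times)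
qed

definition soft_overlap :: "nat \<Rightarrow> fgraph \<Rightarrow> (nat \<Rightarrow> real \<times> real) \<Rightarrow> real" where
  "soft_overlap N F x = (\<Prod>(i, j)\<in>arcs F. soft_le N (fst (x i)) (snd (x j)))"

text \<open>Multiplying out the sums and collecting the factors at each vertex separates the variables.\<close>

lemma soft_overlap_eq_sum:
  "soft_overlap N F x = (\<Sum>g\<in>arcs F \<rightarrow>\<^sub>E {..N}. \<Prod>v\<in>verts F.
     (\<Prod>e\<in>{e \<in> arcs F. fst e = v}. tent N (real (g e)) (fst (x v))) *
     (\<Prod>e\<in>{e \<in> arcs F. snd e = v}. ramp N (real (g e)) (snd (x v))))"
proof -
  have "soft_overlap N F x = (\<Prod>e\<in>arcs F. \<Sum>k\<le>N. tent N (real k) (fst (x (fst e))) * ramp N (real k) (snd (x (snd e))))"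
    by (simp add: soft_overlap_def soft_le_def case_prod_unfold)
  also have "\<dots> = (\<Sum>g\<in>arcs F \<rightarrow>\<^sub>E {..N}. \<Prod>e\<in>arcs F.
      tent N (real (g e)) (fst (x (fst e))) * ramp N (real (g e)) (snd (x (snd e))))"
    by (rule prod_sum_PiE) auto
  also have "\<dots> = (\<Sum>g\<in>arcs F \<rightarrow>\<^sub>E {..N}. \<Prod>v\<in>verts F.
     (\<Prod>e\<in>{e \<in> arcs F. fst e = v}. tent N (real (g e)) (fst (x v))) *
     (\<Prod>e\<in>{e \<in> arcs F. snd e = v}. ramp N (real (g e)) (snd (x v))))"
  proof (rule sum.cong[OF refl])
    fix g
    have "(\<Prod>e\<in>arcs F. tent N (real (g e)) (fst (x (fst e))))
        = (\<Prod>v\<in>verts F. \<Prod>e\<in>{e \<in> arcs F. fst e = v}. tent N (real (g e)) (fst (x (fst e))))"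
      using arcs_subset[of F] by (intro prod.group[symmetric]) auto
    moreover have "(\<Prod>e\<in>arcs F. ramp N (real (g e)) (snd (x (snd e))))
        = (\<Prod>v\<in>verts F. \<Prod>e\<in>{e \<in> arcs F. snd e = v}. ramp N (real (g e)) (snd (x (snd e))))"
      using arcs_subset[of F] by (intro prod.group[symmetric]) auto
    ultimately show "(\<Prod>e\<in>arcs F. tent N (real (g e)) (fst (x (fst e))) * ramp N (real (g e)) (snd (x (snd e))))
      = (\<Prod>v\<in>verts F.
     (\<Prod>e\<in>{e \<in> arcs F. fst e = v}. tent N (real (g e)) (fst (x v))) *
     (\<Prod>e\<in>{e \<in> arcs F. snd e = v}. ramp N (real (g e)) (snd (x v))))"
      by (simp add: prod.distrib)
  qed
  finally show ?thesis .
qed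

lemma continuous_map_soft_overlap:
  "continuous_map weak_topology euclideanreal (\<lambda>\<mu>. \<integral>x. soft_overlap N F x \<partial>PiM (verts F) (\<lambda>_. \<mu>))"
proof -
  define h where "h g v y = (\<Prod>e\<in>{e \<in> arcs F. fst e = v}. tent N (real (g e)) (fst y)) *
     (\<Prod>e\<in>{e \<in> arcs F. snd e = v}. ramp N (real (g e)) (snd y))" for g v and y :: "real \<times> real"
  have h: "continuous_on intervals (h g v)" for g :: "nat \<times> nat \<Rightarrow> nat" and v
    unfolding h_def by (intro continuous_intros)
  have eq: "(\<integral>x. soft_overlap N F x \<partial>PiM (verts F) (\<lambda>_. \<mu>))
      = (\<Sum>g\<in>arcs F \<rightarrow>\<^sub>E {..N}. \<Prod>v\<in>verts F. \<integral>y. h g v y \<partial>\<mu>)" if \<mu>: "\<mu> \<in> interval_measures" for \<mu>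
  proof -
    interpret \<mu>: prob_space \<mu> by (rule interval_measuresD(1)[OF \<mu>])
    interpret P: product_sigma_finite "\<lambda>_. \<mu>" by standard
    have hi: "integrable \<mu> (h g v)" for g v by (rule integrable_continuous_on_intervals[OF \<mu> h])
    have "(\<integral>x. soft_overlap N F x \<partial>PiM (verts F) (\<lambda>_. \<mu>))
        = (\<integral>x. (\<Sum>g\<in>arcs F \<rightarrow>\<^sub>E {..N}. \<Prod>v\<in>verts F. h g v (x v)) \<partial>PiM (verts F) (\<lambda>_. \<mu>))"
      by (simp add: soft_overlap_eq_sum h_def)
    also have "\<dots> = (\<Sum>g\<in>arcs F \<rightarrow>\<^sub>E {..N}. \<integral>x. (\<Prod>v\<in>verts F. h g v (x v)) \<partial>PiM (verts F) (\<lambda>_. \<mu>))"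
      by (intro Bochner_Integration.integral_sum P.product_integrable_prod hi finite_verts)
    also have "\<dots> = (\<Sum>g\<in>arcs F \<rightarrow>\<^sub>E {..N}. \<Prod>v\<in>verts F. \<integral>y. h g v y \<partial>\<mu>)"
      by (intro sum.cong refl P.product_integral_prod hi finite_verts)
    finally show ?thesis .
  qed
  have "continuous_map weak_topology euclideanreal
      (\<lambda>\<mu>. \<Sum>g\<in>arcs F \<rightarrow>\<^sub>E {..N}. \<Prod>v\<in>verts F. \<integral>y. h g v y \<partial>\<mu>)"
    by (intro continuous_map_sum continuous_map_prod continuous_map_integral h finite_verts finite_PiE finite_arcs) auto
  then show ?thesis
    by (rule continuous_map_eq) (simp add: eq topspace_weak_topology)
qed

text \<open>A property common to the three normalizations; the constant 2 is what the averaged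
  normalization gives for either endpoint.\<close>

definition spread_endpoint :: "(real \<times> real) measure \<Rightarrow> bool" where
  "spread_endpoint \<mu> \<longleftrightarrow>
     (\<forall>s t. s \<le> t \<longrightarrow> measure \<mu> {x \<in> space \<mu>. fst x \<in> {s..t}} \<le> 2 * (t - s)) \<or>
     (\<forall>s t. s \<le> t \<longrightarrow> measure \<mu> {x \<in> space \<mu>. snd x \<in> {s..t}} \<le> 2 * (t - s))"

text \<open>Once the interval that contributes the other endpoint is fixed, the spread endpoint has to lie in
  an interval of length \<open>2 d\<close>.\<close>

lemma near_tie_probability:
  assumes \<mu>: "\<mu> \<in> interval_measures" and tame: "spread_endpoint \<mu>" and d: "0 \<le> d"
  shows "measure (\<mu> \<Otimes>\<^sub>M \<mu>) {z \<in> space (\<mu> \<Otimes>\<^sub>M \<mu>). \<bar>fst (fst z) - snd (snd z)\<bar> \<le> d} \<le> 4 * d"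
proof -
  note M = interval_measuresD[OF \<mu>]
  interpret \<mu>: prob_space \<mu> by (rule M(1))
  interpret N: pair_prob_space \<mu> \<mu> ..
  have [measurable]: "fst \<in> borel_measurable \<mu>" "snd \<in> borel_measurable \<mu>"
    by (rule measurable_endpoints[OF M(2)])+
  let ?S = "{z \<in> space (\<mu> \<Otimes>\<^sub>M \<mu>). \<bar>fst (fst z) - snd (snd z)\<bar> \<le> d}"
  have S: "?S \<in> sets (\<mu> \<Otimes>\<^sub>M \<mu>)" by measurable
  have "emeasure (\<mu> \<Otimes>\<^sub>M \<mu>) ?S \<le> ennreal (4 * d)"
    using tame unfolding spread_endpoint_def
  proof
    assume *: "\<forall>s t. s \<le> t \<longrightarrow> measure \<mu> {x \<in> space \<mu>. fst x \<in> {s..t}} \<le> 2 * (t - s)"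
    have "emeasure \<mu> ((\<lambda>x. (x, y)) -` ?S) \<le> ennreal (4 * d)" if y: "y \<in> space \<mu>" for y
    proof -
      have "(\<lambda>x. (x, y)) -` ?S = {x \<in> space \<mu>. fst x \<in> {snd y - d..snd y + d}}"
        using y by (auto simp: space_pair_measure)
      then show ?thesis
        using *[rule_format, of "snd y - d" "snd y + d"] d
        by (simp add: \<mu>.emeasure_eq_measure ennreal_leI)
    qed
    then have "(\<integral>\<^sup>+ y. emeasure \<mu> ((\<lambda>x. (x, y)) -` ?S) \<partial>\<mu>) \<le> (\<integral>\<^sup>+ y. ennreal (4 * d) \<partial>\<mu>)"
      by (intro nn_integral_mono) auto
    then show ?thesis
      unfolding N.emeasure_pair_measure_alt2[OF S] by (simp add: \<mu>.emeasure_space_1)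
  next
    assume *: "\<forall>s t. s \<le> t \<longrightarrow> measure \<mu> {x \<in> space \<mu>. snd x \<in> {s..t}} \<le> 2 * (t - s)"
    have "emeasure \<mu> (Pair x -` ?S) \<le> ennreal (4 * d)" if x: "x \<in> space \<mu>" for x
    proof -
      have "Pair x -` ?S = {y \<in> space \<mu>. snd y \<in> {fst x - d..fst x + d}}"
        using x by (auto simp: space_pair_measure)
      then show ?thesis
        using *[rule_format, of "fst x - d" "fst x + d"] d
        by (simp add: \<mu>.emeasure_eq_measure ennreal_leI)
    qed
    then have "(\<integral>\<^sup>+ x. emeasure \<mu> (Pair x -` ?S) \<partial>\<mu>) \<le> (\<integral>\<^sup>+ y. ennreal (4 * d) \<partial>\<mu>)"
      by (intro nn_integral_mono) auto
    then show ?thesis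
      unfolding \<mu>.emeasure_pair_measure_alt[OF S] by (simp add: \<mu>.emeasure_space_1)
  qed
  then show ?thesis using d by (simp add: N.emeasure_eq_measure)
qed

text \<open>Products of numbers between 0 and 1 differ by at most the sum of the differences of the factors,
  and a factor changes only if its two endpoints are nearly tied. The bound is uniform in \<open>\<mu>\<close>, which is
  what makes the limit \<open>N \<rightarrow> \<infinity>\<close> preserve continuity.\<close>

lemma soft_overlap_error:
  assumes \<mu>: "\<mu> \<in> interval_measures" and tame: "spread_endpoint \<mu>" and N: "N > 0"
  shows "\<bar>interval_limit \<mu> F - (\<integral>x. soft_overlap N F x \<partial>PiM (verts F) (\<lambda>_. \<mu>))\<bar>
    \<le> 8 * real (card (arcs F)) / real N"
proof -
  note M = interval_measuresD[OF \<mu>]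
  let ?P = "PiM (verts F) (\<lambda>_. \<mu>)" and ?d = "2 / real N"
  interpret \<mu>: prob_space \<mu> by (rule M(1))
  interpret NN: pair_prob_space \<mu> \<mu> ..
  interpret P: prob_space ?P by (intro prob_space_PiM) (rule M(1))
  have e: "(\<lambda>x. fst (x i)) \<in> borel_measurable ?P" "(\<lambda>x. snd (x i)) \<in> borel_measurable ?P"
    if "i \<in> verts F" for i
    by (rule measurable_at_coordinate[OF measurable_endpoints(1)[OF M(2)] that],
        rule measurable_at_coordinate[OF measurable_endpoints(2)[OF M(2)] that])
  have unit: "fst (x i) \<in> {0..1}" if "x \<in> space ?P" "i \<in> verts F" for x i
  proof -
    have "x i \<in> intervals" using that by (auto simp: space_PiM M(3))
    then show ?thesis by (cases "x i") (auto simp: intervals_def)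
  qed
  have om: "overlap F \<in> borel_measurable ?P"
    by (intro overlap_measurable measurable_endpoints M(2))
  have sm: "soft_overlap N F \<in> borel_measurable ?P"
    unfolding soft_overlap_def[abs_def] case_prod_unfold
    by (intro borel_measurable_prod soft_le_measurable e) (use arcsD in auto)
  have oi: "integrable ?P (overlap F)"
    using om overlap_bounds[of F] by (intro P.integrable_const_bound[where B = 1]) auto
  have si: "integrable ?P (soft_overlap N F)"
  proof (rule P.integrable_const_bound[where B = 1, OF AE_I2 sm])
    fix x assume x: "x \<in> space ?P"
    have "0 \<le> soft_overlap N F x"
      unfolding soft_overlap_def using x by (auto intro!: prod_nonneg soft_le_bounds unit dest: arcsD)
    moreover have "soft_overlap N F x \<le> 1"
      unfolding soft_overlap_def using x by (auto intro!: prod_le_1 soft_le_bounds unit dest: arcsD)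
    ultimately show "norm (soft_overlap N F x) \<le> 1" by simp
  qed
  define B where "B e = {x \<in> space ?P. \<bar>fst (x (fst e)) - snd (x (snd e))\<bar> \<le> ?d}" for e
  have B: "B e \<in> sets ?P" "measure ?P (B e) \<le> 8 / real N" if "e \<in> arcs F" for e
  proof -
    have v: "fst e \<in> verts F" "snd e \<in> verts F" "fst e \<noteq> snd e" using arcsD[of "fst e" "snd e" F] that by auto
    note [measurable] = e(1)[OF v(1)] e(2)[OF v(2)]
    show "B e \<in> sets ?P" unfolding B_def by measurable
    let ?S = "{z \<in> space (\<mu> \<Otimes>\<^sub>M \<mu>). \<bar>fst (fst z) - snd (snd z)\<bar> \<le> ?d}"
    have S: "?S \<in> sets (\<mu> \<Otimes>\<^sub>M \<mu>)"
    proof -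
      have [measurable]: "fst \<in> borel_measurable \<mu>" "snd \<in> borel_measurable \<mu>"
        by (rule measurable_endpoints[OF M(2)])+
      show ?thesis by measurable
    qed
    have pm: "(\<lambda>x. (x (fst e), x (snd e))) \<in> ?P \<rightarrow>\<^sub>M \<mu> \<Otimes>\<^sub>M \<mu>"
      using v by (intro measurable_Pair measurable_component_singleton)
    have "measure (\<mu> \<Otimes>\<^sub>M \<mu>) ?S = measure (distr ?P (\<mu> \<Otimes>\<^sub>M \<mu>) (\<lambda>x. (x (fst e), x (snd e)))) ?S"
      unfolding pair_marginal_PiM[OF M(1) v] ..
    also have "\<dots> = measure ?P (B e)"
      unfolding measure_distr[OF pm S] B_def using measurable_space[OF pm]
      by (intro arg_cong[where f = "measure ?P"]) auto
    finally show "measure ?P (B e) \<le> 8 / real N"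
      using near_tie_probability[OF \<mu> tame, of ?d] by simp
  qed
  have "\<bar>(\<integral>x. overlap F x \<partial>?P) - (\<integral>x. soft_overlap N F x \<partial>?P)\<bar> \<le> (\<integral>x. \<bar>overlap F x - soft_overlap N F x\<bar> \<partial>?P)"
    unfolding Bochner_Integration.integral_diff[OF oi si, symmetric] by (rule integral_abs_bound)
  also have "\<dots> \<le> (\<integral>x. (\<Sum>e\<in>arcs F. indicator (B e) x) \<partial>?P)"
  proof (rule integral_mono)
    show "integrable ?P (\<lambda>x. \<bar>overlap F x - soft_overlap N F x\<bar>)" using oi si by auto
    show "integrable ?P (\<lambda>x. \<Sum>e\<in>arcs F. indicator (B e) x :: real)"
      using B(1) by (intro Bochner_Integration.integrable_sum) (auto simp: P.emeasure_eq_measure)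
    fix x assume x: "x \<in> space ?P"
    have "\<bar>overlap F x - soft_overlap N F x\<bar>
        \<le> (\<Sum>e\<in>arcs F. \<bar>of_bool (fst (x (fst e)) \<le> snd (x (snd e))) - soft_le N (fst (x (fst e))) (snd (x (snd e)))\<bar>)"
      unfolding overlap_def soft_overlap_def case_prod_unfold real_norm_def[symmetric]
    proof (rule norm_prod_diff)
      fix e assume "e \<in> arcs F"
      then have "fst e \<in> verts F" using arcsD[of "fst e" "snd e" F] by auto
      from soft_le_bounds[OF unit[OF x this]]
      show "norm (soft_le N (fst (x (fst e))) (snd (x (snd e)))) \<le> 1" by simp
    qed simp
    also have "\<dots> \<le> (\<Sum>e\<in>arcs F. indicator (B e) x)"
    proof (rule sum_mono)
      fix e assume "e \<in> arcs F"
      then have "fst e \<in> verts F" using arcsD[of "fst e" "snd e" F] by auto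
      from soft_le_error[OF unit[OF x this] N, of "snd (x (snd e))"]
      show "\<bar>of_bool (fst (x (fst e)) \<le> snd (x (snd e))) - soft_le N (fst (x (fst e))) (snd (x (snd e)))\<bar>
          \<le> indicator (B e) x"
        using x by (simp add: B_def indicator_def)
    qed
    finally show "\<bar>overlap F x - soft_overlap N F x\<bar> \<le> (\<Sum>e\<in>arcs F. indicator (B e) x)" .
  qed
  also have "\<dots> = (\<Sum>e\<in>arcs F. measure ?P (B e))"
    using B(1) by (subst Bochner_Integration.integral_sum) (auto simp: P.emeasure_eq_measure)
  also have "\<dots> \<le> (\<Sum>e\<in>arcs F. 8 / real N)" using B(2) by (rule sum_mono)
  finally show ?thesis unfolding interval_limit_eq[OF \<mu>] by (simp add: mult.commute)
qed

lemma continuous_map_interval_limit_at: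
  assumes "P \<subseteq> {\<mu> \<in> interval_measures. spread_endpoint \<mu>}"
  shows "continuous_map (subtopology weak_topology P) euclideanreal (\<lambda>\<mu>. interval_limit \<mu> F)"
proof -
  let ?Q = "\<lambda>N \<mu>. \<integral>x. soft_overlap N F x \<partial>PiM (verts F) (\<lambda>_. \<mu>)"
  have "continuous_map (subtopology weak_topology P) Met_TC.mtopology (\<lambda>\<mu>. interval_limit \<mu> F)"
  proof (rule Met_TC.continuous_map_uniform_limit[where F = sequentially and f = ?Q])
    show "\<forall>\<^sub>F N in sequentially. continuous_map (subtopology weak_topology P) Met_TC.mtopology (?Q N)"
      using continuous_map_from_subtopology[OF continuous_map_soft_overlap] by simp
    fix \<epsilon> :: real assume \<epsilon>: "0 < \<epsilon>"
    have "(\<lambda>N. (8 * real (card (arcs F))) * (1 / real N)) \<longlonglongrightarrow> (8 * real (card (arcs F))) * 0"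
      by (intro tendsto_mult tendsto_const lim_1_over_n)
    then have "\<forall>\<^sub>F N in sequentially. 8 * real (card (arcs F)) / real N < \<epsilon>"
      using \<epsilon> by (auto dest: order_tendstoD(2))
    then show "\<forall>\<^sub>F N in sequentially. \<forall>\<mu>\<in>topspace (subtopology weak_topology P).
        interval_limit \<mu> F \<in> UNIV \<and> dist (?Q N \<mu>) (interval_limit \<mu> F) < \<epsilon>"
      using eventually_gt_at_top[of 0]
    proof eventually_elim
      case (elim N)
      show ?case
      proof safe
        fix \<mu> assume "\<mu> \<in> topspace (subtopology weak_topology P)"
        then have "\<mu> \<in> interval_measures" "spread_endpoint \<mu>" using assms by auto
        from soft_overlap_error[OF this elim(2), of F] elim(1)
        show "dist (?Q N \<mu>) (interval_limit \<mu> F) < \<epsilon>" by (simp add: dist_real_def)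
      qed simp
    qed
  qed simp
  then show ?thesis by simp
qed

lemma measure_marginals:
  assumes "\<mu> \<in> interval_measures" "A \<in> sets unit_space"
  shows "measure (left_marginal \<mu>) A = measure \<mu> {x \<in> space \<mu>. fst x \<in> A}"
    and "measure (right_marginal \<mu>) A = measure \<mu> {x \<in> space \<mu>. snd x \<in> A}"
  unfolding left_marginal_def right_marginal_def
  using endpoints_in_unit_space[OF interval_measuresD(2)[OF assms(1)]] assms(2)
  by (auto simp: measure_distr intro!: arg_cong[where f = "measure \<mu>"])

lemma measure_lebesgue01_Icc_le: "s \<le> t \<Longrightarrow> measure lebesgue01 ({s..t} \<inter> {0..1}) \<le> t - s"
  by (subst measure_lebesgue01) (auto simp: Int_atLeastAtMost)

lemma spread_endpoint_if_normalized:
  assumes "P \<in> {interval_measures_L, interval_measures_R, interval_measures_m}"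
  shows "P \<subseteq> {\<mu> \<in> interval_measures. spread_endpoint \<mu>}"
proof
  fix \<mu> assume \<mu>P: "\<mu> \<in> P"
  then have \<mu>: "\<mu> \<in> interval_measures"
    using assms by (auto simp: interval_measures_L_def interval_measures_R_def interval_measures_m_def)
  note M = interval_measuresD[OF \<mu>]
  have A: "{s..t} \<inter> {0..1} \<in> sets unit_space" for s t :: real
    by (auto simp: sets_restrict_space_iff)
  have ends: "{x \<in> space \<mu>. fst x \<in> {s..t} \<inter> {0..1}} = {x \<in> space \<mu>. fst x \<in> {s..t}}"
    "{x \<in> space \<mu>. snd x \<in> {s..t} \<inter> {0..1}} = {x \<in> space \<mu>. snd x \<in> {s..t}}" for s t :: real
    by (auto simp: M(3) intervals_def)
  note marg = measure_marginals[OF \<mu> A, unfolded ends]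
  from assms consider "left_marginal \<mu> = lebesgue01" | "right_marginal \<mu> = lebesgue01"
    | "\<forall>A\<in>sets lebesgue01. (measure (left_marginal \<mu>) A + measure (right_marginal \<mu>) A) / 2 = measure lebesgue01 A"
    using \<mu>P by (auto simp: interval_measures_L_def interval_measures_R_def interval_measures_m_def)
  then have "spread_endpoint \<mu>"
  proof cases
    case 1
    have "measure \<mu> {x \<in> space \<mu>. fst x \<in> {s..t}} \<le> 2 * (t - s)" if "s \<le> t" for s t
      using measure_lebesgue01_Icc_le[OF that] that marg(1)[of s t] 1 by simp
    then show ?thesis unfolding spread_endpoint_def by blast
  next
    case 2
    have "measure \<mu> {x \<in> space \<mu>. snd x \<in> {s..t}} \<le> 2 * (t - s)" if "s \<le> t" for s t
      using measure_lebesgue01_Icc_le[OF that] that marg(2)[of s t] 2 by simp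
    then show ?thesis unfolding spread_endpoint_def by blast
  next
    case 3
    have "measure \<mu> {x \<in> space \<mu>. fst x \<in> {s..t}} \<le> 2 * (t - s)" if "s \<le> t" for s t
    proof -
      have "(measure (left_marginal \<mu>) ({s..t} \<inter> {0..1}) + measure (right_marginal \<mu>) ({s..t} \<inter> {0..1})) / 2 \<le> t - s"
        using 3 A[of s t] measure_lebesgue01_Icc_le[OF that] by (simp add: sets_lebesgue01)
      moreover have "0 \<le> measure (right_marginal \<mu>) ({s..t} \<inter> {0..1})" by simp
      ultimately have "measure (left_marginal \<mu>) ({s..t} \<inter> {0..1}) \<le> 2 * (t - s)" by argo
      then show ?thesis by (simp only: marg(1))
    qed
    then show ?thesis unfolding spread_endpoint_def by blast
  qed
  with \<mu> show "\<mu> \<in> {\<mu> \<in> interval_measures. spread_endpoint \<mu>}" by simp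
qed


section \<open>Weak sequential compactness\<close>

text \<open>The digits are 0 or 1 in base 4; the gaps between such numbers let the digits be read off
  continuously.\<close>

definition membership_code :: "(nat \<Rightarrow> 'a set) \<Rightarrow> 'a \<Rightarrow> real" where
  "membership_code D x = (\<Sum>k. of_bool (x \<in> D k) * (1 / 4) ^ k)"

lemma summable_quarter_digits:
  assumes "\<And>k. \<bar>d k\<bar> \<le> (1 :: real)"
  shows "summable (\<lambda>k. d k * (1 / 4) ^ k)"
proof (rule summable_comparison_test')
  show "summable (\<lambda>k. (1 / 4 :: real) ^ k)" by (rule summable_geometric) simp
  show "norm (d k * (1 / 4) ^ k) \<le> (1 / 4) ^ k" if "0 \<le> k" for k
    using mult_right_mono[OF assms[of k], of "(1 / 4) ^ k"] by (simp add: abs_mult power_abs)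
qed

lemma membership_code_bounds: "0 \<le> membership_code D x" "membership_code D x \<le> 4 / 3"
proof -
  have s: "summable (\<lambda>k. of_bool (x \<in> D k) * (1 / 4 :: real) ^ k)"
    by (rule summable_quarter_digits) auto
  show "0 \<le> membership_code D x"
    unfolding membership_code_def by (rule suminf_nonneg[OF s]) auto
  have "membership_code D x \<le> (\<Sum>k. (1 / 4 :: real) ^ k)"
    unfolding membership_code_def by (rule suminf_le[OF _ s]) (auto intro: summable_geometric)
  then show "membership_code D x \<le> 4 / 3" by (simp add: suminf_geometric)
qed

text \<open>The first digit in which two codes differ outweighs all later digits.\<close>

lemma close_codes_agree:
  assumes close: "\<bar>membership_code D x - membership_code D y\<bar> < (1 / 4) ^ m / 2" and k: "k \<le> m"
  shows "x \<in> D k \<longleftrightarrow> y \<in> D k"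
proof (rule ccontr)
  assume neq: "\<not> (x \<in> D k \<longleftrightarrow> y \<in> D k)"
  define d where "d j = (of_bool (x \<in> D j) - of_bool (y \<in> D j) :: real)" for j
  have d1: "\<bar>d j\<bar> \<le> 1" for j by (auto simp: d_def)
  define l where "l = (LEAST j. d j \<noteq> 0)"
  have "d k \<noteq> 0" using neq by (auto simp: d_def)
  then have l: "d l \<noteq> 0" "l \<le> k"
    unfolding l_def by (rule LeastI[of "\<lambda>j. d j \<noteq> 0"], rule Least_le[of "\<lambda>j. d j \<noteq> 0"])
  have below: "d j = 0" if "j < l" for j using not_less_Least[of j "\<lambda>j. d j \<noteq> 0"] that by (simp add: l_def)
  have dl: "\<bar>d l\<bar> = 1" using l(1) by (auto simp: d_def split: if_splits)
  have sd: "summable (\<lambda>j. d j * (1 / 4) ^ j)" by (rule summable_quarter_digits[OF d1])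
  have "membership_code D x - membership_code D y = (\<Sum>j. d j * (1 / 4) ^ j)"
    unfolding membership_code_def d_def left_diff_distrib
    by (rule suminf_diff) (rule summable_quarter_digits; simp)+
  also have "\<dots> = (\<Sum>j. d (j + Suc l) * (1 / 4) ^ (j + Suc l)) + (\<Sum>j<Suc l. d j * (1 / 4) ^ j)"
    by (rule suminf_split_initial_segment[OF sd])
  also have "(\<Sum>j<Suc l. d j * (1 / 4) ^ j) = d l * (1 / 4) ^ l"
    using below by simp
  finally have eq: "membership_code D x - membership_code D y
    = (\<Sum>j. d (j + Suc l) * (1 / 4) ^ (j + Suc l)) + d l * (1 / 4) ^ l" .
  have st: "summable (\<lambda>j. d (j + Suc l) * (1 / 4) ^ (j + Suc l))"
    using sd by (rule summable_ignore_initial_segment)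
  have tail: "\<bar>\<Sum>j. d (j + Suc l) * (1 / 4) ^ (j + Suc l)\<bar> \<le> (1 / 4) ^ l / 3"
  proof -
    have "\<bar>\<Sum>j. d (j + Suc l) * (1 / 4) ^ (j + Suc l)\<bar> \<le> (\<Sum>j. (1 / 4) ^ Suc l * (1 / 4 :: real) ^ j)"
      unfolding real_norm_def[symmetric]
    proof (rule norm_suminf_le)
      show "summable (\<lambda>j. (1 / 4) ^ Suc l * (1 / 4 :: real) ^ j)"
        by (intro summable_mult summable_geometric) simp
      show "norm (d (j + Suc l) * (1 / 4) ^ (j + Suc l)) \<le> (1 / 4) ^ Suc l * (1 / 4) ^ j" for j
        using mult_right_mono[OF d1[of "j + Suc l"], of "(1 / 4) ^ (j + Suc l)"]
        by (simp add: abs_mult power_abs power_add mult_ac)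
    qed
    also have "\<dots> = (1 / 4) ^ Suc l * (\<Sum>j. (1 / 4 :: real) ^ j)"
      by (rule suminf_mult) (auto intro: summable_geometric)
    also have "\<dots> = (1 / 4) ^ l / 3" by (simp add: suminf_geometric)
    finally show ?thesis .
  qed
  have head: "\<bar>d l * (1 / 4) ^ l\<bar> = (1 / 4) ^ l" using dl by (simp add: abs_mult)
  have separated: "2 / 3 * q \<le> \<bar>T + h\<bar>" if "\<bar>T\<bar> \<le> q / 3" "\<bar>h\<bar> = q" for T h q :: real
    using that by linarith
  have "2 / 3 * (1 / 4) ^ m \<le> (2 / 3 :: real) * (1 / 4) ^ l"
    using l(2) k by (intro mult_left_mono power_decreasing) auto
  also have "\<dots> \<le> \<bar>membership_code D x - membership_code D y\<bar>"
    unfolding eq by (rule separated[OF tail head])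
  also have "\<dots> < (1 / 4) ^ m / 2" by (rule close)
  finally have less: "2 / 3 * (1 / 4) ^ m < (1 / 4 :: real) ^ m / 2" .
  have half: "q / 2 \<le> 2 / 3 * q" if "0 < q" for q :: real using that by linarith
  have pos: "0 < (1 / 4 :: real) ^ m" by (rule zero_less_power) simp
  from leD[OF half[OF pos]] less show False by (rule notE)
qed

text \<open>Recording the membership in the sets of a countable base embeds a compact set into the real
  line by a Borel map whose inverse is uniformly continuous, because finitely many small base sets
  cover the compact set.\<close>

lemma ex_code_with_uniformly_continuous_inverse:
  fixes S :: "'a::euclidean_space set"
  assumes S: "compact S"
  obtains c :: "'a \<Rightarrow> real" where "c \<in> borel_measurable borel" "\<And>x. 0 \<le> c x \<and> c x \<le> 4 / 3"
    "\<And>\<epsilon>. \<epsilon> > 0 \<Longrightarrow> \<exists>\<delta>>0. \<forall>x\<in>S. \<forall>y\<in>S. \<bar>c x - c y\<bar> < \<delta> \<longrightarrow> dist x y < \<epsilon>"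
proof -
  obtain D :: "nat \<Rightarrow> 'a set" where D: "\<And>n. open (D n)" "\<And>U. open U \<Longrightarrow> \<exists>k. U = \<Union>{D n |n. n \<in> k}"
  proof (rule univ_second_countable_sequence)
    fix B :: "nat \<Rightarrow> 'a set"
    assume "\<And>n. open (B n)" "\<And>U. open U \<Longrightarrow> \<exists>k. U = \<Union>{B n |n. n \<in> k}"
    then show thesis by (rule that)
  qed
  let ?c = "membership_code D"
  have "?c \<in> borel_measurable borel"
  proof -
    have "(\<lambda>x. of_bool (x \<in> D k) * (1 / 4 :: real) ^ k) \<in> borel_measurable borel" for k
    proof -
      have "(\<lambda>x. indicator (D k) x * (1 / 4 :: real) ^ k) \<in> borel_measurable borel"
        using D(1)[of k] by (intro borel_measurable_times borel_measurable_indicator) auto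
      then show ?thesis by (simp add: indicator_def of_bool_def)
    qed
    then show ?thesis unfolding membership_code_def by (rule borel_measurable_suminf)
  qed
  moreover have "\<exists>\<delta>>0. \<forall>x\<in>S. \<forall>y\<in>S. \<bar>?c x - ?c y\<bar> < \<delta> \<longrightarrow> dist x y < \<epsilon>" if \<epsilon>: "\<epsilon> > 0" for \<epsilon>
  proof -
    have "\<exists>k. x \<in> D k \<and> D k \<subseteq> ball x (\<epsilon> / 2)" for x
    proof -
      obtain A where A: "ball x (\<epsilon> / 2) = \<Union>{D n |n. n \<in> A}" using D(2)[OF open_ball] by blast
      have "x \<in> ball x (\<epsilon> / 2)" using \<epsilon> by simp
      then obtain n where "n \<in> A" "x \<in> D n" unfolding A by blast
      then show ?thesis using A by blast
    qed
    then obtain \<kappa> where \<kappa>: "\<And>x. x \<in> D (\<kappa> x)" "\<And>x. D (\<kappa> x) \<subseteq> ball x (\<epsilon> / 2)" by metis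
    obtain T where T: "T \<subseteq> S" "finite T" "S \<subseteq> (\<Union>x\<in>T. D (\<kappa> x))"
    proof (rule compactE_image[OF S, of S "\<lambda>x. D (\<kappa> x)"])
      show "S \<subseteq> (\<Union>x\<in>S. D (\<kappa> x))" using \<kappa>(1) by blast
    qed (use D(1) in auto)
    define m where "m = (\<Sum>z\<in>T. \<kappa> z)"
    have m: "\<kappa> z \<le> m" if "z \<in> T" for z unfolding m_def using T(2) that by (intro member_le_sum) auto
    have "dist x y < \<epsilon>" if xy: "x \<in> S" "y \<in> S" "\<bar>?c x - ?c y\<bar> < (1 / 4) ^ m / 2" for x y
    proof -
      obtain z where z: "z \<in> T" "x \<in> D (\<kappa> z)" using T(3) xy(1) by blast
      then have "y \<in> D (\<kappa> z)" using close_codes_agree[OF xy(3) m[OF z(1)]] by simp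
      then have "dist z x < \<epsilon> / 2" "dist z y < \<epsilon> / 2" using z \<kappa>(2)[of z] by auto
      then show ?thesis by (metis dist_triangle_half_r)
    qed
    then show ?thesis by (intro exI[of _ "(1 / 4) ^ m / 2"]) auto
  qed
  ultimately show ?thesis using membership_code_bounds[of D] by (intro that[of ?c]) auto
qed

text \<open>Through the code, the selection theorem for distribution functions on the real line applies to
  measures on a compact set; the limit on the line lives on the closure of the codes and is
  transported back by the extended inverse.\<close>

lemma weak_sequential_compactness:
  fixes S :: "'a::euclidean_space set" and \<mu> :: "nat \<Rightarrow> 'a measure"
  assumes S: "compact S" and \<mu>: "\<And>n. prob_space (\<mu> n)"
    and sets_\<mu>: "\<And>n. sets (\<mu> n) = sets (restrict_space borel S)"
  shows "\<exists>r \<nu>. strict_mono (r :: nat \<Rightarrow> nat) \<and> prob_space \<nu> \<and> sets \<nu> = sets (restrict_space borel S) \<and>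
    (\<forall>f :: 'a \<Rightarrow> real. continuous_on S f \<longrightarrow> (\<lambda>n. \<integral>x. f x \<partial>\<mu> (r n)) \<longlonglongrightarrow> (\<integral>x. f x \<partial>\<nu>))"
proof -
  obtain c :: "'a \<Rightarrow> real" where c [measurable]: "c \<in> borel_measurable borel"
    and c01: "\<And>x. 0 \<le> c x \<and> c x \<le> 4 / 3"
    and c_unif: "\<And>\<epsilon>. \<epsilon> > 0 \<Longrightarrow> \<exists>\<delta>>0. \<forall>x\<in>S. \<forall>y\<in>S. \<bar>c x - c y\<bar> < \<delta> \<longrightarrow> dist x y < \<epsilon>"
    using ex_code_with_uniformly_continuous_inverse[OF S] by metis
  have space_\<mu>: "space (\<mu> n) = S" for n
    using sets_eq_imp_space_eq[OF sets_\<mu>] by (simp add: space_restrict_space)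
  have c\<mu>: "c \<in> borel_measurable (\<mu> n)" for n
    unfolding measurable_cong_sets[OF sets_\<mu> refl] by (rule measurable_restrict_space1[OF c])
  define X where "X = c ` S"
  define K where "K = closure X"
  have inj: "inj_on c S"
  proof (rule inj_onI)
    fix x y assume xy: "x \<in> S" "y \<in> S" "c x = c y"
    have "dist x y < \<epsilon>" if "\<epsilon> > 0" for \<epsilon> using c_unif[OF that] xy by force
    then show "x = y" by (metis dist_pos_lt less_irrefl)
  qed
  have "uniformly_continuous_on X (inv_into S c)"
    unfolding uniformly_continuous_on_def
  proof (intro allI impI)
    fix \<epsilon> :: real assume "\<epsilon> > 0"
    from c_unif[OF this] obtain \<delta> where \<delta>: "\<delta> > 0" "\<And>x y. x \<in> S \<Longrightarrow> y \<in> S \<Longrightarrow> \<bar>c x - c y\<bar> < \<delta> \<Longrightarrow> dist x y < \<epsilon>"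
      by blast
    have "dist (inv_into S c v) (inv_into S c u) < \<epsilon>" if "u \<in> X" "v \<in> X" "dist v u < \<delta>" for u v
      using that inj by (auto simp: X_def dist_real_def intro!: \<delta>(2))
    then show "\<exists>d>0. \<forall>x\<in>X. \<forall>x'\<in>X. dist x' x < d \<longrightarrow> dist (inv_into S c x') (inv_into S c x) < \<epsilon>"
      using \<delta>(1) by blast
  qed
  then obtain g where g: "uniformly_continuous_on K g" "\<And>x. x \<in> X \<Longrightarrow> inv_into S c x = g x"
  proof (rule uniformly_continuous_on_extension_on_closure)
    fix g assume "uniformly_continuous_on (closure X) g" "\<And>x. x \<in> X \<Longrightarrow> inv_into S c x = g x"
    then show thesis by (intro that[of g]) (simp_all add: K_def)
  qed
  have gc: "g (c x) = x" if "x \<in> S" for x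
    using g(2)[of "c x"] inj that by (simp add: X_def)
  have g_cont: "continuous_on K g" by (rule uniformly_continuous_imp_continuous[OF g(1)])
  have gS: "g x \<in> S" if "x \<in> K" for x
  proof -
    have "g ` closure X \<subseteq> S"
      using g_cont gc compact_imp_closed[OF S] by (intro image_closure_subset) (auto simp: X_def K_def)
    then show ?thesis using that by (auto simp: K_def)
  qed
  have closed_K: "closed K" by (simp add: K_def)
  have cK: "c x \<in> K" if "x \<in> S" for x using that closure_subset[of X] by (auto simp: K_def X_def)
  interpret \<mu>0: prob_space "\<mu> 0" by (rule \<mu>)
  obtain s where s: "s \<in> S" using \<mu>0.not_empty space_\<mu> by auto
  have K_ne: "K \<noteq> {}" using cK[OF s] by auto

  define \<rho> where "\<rho> n = distr (\<mu> n) borel c" for n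
  have \<rho>: "real_distribution (\<rho> n)" for n
    unfolding \<rho>_def
    by (auto simp: real_distribution_def real_distribution_axioms_def intro!: prob_space.prob_space_distr \<mu> c\<mu>)
  have "tight \<rho>"
    unfolding tight_def
  proof (intro conjI allI impI \<rho>)
    fix \<epsilon> :: real assume \<epsilon>: "\<epsilon> > 0"
    have "measure (\<rho> n) {-1<..2} = 1" for n
    proof -
      have "c -` {-1<..2} \<inter> space (\<mu> n) = space (\<mu> n)"
        using c01 by (force simp: less_le_trans[of "-1" 0] order.trans[of _ "4/3" 2])
      then show ?thesis
        using prob_space.prob_space[OF \<mu>, of n] by (simp add: \<rho>_def measure_distr[OF c\<mu>])
    qed
    then show "\<exists>a b. a < b \<and> (\<forall>n. 1 - \<epsilon> < measure (\<rho> n) {a<..b})"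
      using \<epsilon> by (intro exI[of _ "-1"] exI[of _ 2]) auto
  qed
  from tight_imp_convergent_subsubsequence[OF this strict_mono_id]
  obtain r M where r: "strict_mono (r :: nat \<Rightarrow> nat)" and M: "real_distribution M"
    and conv: "weak_conv_m (\<rho> \<circ> id \<circ> r) M" by blast
  interpret M: real_distribution M by (rule M)
  have conv_int: "(\<lambda>n. \<integral>x. F (c x) \<partial>\<mu> (r n)) \<longlonglongrightarrow> (\<integral>t. F t \<partial>M)"
    if F: "continuous_on UNIV F" "\<And>t. norm (F t) \<le> B" for F :: "real \<Rightarrow> real" and B
  proof -
    have "(\<lambda>n. \<integral>t. F t \<partial>(\<rho> \<circ> id \<circ> r) n) \<longlonglongrightarrow> (\<integral>t. F t \<partial>M)"
    proof (rule weak_conv_imp_integral_bdd_continuous_conv[OF _ M conv])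
      show "real_distribution ((\<rho> \<circ> id \<circ> r) n)" for n by (simp add: \<rho>)
      show "isCont F t" for t using F(1) by (simp add: continuous_on_eq_continuous_at)
      show "norm (F t) \<le> B" for t by (rule F(2))
    qed
    moreover have "(\<integral>t. F t \<partial>(\<rho> \<circ> id \<circ> r) n) = (\<integral>x. F (c x) \<partial>\<mu> (r n))" for n
      using borel_measurable_continuous_onI[OF F(1)] by (simp add: \<rho>_def integral_distr[OF c\<mu>])
    ultimately show ?thesis by simp
  qed

  have AE_K: "AE t in M. t \<in> K"
  proof -
    let ?F = "\<lambda>t. min 1 (infdist t K)"
    have F: "continuous_on UNIV ?F" by (intro continuous_intros)
    have F1: "norm (?F t) \<le> 1" for t using infdist_nonneg[of t K] by simp
    have "(\<lambda>n. \<integral>x. ?F (c x) \<partial>\<mu> (r n)) \<longlonglongrightarrow> (\<integral>t. ?F t \<partial>M)"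
      by (rule conv_int[OF F F1])
    moreover have "(\<integral>x. ?F (c x) \<partial>\<mu> (r n)) = (\<integral>x. 0 \<partial>\<mu> (r n))" for n
      using cK by (intro Bochner_Integration.integral_cong) (auto simp: space_\<mu>)
    ultimately have "(\<integral>t. ?F t \<partial>M) = 0" by (simp add: LIMSEQ_const_iff)
    moreover have "integrable M ?F"
      using F1 borel_measurable_continuous_onI[OF F]
      by (intro M.integrable_const_bound[where B = 1]) auto
    ultimately have "AE t in M. ?F t = 0"
      using infdist_nonneg by (subst (asm) integral_nonneg_eq_0_iff_AE) auto
    then show ?thesis
    proof eventually_elim
      case (elim t)
      then have "infdist t K = 0" by (auto simp: min_def split: if_splits)
      then show ?case using in_closed_iff_infdist_zero[OF closed_K K_ne] by blast
    qed
  qed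

  define \<gamma> where "\<gamma> t = (if t \<in> K then g t else s)" for t
  have K_sets: "K \<in> sets borel" using closed_K by simp
  have \<gamma>: "\<gamma> \<in> M \<rightarrow>\<^sub>M restrict_space borel S"
  proof (rule measurable_restrict_space2)
    show "\<gamma> \<in> space M \<rightarrow> S" using gS s by (auto simp: \<gamma>_def)
    have "(\<lambda>t. if t \<in> K then g t else s) \<in> borel \<rightarrow>\<^sub>M borel"
      using K_sets borel_measurable_continuous_on_restrict[OF g_cont]
      by (subst measurable_If_restrict_space_iff) auto
    then show "\<gamma> \<in> borel_measurable M" unfolding \<gamma>_def by (simp add: measurable_cong_sets[OF M.events_eq_borel refl])
  qed
  define \<nu> where "\<nu> = distr M (restrict_space borel S) \<gamma>"
  have "(\<lambda>n. \<integral>x. f x \<partial>\<mu> (r n)) \<longlonglongrightarrow> (\<integral>x. f x \<partial>\<nu>)" if f: "continuous_on S f" for f :: "'a \<Rightarrow> real"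
  proof -
    have fg: "continuous_on K (\<lambda>t. f (g t))"
      using continuous_on_compose2[OF f g_cont] gS by blast
    obtain B where B: "\<And>x. x \<in> S \<Longrightarrow> norm (f x) \<le> B"
      using compact_imp_bounded[OF compact_continuous_image[OF f S]] by (auto simp: bounded_iff)
    then have "0 \<le> B" using s norm_ge_zero order.trans by metis
    obtain F where F: "continuous_on UNIV F" "\<And>t. t \<in> K \<Longrightarrow> F t = f (g t)" "\<And>t. t \<in> UNIV \<Longrightarrow> norm (F t) \<le> B"
    proof (rule Tietze[OF fg, of UNIV B])
      show "closedin (top_of_set UNIV) K" using closed_K by simp
      show "norm (f (g t)) \<le> B" if "t \<in> K" for t by (rule B[OF gS[OF that]])
      fix F assume "continuous_on UNIV F" "\<And>t. t \<in> K \<Longrightarrow> F t = f (g t)" "\<And>t. t \<in> UNIV \<Longrightarrow> norm (F t) \<le> B"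
      then show thesis by (rule that)
    qed (rule \<open>0 \<le> B\<close>)
    have "(\<lambda>n. \<integral>x. F (c x) \<partial>\<mu> (r n)) \<longlonglongrightarrow> (\<integral>t. F t \<partial>M)" using F by (intro conv_int) auto
    moreover have "(\<integral>x. F (c x) \<partial>\<mu> n) = (\<integral>x. f x \<partial>\<mu> n)" for n
      using F(2) cK gc by (intro Bochner_Integration.integral_cong) (auto simp: space_\<mu>)
    moreover have "(\<integral>x. f x \<partial>\<nu>) = (\<integral>t. F t \<partial>M)"
    proof -
      have fm: "f \<in> borel_measurable (restrict_space borel S)"
        by (rule borel_measurable_continuous_on_restrict[OF f])
      have "(\<integral>x. f x \<partial>\<nu>) = (\<integral>t. f (\<gamma> t) \<partial>M)" unfolding \<nu>_def by (rule integral_distr[OF \<gamma> fm])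
      also have "\<dots> = (\<integral>t. F t \<partial>M)"
      proof (rule integral_cong_AE)
        show "(\<lambda>t. f (\<gamma> t)) \<in> borel_measurable M" by (rule measurable_compose[OF \<gamma> fm])
        show "F \<in> borel_measurable M" using borel_measurable_continuous_onI[OF F(1)] by simp
        show "AE t in M. f (\<gamma> t) = F t" using AE_K by eventually_elim (simp add: \<gamma>_def F(2))
      qed
      finally show ?thesis .
    qed
    ultimately show ?thesis by simp
  qed
  moreover have "prob_space \<nu>" unfolding \<nu>_def by (rule M.prob_space_distr[OF \<gamma>])
  moreover have "sets \<nu> = sets (restrict_space borel S)" by (simp add: \<nu>_def)
  ultimately show ?thesis using r by blast
qed

lemma limitin_weak_topology:
  assumes "\<And>n. \<mu> n \<in> interval_measures" "\<nu> \<in> interval_measures"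
    and conv: "\<And>f :: real \<times> real \<Rightarrow> real. continuous_on intervals f \<Longrightarrow> (\<lambda>n. \<integral>x. f x \<partial>\<mu> n) \<longlonglongrightarrow> (\<integral>x. f x \<partial>\<nu>)"
  shows "limitin weak_topology \<mu> \<nu> sequentially"
proof -
  let ?C = "{f :: real \<times> real \<Rightarrow> real. continuous_on intervals f}"
  let ?\<Phi> = "\<lambda>\<mu>. \<lambda>f\<in>?C. \<integral>x. f x \<partial>\<mu>" and ?T = "product_topology (\<lambda>_. euclideanreal) ?C"
  have lim: "limitin ?T (\<lambda>n. ?\<Phi> (\<mu> n)) (?\<Phi> \<nu>) sequentially"
    using conv by (auto simp: limitin_componentwise)
  show ?thesis
    unfolding limitin_def
  proof (intro conjI allI impI)
    show "\<nu> \<in> topspace weak_topology" using assms by (simp add: topspace_weak_topology)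
    fix U assume U: "openin weak_topology U \<and> \<nu> \<in> U"
    then obtain V where V: "openin ?T V" "U = ?\<Phi> -` V \<inter> interval_measures"
      unfolding weak_topology_def Let_def openin_pullback_topology by blast
    then have "\<forall>\<^sub>F n in sequentially. ?\<Phi> (\<mu> n) \<in> V"
      using lim U unfolding limitin_def by blast
    then show "\<forall>\<^sub>F n in sequentially. \<mu> n \<in> U"
      by eventually_elim (simp add: V(2) assms(1))
  qed
qed

lemma left_distribution_function_bounds:
  assumes \<mu>: "\<mu> \<in> interval_measures" and \<delta>: "\<delta> > 0"
  shows "measure \<mu> {x \<in> space \<mu>. fst x \<le> s} \<le> (\<integral>x. max 0 (min 1 ((s + \<delta> - fst x) / \<delta>)) \<partial>\<mu>)"
    and "(\<integral>x. max 0 (min 1 ((s + \<delta> - fst x) / \<delta>)) \<partial>\<mu>) \<le> measure \<mu> {x \<in> space \<mu>. fst x \<le> s + \<delta>}"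
proof -
  note M = interval_measuresD[OF \<mu>]
  interpret \<mu>: prob_space \<mu> by (rule M(1))
  have [measurable]: "fst \<in> borel_measurable \<mu>" by (rule measurable_endpoints(1)[OF M(2)])
  have i: "integrable \<mu> (\<lambda>x. max 0 (min 1 ((s + \<delta> - fst x) / \<delta>)))"
    by (rule integrable_continuous_on_intervals[OF \<mu>]) (intro continuous_intros; use \<delta> in simp)
  have int: "measure \<mu> {x \<in> space \<mu>. fst x \<le> t} = (\<integral>x. indicator {x \<in> space \<mu>. fst x \<le> t} x \<partial>\<mu>)"
    "integrable \<mu> (\<lambda>x. indicator {x \<in> space \<mu>. fst x \<le> t} x :: real)" for t
    by (auto simp: \<mu>.emeasure_eq_measure)
  show "measure \<mu> {x \<in> space \<mu>. fst x \<le> s} \<le> (\<integral>x. max 0 (min 1 ((s + \<delta> - fst x) / \<delta>)) \<partial>\<mu>)"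
    unfolding int(1) using \<delta> by (intro integral_mono int(2) i) (auto simp: indicator_def field_simps)
  show "(\<integral>x. max 0 (min 1 ((s + \<delta> - fst x) / \<delta>)) \<partial>\<mu>) \<le> measure \<mu> {x \<in> space \<mu>. fst x \<le> s + \<delta>}"
    unfolding int(1) using \<delta> by (intro integral_mono int(2) i) (auto simp: indicator_def field_simps)
qed

lemma left_normalized_distribution_function:
  assumes \<mu>: "\<mu> \<in> interval_measures_L" and t: "0 \<le> t" "t \<le> 1"
  shows "measure \<mu> {x \<in> space \<mu>. fst x \<le> t} = t"
proof -
  have \<mu>P: "\<mu> \<in> interval_measures" and left: "left_marginal \<mu> = lebesgue01"
    using \<mu> by (auto simp: interval_measures_L_def)
  have "measure \<mu> {x \<in> space \<mu>. fst x \<le> t} = measure \<mu> {x \<in> space \<mu>. fst x \<in> {0..t}}"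
    by (intro arg_cong[where f = "measure \<mu>"]) (auto simp: interval_measuresD(3)[OF \<mu>P] intervals_def)
  also have "\<dots> = measure lebesgue01 {0..t}"
    using measure_marginals(1)[OF \<mu>P, of "{0..t}"] t left by (simp add: sets_restrict_space_iff)
  also have "\<dots> = t" using t by (subst measure_lebesgue01) auto
  finally show ?thesis .
qed

text \<open>Distribution functions cannot be passed to a weak limit directly, but continuous ramps that
  enclose them can; the ramps are evaluated along the sequence, where the distribution function is the
  identity, and their width tends to 0.\<close>

lemma left_normalized_closed:
  assumes \<mu>: "\<And>n. \<mu> n \<in> interval_measures_L" and \<nu>: "\<nu> \<in> interval_measures"
    and conv: "\<And>f :: real \<times> real \<Rightarrow> real. continuous_on intervals f \<Longrightarrow> (\<lambda>n. \<integral>x. f x \<partial>\<mu> n) \<longlonglongrightarrow> (\<integral>x. f x \<partial>\<nu>)"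
  shows "\<nu> \<in> interval_measures_L"
proof -
  note M = interval_measuresD[OF \<nu>]
  interpret \<nu>: prob_space \<nu> by (rule M(1))
  have [measurable]: "fst \<in> borel_measurable \<nu>" by (rule measurable_endpoints(1)[OF M(2)])
  have \<mu>P: "\<mu> n \<in> interval_measures" for n using \<mu>[of n] by (simp add: interval_measures_L_def)
  have upper: "measure \<nu> {x \<in> space \<nu>. fst x \<le> t} \<le> t" if t: "0 < t" "t < 1" for t
  proof (rule field_le_epsilon)
    fix e :: real assume e: "e > 0"
    define \<delta> where "\<delta> = min e (1 - t)"
    have \<delta>: "\<delta> > 0" "\<delta> \<le> e" "t + \<delta> \<le> 1" using t e by (auto simp: \<delta>_def)
    have "measure \<nu> {x \<in> space \<nu>. fst x \<le> t} \<le> (\<integral>x. max 0 (min 1 ((t + \<delta> - fst x) / \<delta>)) \<partial>\<nu>)"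
      by (rule left_distribution_function_bounds(1)[OF \<nu> \<delta>(1)])
    also have "\<dots> \<le> t + \<delta>"
    proof (rule LIMSEQ_le_const2[OF conv])
      show "continuous_on intervals (\<lambda>x. max 0 (min 1 ((t + \<delta> - fst x) / \<delta>)))"
        using \<delta>(1) by (intro continuous_intros) auto
      show "\<exists>N. \<forall>n\<ge>N. (\<integral>x. max 0 (min 1 ((t + \<delta> - fst x) / \<delta>)) \<partial>\<mu> n) \<le> t + \<delta>"
        using left_distribution_function_bounds(2)[OF \<mu>P \<delta>(1), where s = t]
          left_normalized_distribution_function[OF \<mu>, where t = "t + \<delta>"] t \<delta> by auto
    qed
    finally show "measure \<nu> {x \<in> space \<nu>. fst x \<le> t} \<le> t + e" using \<delta>(2) by simp
  qed
  have lower: "t \<le> measure \<nu> {x \<in> space \<nu>. fst x \<le> t}" if t: "0 < t" "t < 1" for t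
  proof (rule field_le_epsilon)
    fix e :: real assume e: "e > 0"
    define \<delta> where "\<delta> = min e t"
    have \<delta>: "\<delta> > 0" "\<delta> \<le> e" "\<delta> \<le> t" using t e by (auto simp: \<delta>_def)
    have "t - \<delta> \<le> (\<integral>x. max 0 (min 1 ((t - \<delta> + \<delta> - fst x) / \<delta>)) \<partial>\<nu>)"
    proof (rule LIMSEQ_le_const[OF conv])
      show "continuous_on intervals (\<lambda>x. max 0 (min 1 ((t - \<delta> + \<delta> - fst x) / \<delta>)))"
        using \<delta>(1) by (intro continuous_intros) auto
      show "\<exists>N. \<forall>n\<ge>N. t - \<delta> \<le> (\<integral>x. max 0 (min 1 ((t - \<delta> + \<delta> - fst x) / \<delta>)) \<partial>\<mu> n)"
        using left_distribution_function_bounds(1)[OF \<mu>P \<delta>(1), where s = "t - \<delta>"]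
          left_normalized_distribution_function[OF \<mu>, where t = "t - \<delta>"] t \<delta> by auto
    qed
    also have "\<dots> \<le> measure \<nu> {x \<in> space \<nu>. fst x \<le> t - \<delta> + \<delta>}"
      by (rule left_distribution_function_bounds(2)[OF \<nu> \<delta>(1)])
    finally show "t \<le> measure \<nu> {x \<in> space \<nu>. fst x \<le> t} + e" using \<delta>(2) by simp
  qed
  have fst_unit: "fst \<in> \<nu> \<rightarrow>\<^sub>M unit_space" by (rule endpoints_in_unit_space(1)[OF M(2)])
  have marg: "measure (left_marginal \<nu>) {x \<in> space (left_marginal \<nu>). Q x} = measure \<nu> {x \<in> space \<nu>. Q (fst x)}"
    if "{x \<in> {0..1}. Q x} \<in> sets unit_space" for Q
    using that measurable_space[OF fst_unit]
    by (simp add: left_marginal_def space_restrict_space measure_distr[OF fst_unit])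
       (auto intro!: arg_cong[where f = "measure \<nu>"] simp: space_restrict_space)
  have "left_marginal \<nu> = lebesgue01"
  proof (rule lebesgue01_eqI)
    show "prob_space (left_marginal \<nu>)" unfolding left_marginal_def by (rule \<nu>.prob_space_distr[OF fst_unit])
    show "sets (left_marginal \<nu>) = sets unit_space" by (simp add: left_marginal_def)
    fix t :: real assume t: "0 < t" "t < 1"
    have "measure \<nu> {x \<in> space \<nu>. fst x < t} \<le> measure \<nu> {x \<in> space \<nu>. fst x \<le> t}"
      by (intro \<nu>.finite_measure_mono) auto
    also have "\<dots> \<le> t" by (rule upper[OF t])
    finally show "measure (left_marginal \<nu>) {x \<in> space (left_marginal \<nu>). x < t} \<le> t"
      by (subst marg) (auto simp: sets_restrict_space_iff)
    show "t \<le> measure (left_marginal \<nu>) {x \<in> space (left_marginal \<nu>). x \<le> t}"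
      using lower[OF t] by (subst marg) (auto simp: sets_restrict_space_iff)
  qed
  with \<nu> show ?thesis by (simp add: interval_measures_L_def)
qed

section \<open>Limits of interval graphs\<close>

text \<open>Left-normalized empirical measures have a left-normalized weak limit point, at which the densities
  are continuous.\<close>

lemma interval_graph_limit_is_left_normalized:
  assumes "\<Gamma> \<in> interval_graph_limits"
  shows "\<exists>\<nu>\<in>interval_measures_L. interval_limit \<nu> = \<Gamma>"
proof -
  obtain G where G: "\<And>n. interval_graph (G n)" and G_tendsto: "graph_tendsto G \<Gamma>"
    using assms by (auto simp: interval_graph_limits_def)
  then have card: "filterlim (\<lambda>n. card (verts (G n))) at_top sequentially"
    and lim: "\<And>F. (\<lambda>n. hom_density F (G n)) \<longlonglongrightarrow> \<Gamma> F"
    by (auto simp: graph_tendsto_def)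
  \<comment> \<open>the shift by \<open>n0\<close> skips the graphs without vertices, which have no empirical measure\<close>
  obtain n0 where n0: "\<And>n. n \<ge> n0 \<Longrightarrow> card (verts (G n)) \<ge> 1"
    using card unfolding filterlim_at_top eventually_sequentially by blast
  have "\<exists>\<nu>\<in>interval_measures_L. \<forall>F. \<bar>hom_density F (G (n + n0)) - interval_limit \<nu> F\<bar>
      \<le> (real (card (verts F)))\<^sup>2 / real (card (verts (G (n + n0))))" for n
  proof -
    have "verts (G (n + n0)) \<noteq> {}" using n0[of "n + n0"] by auto
    then obtain \<nu> where \<nu>: "\<nu> \<in> interval_measures"
      "\<And>F. \<bar>hom_density F (G (n + n0)) - interval_limit \<nu> F\<bar>
        \<le> (real (card (verts F)))\<^sup>2 / real (card (verts (G (n + n0))))"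
      by (rule interval_graph_near_empirical_limit[OF G]) auto
    obtain \<nu>' where "\<nu>' \<in> interval_measures_L" "interval_limit \<nu>' = interval_limit \<nu>"
      using ex_left_normalized[OF \<nu>(1)] by blast
    then show ?thesis using \<nu>(2) by (intro bexI[of _ \<nu>']) simp_all
  qed
  then obtain \<nu> where \<nu>: "\<And>n. \<nu> n \<in> interval_measures_L"
    "\<And>n F. \<bar>hom_density F (G (n + n0)) - interval_limit (\<nu> n) F\<bar>
      \<le> (real (card (verts F)))\<^sup>2 / real (card (verts (G (n + n0))))"
    by metis
  have \<nu>P: "\<nu> n \<in> interval_measures" for n using \<nu>(1)[of n] by (simp add: interval_measures_L_def)
  obtain r :: "nat \<Rightarrow> nat" and \<mu> :: "(real \<times> real) measure" where *: "strict_mono r \<and> prob_space \<mu> \<and>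
      sets \<mu> = sets interval_space \<and> (\<forall>f :: real \<times> real \<Rightarrow> real. continuous_on intervals f \<longrightarrow>
        (\<lambda>n. \<integral>x. f x \<partial>\<nu> (r n)) \<longlonglongrightarrow> (\<integral>x. f x \<partial>\<mu>))"
    using weak_sequential_compactness[of intervals \<nu>, OF compact_intervals
        interval_measuresD(1)[OF \<nu>P] interval_measuresD(2)[OF \<nu>P]] by (elim exE)
  then have r: "strict_mono r" and \<mu>: "prob_space \<mu>" "sets \<mu> = sets interval_space"
    by simp_all
  have conv: "(\<lambda>n. \<integral>x. f x \<partial>\<nu> (r n)) \<longlonglongrightarrow> (\<integral>x. f x \<partial>\<mu>)" if "continuous_on intervals f"
    for f :: "real \<times> real \<Rightarrow> real"
    using * that by simp
  have \<mu>P: "\<mu> \<in> interval_measures" using \<mu> by (simp add: interval_measures_def)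
  have \<mu>L: "\<mu> \<in> interval_measures_L"
    by (rule left_normalized_closed[OF \<nu>(1) \<mu>P conv])
  have lim': "limitin (subtopology weak_topology interval_measures_L) (\<lambda>n. \<nu> (r n)) \<mu> sequentially"
    using limitin_weak_topology[OF \<nu>P \<mu>P conv] \<mu>L \<nu>(1) by (simp add: limitin_subtopology)
  have cont: "continuous_map (subtopology weak_topology interval_measures_L) euclideanreal (\<lambda>\<mu>. interval_limit \<mu> F)" for F
    by (intro continuous_map_interval_limit_at spread_endpoint_if_normalized) simp
  have 1: "(\<lambda>n. interval_limit (\<nu> (r n)) F) \<longlonglongrightarrow> interval_limit \<mu> F" for F
    using continuous_map_limit[OF cont lim', of F] by (simp add: comp_def)
  have 2: "(\<lambda>n. interval_limit (\<nu> (r n)) F) \<longlonglongrightarrow> \<Gamma> F" for F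
  proof -
    have sub: "filterlim (\<lambda>n. r n + n0) at_top sequentially"
      using filterlim_subseq[OF r] by (rule filterlim_at_top_mono) auto
    have h: "(\<lambda>n. hom_density F (G (r n + n0))) \<longlonglongrightarrow> \<Gamma> F"
      by (rule filterlim_compose[OF lim sub])
    have "filterlim (\<lambda>n. real (card (verts (G (r n + n0))))) at_top sequentially"
      by (rule filterlim_compose[OF filterlim_real_sequentially filterlim_compose[OF card sub]])
    then have z: "(\<lambda>n. (real (card (verts F)))\<^sup>2 / real (card (verts (G (r n + n0))))) \<longlonglongrightarrow> 0"
      by (rule real_tendsto_divide_at_top[OF tendsto_const])
    have "(\<lambda>n. interval_limit (\<nu> (r n)) F - hom_density F (G (r n + n0))) \<longlonglongrightarrow> 0"
      by (rule Lim_null_comparison[OF _ z]) (use \<nu>(2) in \<open>simp add: abs_minus_commute\<close>)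
    from tendsto_add[OF this h] show ?thesis by simp
  qed
  have "interval_limit \<mu> = \<Gamma>" using LIMSEQ_unique[OF 1 2] by blast
  with \<mu>L show ?thesis by blast
qed

theorem theorem3p1:
  shows "interval_graph_limits = interval_limit ` interval_measures
    \<and> interval_graph_limits = interval_limit ` interval_measures_L
    \<and> interval_graph_limits = interval_limit ` interval_measures_R
    \<and> interval_graph_limits = interval_limit ` interval_measures_m
    \<and> (\<forall>P \<in> {interval_measures_L, interval_measures_R, interval_measures_m}.
          continuous_map (subtopology weak_topology P)
            (subtopology graph_limit_topology interval_graph_limits) interval_limit
          \<and> interval_limit ` P = interval_graph_limits)"
proof -
  have sub: "interval_measures_L \<subseteq> interval_measures" "interval_measures_R \<subseteq> interval_measures"
    "interval_measures_m \<subseteq> interval_measures"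
    by (auto simp: interval_measures_L_def interval_measures_R_def interval_measures_m_def)
  have P: "interval_limit ` interval_measures \<subseteq> interval_graph_limits"
    using interval_limit_is_interval_graph_limit by blast
  have L: "interval_graph_limits \<subseteq> interval_limit ` interval_measures_L"
    using interval_graph_limit_is_left_normalized by blast
  have R: "interval_graph_limits \<subseteq> interval_limit ` interval_measures_R"
  proof
    fix \<Gamma> assume "\<Gamma> \<in> interval_graph_limits"
    then obtain \<mu> where "\<mu> \<in> interval_measures" "\<Gamma> = interval_limit \<mu>" using L sub(1) by blast
    then obtain \<nu> where "\<nu> \<in> interval_measures_R" "\<Gamma> = interval_limit \<nu>"
      using ex_right_normalized[of \<mu>] by auto
    then show "\<Gamma> \<in> interval_limit ` interval_measures_R" by blast
  qed
  have m: "interval_graph_limits \<subseteq> interval_limit ` interval_measures_m"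
  proof
    fix \<Gamma> assume "\<Gamma> \<in> interval_graph_limits"
    then obtain \<mu> where "\<mu> \<in> interval_measures_L" "\<Gamma> = interval_limit \<mu>" using L by blast
    then obtain \<nu> where "\<nu> \<in> interval_measures_m" "\<Gamma> = interval_limit \<nu>"
      using ex_average_normalized[of \<mu>] by auto
    then show "\<Gamma> \<in> interval_limit ` interval_measures_m" by blast
  qed
  have eq: "interval_limit ` interval_measures = interval_graph_limits"
    "interval_limit ` interval_measures_L = interval_graph_limits"
    "interval_limit ` interval_measures_R = interval_graph_limits"
    "interval_limit ` interval_measures_m = interval_graph_limits"
    using P L R m sub by blast+
  have cont: "continuous_map (subtopology weak_topology Q)
      (subtopology graph_limit_topology interval_graph_limits) interval_limit"
    if Q: "Q \<in> {interval_measures_L, interval_measures_R, interval_measures_m}" for Q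
  proof -
    have "interval_limit ` Q \<subseteq> interval_graph_limits" using Q eq by blast
    moreover have "interval_graph_limits \<subseteq> graph_limits" by (auto simp: interval_graph_limits_def)
    moreover have "continuous_map (subtopology weak_topology Q) euclideanreal (\<lambda>\<mu>. interval_limit \<mu> F)" for F
      by (rule continuous_map_interval_limit_at[OF spread_endpoint_if_normalized[OF Q]])
    ultimately show ?thesis
      unfolding graph_limit_topology_def
      by (auto simp: continuous_map_in_subtopology continuous_map_componentwise_UNIV)
  qed
  show ?thesis using eq cont by auto
qed

end
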